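(* Let $\mathrm{L}$ be a spline-admissible operator and $w$ a Lévy white noise on $\mathcal{S}'(\mathbb{R}^d)$ with Lévy exponent $f$, such that $(\mathrm{L},w)$ is compatible, and let $s=\mathrm{L}^{-1}w$. For $n\ge 1$, let $w_n$ be the impulsive noise with Lévy exponent $$f_n(\xi)=n\left(\mathrm{e}^{f(\xi)/n}-1\right),\qquad \xi\in\mathbb{R},$$ and let $s_n=\mathrm{L}^{-1}w_n$ be the associated generalized Poisson process. Here a left inverse $\mathrm{T}$ of $\mathrm{L}^*$ as in the definition of compatibility of $(\mathrm{L},w)$ is fixed, and $s$ and $s_n$ are the generalized random processes with characteristic functionals $\widehat{\mathscr{P}}_s(\varphi)=\widehat{\mathscr{P}}_w(\mathrm{T}\{\varphi\})$ and $\widehat{\mathscr{P}}_{s_n}(\varphi)=\widehat{\mathscr{P}}_{w_n}(\mathrm{T}\{\varphi\})$, $\varphi\in\mathcal{S}(\mathbb{R}^d)$. Then $s_n$ converges in law to $s$ as $n\to\infty$.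
   Context: $\mathcal{S}(\mathbb{R}^d)$ is the Schwartz space of rapidly decaying functions from $\mathbb{R}^d$ to $\mathbb{R}$ and $\mathcal{S}'(\mathbb{R}^d)$ its topological dual (tempered generalized functions). Generalized random processes. A generalized random process is a measurable map $s$ from a probability space to $\mathcal{S}'(\mathbb{R}^d)$ endowed with the cylindrical $\sigma$-field (generated by the cylinders $\{v:(\langle v,\varphi_1\rangle,\ldots,\langle v,\varphi_N\rangle)\in B\}$ with $N\ge1$, $\varphi_i\in\mathcal{S}(\mathbb{R}^d)$, $B\subset\mathbb{R}^N$ Borel). Its law $\mathscr{P}_s$ is the image probability measure on $\mathcal{S}'(\mathbb{R}^d)$, and its characteristic functional is $\widehat{\mathscr{P}}_s(\varphi)=\mathbb{E}[\mathrm{e}^{\mathrm{i}\langle s,\varphi\rangle}]$, $\varphi\in\mathcal{S}(\mathbb{R}^d)$. The sequence $s_n$ converges in law to $s$ if $\int F\,d\mathscr{P}_{s_n}\to\int F\,d\mathscr{P}_s$ for every continuous bounded function $F:\mathcal{S}'(\mathbb{R}^d)\to\mathbb{R}$. Spline-admissible operators. A linear and continuous operator $\mathrm{L}$ from $\mathcal{S}(\mathbb{R}^d)$ to $\mathcal{S}'(\mathbb{R}^d)$ is spline-admissible if it is shift-invariant ($\mathrm{L}\{\varphi(\cdot-\boldsymbol{x}_0)\}=\mathrm{L}\{\varphi\}(\cdot-\boldsymbol{x}_0)$ for all $\varphi\in\mathcal{S}(\mathbb{R}^d)$, $\boldsymbol{x}_0\in\mathbb{R}^d$) and there is a measurable function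 of slow growth $\rho_{\mathrm{L}}$ with $\mathrm{L}\{\rho_{\mathrm{L}}\}=\delta$, the Dirac delta. Lévy exponents. A Lévy exponent is a function $f:\mathbb{R}\to\mathbb{C}$ that is the continuous log-characteristic function of an infinitely divisible law; equivalently $$f(\xi)=\mathrm{i}\mu\xi-\tfrac{\sigma^2\xi^2}{2}+\int_{\mathbb{R}}(\mathrm{e}^{\mathrm{i}\xi t}-1-\mathrm{i}\xi t\,1_{|t|\le1})\,V(dt)$$ with $\mu\in\mathbb{R}$, $\sigma^2\ge0$ and $V$ a Lévy measure (a measure on $\mathbb{R}$ with $V(\{0\})=0$ and $\int\min(1,t^2)V(dt)<\infty$). $(\mu,\sigma^2,V)$ is the Lévy triplet of $f$. $f$ satisfies the Schwartz condition if $\int_{|t|\ge1}|t|^\epsilon V(dt)<\infty$ for some $\epsilon>0$. $(p_{\min},p_{\max})$-exponents. For $0\le p_{\min}\le p_{\max}\le2$, $f$ is a $(p_{\min},p_{\max})$-exponent if there exist $p,q$ with $p_{\min}\le p\le q\le p_{\max}$ such that (1) $\int_{|t|\ge1}|t|^pV(dt)<\infty$; (2) $\int_{|t|<1}|t|^qV(dt)<\infty$; (3) $p_{\min}=\inf(p,1)$ if $V$ is non-symmetric or $\mu\ne0$; (4) $p_{\max}=2$ if $\sigma^2\neq0$. Lévy white noises. A Lévy white noise is a generalized random process $w$ with characteristic functional $\widehat{\mathscr{P}}_w(\varphi)=\exp\left(\int_{\mathbb{R}^d}f(\varphi(\boldsymbol{x}))\,d\boldsymbol{x}\right)$, where $f$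 is a Lévy exponent satisfying the Schwartz condition. When $f$ is a $(p_{\min},p_{\max})$-exponent with $p_{\min}>0$, $\widehat{\mathscr{P}}_w$ is extended to $L_{p_{\min}}(\mathbb{R}^d)\cap L_{p_{\max}}(\mathbb{R}^d)$ by the same formula. Impulsive noises. Let $\lambda>0$ and let $P$ be a probability law on $\mathbb{R}\setminus\{0\}$ with $\int_{\mathbb{R}\setminus\{0\}}|t|^\epsilon P(dt)<\infty$ for some $\epsilon>0$. The impulsive noise (compound-Poisson white noise) with rate $\lambda$ and amplitude (jump) law $P$ is the generalized random process with characteristic functional $\exp\left(\lambda\int_{\mathbb{R}^d}\int_{\mathbb{R}}(\mathrm{e}^{\mathrm{i}\varphi(\boldsymbol{x})t}-1)P(dt)\,d\boldsymbol{x}\right)$; it is a Lévy white noise with Lévy exponent $\lambda(\widehat P(\xi)-1)$, where $\widehat P$ is the characteristic function of $P$. The exponent $f_n$ corresponds to rate $n$ and to the infinitely divisible jump law with Lévy exponent $f/n$. Compatibility. $(\mathrm{L},w)$ is compatible if there exist $0<p_{\min}\le p_{\max}\le2$ such that $f$ is a $(p_{\min},p_{\max})$-exponent and the adjoint $\mathrm{L}^*$ of $\mathrm{L}$ admits a left inverse $\mathrm{T}$, with $\mathrm{T}\mathrm{L}^*\{\varphi\}=\varphi$ for all $\varphi\in\mathcal{S}(\mathbb{R}^d)$, that is linear and continuous from $\mathcal{S}(\mathbb{R}^d)$ to $L_{p_{\min}}(\mathbb{R}^d)\cap L_{p_{\max}}(\mathbb{R}^d)$. One then writes $s=\mathrm{L}^{-1}w$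 for the generalized random process with characteristic functional $\varphi\mapsto\widehat{\mathscr{P}}_w(\mathrm{T}\{\varphi\})$ for such a fixed $\mathrm{T}$; it satisfies $\mathrm{L}s=w$ in law. When $w$ is an impulsive noise, $\mathrm{L}^{-1}w$ is called a generalized Poisson process. *)

theory Defs
  imports "HOL-Probability.Probability"
begin

section \<open>The Schwartz space\<close>

text \<open>
  Mixed partial derivatives are indexed by lists of basis vectors; for smooth functions the order of
  the list is immaterial, so these are exactly the derivatives indexed by multi-indices.
\<close>

primrec partials :: "'a::euclidean_space list \<Rightarrow> ('a \<Rightarrow> real) \<Rightarrow> 'a \<Rightarrow> real" where
  "partials [] \<phi> = \<phi>"
| "partials (b # bs) \<phi> = (\<lambda>x. frechet_derivative (partials bs \<phi>) (at x) b)"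

definition smooth :: "('a::euclidean_space \<Rightarrow> real) \<Rightarrow> bool" where
  "smooth \<phi> \<longleftrightarrow> (\<forall>bs\<in>lists Basis. \<forall>x. partials bs \<phi> differentiable at x)"

definition rapidly_decaying :: "('a::euclidean_space \<Rightarrow> real) \<Rightarrow> bool" where
  "rapidly_decaying \<phi> \<longleftrightarrow>
     (\<forall>bs\<in>lists Basis. \<forall>k. bdd_above (range (\<lambda>x. (1 + norm x) ^ k * \<bar>partials bs \<phi> x\<bar>)))"

lemma partials_add:
  assumes "smooth \<phi>" "smooth \<psi>" "bs \<in> lists Basis"
  shows "partials bs (\<lambda>x. \<phi> x + \<psi> x) = (\<lambda>x. partials bs \<phi> x + partials bs \<psi> x)"
  using assms(3)
proof (induction bs)
  case Nil
  show ?case by simp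
next
  case (Cons b bs)
  then have bs: "bs \<in> lists Basis" by simp
  have "frechet_derivative (\<lambda>x. partials bs \<phi> x + partials bs \<psi> x) (at x) =
      (\<lambda>h. frechet_derivative (partials bs \<phi>) (at x) h + frechet_derivative (partials bs \<psi>) (at x) h)" for x
    using assms(1,2) bs unfolding smooth_def
    by (intro frechet_derivative_at[symmetric] has_derivative_add)
      (auto simp: frechet_derivative_works[symmetric])
  then show ?case using Cons.IH bs by simp
qed

lemma partials_scale:
  assumes "smooth \<phi>" "bs \<in> lists Basis"
  shows "partials bs (\<lambda>x. c * \<phi> x) = (\<lambda>x. c * partials bs \<phi> x)"
  using assms(2)
proof (induction bs)
  case Nil
  show ?case by simp
next
  case (Cons b bs)
  then have bs: "bs \<in> lists Basis" by simp
  have "frechet_derivative (\<lambda>x. c * partials bs \<phi> x) (at x) =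
      (\<lambda>h. c * frechet_derivative (partials bs \<phi>) (at x) h)" for x
    using assms(1) bs unfolding smooth_def
    by (intro frechet_derivative_at[symmetric] has_derivative_mult_right)
      (auto simp: frechet_derivative_works[symmetric])
  then show ?case using Cons.IH bs by simp
qed

lemma partials_zero: "partials bs (\<lambda>x. 0) = (\<lambda>x. 0)"
  by (induction bs) auto

lemma partials_shift:
  assumes "smooth \<phi>" "bs \<in> lists Basis"
  shows "partials bs (\<lambda>x. \<phi> (x - a)) = (\<lambda>x. partials bs \<phi> (x - a))"
  using assms(2)
proof (induction bs)
  case Nil
  show ?case by simp
next
  case (Cons b bs)
  then have bs: "bs \<in> lists Basis" by simp
  have "frechet_derivative (\<lambda>x. partials bs \<phi> (x - a)) (at x) =
      frechet_derivative (partials bs \<phi>) (at (x - a))" for x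
  proof (rule frechet_derivative_at[symmetric])
    have "(partials bs \<phi> has_derivative frechet_derivative (partials bs \<phi>) (at (x - a))) (at (x - a))"
      using assms(1) bs unfolding smooth_def by (auto simp: frechet_derivative_works[symmetric])
    moreover have "((\<lambda>x. x - a) has_derivative (\<lambda>h. h)) (at x)"
      by (auto intro!: derivative_eq_intros)
    ultimately show "((\<lambda>x. partials bs \<phi> (x - a)) has_derivative
        frechet_derivative (partials bs \<phi>) (at (x - a))) (at x)"
      using has_derivative_compose[of "\<lambda>x. x - a" "\<lambda>h. h" x UNIV "partials bs \<phi>"
          "frechet_derivative (partials bs \<phi>) (at (x - a))"] by simp
  qed
  then show ?case using Cons.IH bs by simp
qed

lemma smoothD: "smooth \<phi> \<Longrightarrow> bs \<in> lists Basis \<Longrightarrow> partials bs \<phi> differentiable at x"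
  unfolding smooth_def by (drule (1) bspec) (rule spec)

lemma smooth_add:
  assumes "smooth \<phi>" "smooth \<psi>"
  shows "smooth (\<lambda>x. \<phi> x + \<psi> x)"
  unfolding smooth_def
proof (intro ballI allI)
  fix bs :: "'a list" and x :: 'a
  assume bs: "bs \<in> lists Basis"
  show "partials bs (\<lambda>x. \<phi> x + \<psi> x) differentiable at x"
    unfolding partials_add[OF assms bs]
    by (rule differentiable_add[OF smoothD[OF assms(1) bs] smoothD[OF assms(2) bs]])
qed

lemma smooth_scale:
  assumes "smooth \<phi>"
  shows "smooth (\<lambda>x. c * \<phi> x)"
  unfolding smooth_def
proof (intro ballI allI)
  fix bs :: "'a list" and x :: 'a
  assume bs: "bs \<in> lists Basis"
  show "partials bs (\<lambda>x. c * \<phi> x) differentiable at x"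
    unfolding partials_scale[OF assms bs]
    by (rule differentiable_mult[OF differentiable_const smoothD[OF assms bs]])
qed

lemma smooth_shift:
  assumes "smooth \<phi>"
  shows "smooth (\<lambda>x. \<phi> (x - a))"
  unfolding smooth_def
proof (intro ballI allI)
  fix bs :: "'a list" and x :: 'a
  assume bs: "bs \<in> lists Basis"
  have "(\<lambda>x. x - a) differentiable at x"
    by (rule differentiable_diff[OF differentiable_ident differentiable_const])
  then have "(\<lambda>x. partials bs \<phi> (x - a)) differentiable at x"
    using smoothD[OF assms bs, of "x - a"] differentiable_chain_at[of "\<lambda>x. x - a" x "partials bs \<phi>"]
    by (simp add: o_def)
  then show "partials bs (\<lambda>x. \<phi> (x - a)) differentiable at x"
    unfolding partials_shift[OF assms bs] .
qed

lemma rapidly_decayingD: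
  assumes "rapidly_decaying \<phi>" "bs \<in> lists Basis"
  obtains C where "\<And>x. (1 + norm x) ^ k * \<bar>partials bs \<phi> x\<bar> \<le> C"
proof -
  have "bdd_above (range (\<lambda>x. (1 + norm x) ^ k * \<bar>partials bs \<phi> x\<bar>))"
    using bspec[OF assms(1)[unfolded rapidly_decaying_def] assms(2)] by (rule spec)
  then show ?thesis
    using that unfolding bdd_above_def by auto
qed

lemma one_plus_norm_add_power: "(1 + norm (x + a)) ^ k \<le> (1 + norm a) ^ k * (1 + norm x) ^ k"
  for x a :: "'a::real_normed_vector"
proof -
  have "1 + norm (x + a) \<le> (1 + norm a) * (1 + norm x)"
  proof -
    have "(1 + norm a) * (1 + norm x) = 1 + norm a + norm x + norm a * norm x"
      by (simp add: algebra_simps)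
    moreover have "0 \<le> norm a * norm x" by simp
    ultimately show ?thesis
      using norm_triangle_ineq[of x a] by linarith
  qed
  then show ?thesis
    unfolding power_mult_distrib[symmetric] by (intro power_mono) auto
qed

lemma rapidly_decaying_add:
  assumes "smooth \<phi>" "smooth \<psi>" "rapidly_decaying \<phi>" "rapidly_decaying \<psi>"
  shows "rapidly_decaying (\<lambda>x. \<phi> x + \<psi> x)"
  unfolding rapidly_decaying_def
proof (intro ballI allI)
  fix bs :: "'a list" and k :: nat
  assume bs: "bs \<in> lists Basis"
  obtain C where C: "\<And>x. (1 + norm x) ^ k * \<bar>partials bs \<phi> x\<bar> \<le> C"
    using rapidly_decayingD[OF assms(3) bs] by blast
  obtain D where D: "\<And>x. (1 + norm x) ^ k * \<bar>partials bs \<psi> x\<bar> \<le> D"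
    using rapidly_decayingD[OF assms(4) bs] by blast
  have "(1 + norm x) ^ k * \<bar>partials bs \<phi> x + partials bs \<psi> x\<bar> \<le> C + D" for x
  proof -
    have "(1 + norm x) ^ k * \<bar>partials bs \<phi> x + partials bs \<psi> x\<bar>
        \<le> (1 + norm x) ^ k * (\<bar>partials bs \<phi> x\<bar> + \<bar>partials bs \<psi> x\<bar>)"
      by (intro mult_left_mono abs_triangle_ineq) auto
    then show ?thesis using C[of x] D[of x] by (simp add: distrib_left)
  qed
  then show "bdd_above (range (\<lambda>x. (1 + norm x) ^ k * \<bar>partials bs (\<lambda>x. \<phi> x + \<psi> x) x\<bar>))"
    unfolding partials_add[OF assms(1,2) bs] by (intro bdd_aboveI2)
qed

lemma rapidly_decaying_scale:
  assumes "smooth \<phi>" "rapidly_decaying \<phi>"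
  shows "rapidly_decaying (\<lambda>x. c * \<phi> x)"
  unfolding rapidly_decaying_def
proof (intro ballI allI)
  fix bs :: "'a list" and k :: nat
  assume bs: "bs \<in> lists Basis"
  obtain C where C: "\<And>x. (1 + norm x) ^ k * \<bar>partials bs \<phi> x\<bar> \<le> C"
    using rapidly_decayingD[OF assms(2) bs] by blast
  have "(1 + norm x) ^ k * \<bar>c * partials bs \<phi> x\<bar> \<le> \<bar>c\<bar> * C" for x
    using mult_left_mono[OF C[of x], of "\<bar>c\<bar>"] by (simp add: abs_mult mult.left_commute)
  then show "bdd_above (range (\<lambda>x. (1 + norm x) ^ k * \<bar>partials bs (\<lambda>x. c * \<phi> x) x\<bar>))"
    unfolding partials_scale[OF assms(1) bs] by (intro bdd_aboveI2)
qed

lemma shift_decay_bound: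
  assumes "smooth \<phi>" "bs \<in> lists Basis" "\<And>x. (1 + norm x) ^ k * \<bar>partials bs \<phi> x\<bar> \<le> C"
  shows "(1 + norm x) ^ k * \<bar>partials bs (\<lambda>x. \<phi> (x - a)) x\<bar> \<le> (1 + norm a) ^ k * C"
proof -
  have "(1 + norm x) ^ k * \<bar>partials bs \<phi> (x - a)\<bar>
      \<le> ((1 + norm a) ^ k * (1 + norm (x - a)) ^ k) * \<bar>partials bs \<phi> (x - a)\<bar>"
    using one_plus_norm_add_power[of "x - a" a k] by (intro mult_right_mono) auto
  also have "\<dots> = (1 + norm a) ^ k * ((1 + norm (x - a)) ^ k * \<bar>partials bs \<phi> (x - a)\<bar>)"
    by (simp add: mult.assoc)
  also have "\<dots> \<le> (1 + norm a) ^ k * C"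
    by (intro mult_left_mono assms(3)) auto
  finally show ?thesis
    unfolding partials_shift[OF assms(1,2)] .
qed

lemma rapidly_decaying_shift:
  assumes "smooth \<phi>" "rapidly_decaying \<phi>"
  shows "rapidly_decaying (\<lambda>x. \<phi> (x - a))"
  unfolding rapidly_decaying_def
proof (intro ballI allI)
  fix bs :: "'a list" and k :: nat
  assume bs: "bs \<in> lists Basis"
  obtain C where C: "\<And>x. (1 + norm x) ^ k * \<bar>partials bs \<phi> x\<bar> \<le> C"
    using rapidly_decayingD[OF assms(2) bs] by blast
  show "bdd_above (range (\<lambda>x. (1 + norm x) ^ k * \<bar>partials bs (\<lambda>x. \<phi> (x - a)) x\<bar>))"
    using shift_decay_bound[OF assms(1) bs C] by (intro bdd_aboveI2)
qed

typedef (overloaded) 'a::euclidean_space schwartz =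
  "{\<phi> :: 'a \<Rightarrow> real. smooth \<phi> \<and> rapidly_decaying \<phi>}"
  morphisms schwartz_fun Abs_schwartz
proof
  show "(\<lambda>x. 0) \<in> {\<phi> :: 'a \<Rightarrow> real. smooth \<phi> \<and> rapidly_decaying \<phi>}"
    by (auto simp: smooth_def rapidly_decaying_def partials_zero)
qed

setup_lifting type_definition_schwartz

instantiation schwartz :: (euclidean_space) real_vector
begin

lift_definition zero_schwartz :: "'a schwartz" is "\<lambda>x. 0"
  by (auto simp: smooth_def rapidly_decaying_def partials_zero)

lift_definition plus_schwartz :: "'a schwartz \<Rightarrow> 'a schwartz \<Rightarrow> 'a schwartz" is
  "\<lambda>\<phi> \<psi> x. \<phi> x + \<psi> x"
  by (simp add: smooth_add rapidly_decaying_add)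

lift_definition scaleR_schwartz :: "real \<Rightarrow> 'a schwartz \<Rightarrow> 'a schwartz" is
  "\<lambda>c \<phi> x. c * \<phi> x"
  by (simp add: smooth_scale rapidly_decaying_scale)

lift_definition uminus_schwartz :: "'a schwartz \<Rightarrow> 'a schwartz" is "\<lambda>\<phi> x. - \<phi> x"
proof -
  fix \<phi> :: "'a \<Rightarrow> real"
  assume "smooth \<phi> \<and> rapidly_decaying \<phi>"
  then show "smooth (\<lambda>x. - \<phi> x) \<and> rapidly_decaying (\<lambda>x. - \<phi> x)"
    using smooth_scale[of \<phi> "- 1"] rapidly_decaying_scale[of \<phi> "- 1"] by simp
qed

definition minus_schwartz :: "'a schwartz \<Rightarrow> 'a schwartz \<Rightarrow> 'a schwartz" where
  "\<phi> - \<psi> = \<phi> + (- \<psi>)" for \<phi> \<psi> :: "'a schwartz"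

instance
proof
  fix a b c :: "'a schwartz" and r s :: real
  show "a + b + c = a + (b + c)" by transfer (simp add: add.assoc)
  show "a + b = b + a" by transfer (simp add: add.commute)
  show "0 + a = a" by transfer simp
  show "- a + a = 0" by transfer simp
  show "a - b = a + - b" by (rule minus_schwartz_def)
  show "r *\<^sub>R (a + b) = r *\<^sub>R a + r *\<^sub>R b" by transfer (simp add: distrib_left)
  show "(r + s) *\<^sub>R a = r *\<^sub>R a + s *\<^sub>R a" by transfer (simp add: distrib_right)
  show "r *\<^sub>R s *\<^sub>R a = (r * s) *\<^sub>R a" by transfer (simp add: mult.assoc)
  show "1 *\<^sub>R a = a" by transfer simp
qed

end

definition schwartz_seminorm :: "nat \<Rightarrow> 'a::euclidean_space list \<Rightarrow> 'a schwartz \<Rightarrow> real" where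
  "schwartz_seminorm k bs \<phi> = (SUP x. (1 + norm x) ^ k * \<bar>partials bs (schwartz_fun \<phi>) x\<bar>)"

text \<open>The Frechet topology generated by the seminorms.\<close>

instantiation schwartz :: (euclidean_space) topological_space
begin

definition open_schwartz :: "'a schwartz set \<Rightarrow> bool" where
  "open_schwartz U \<longleftrightarrow> (\<forall>\<phi>\<in>U. \<exists>I \<epsilon>. finite I \<and> I \<subseteq> UNIV \<times> lists Basis \<and> 0 < \<epsilon> \<and>
     {\<psi>. \<forall>(k, bs)\<in>I. schwartz_seminorm k bs (\<psi> - \<phi>) < \<epsilon>} \<subseteq> U)"

instance
proof
  show "open (UNIV :: 'a schwartz set)"
    unfolding open_schwartz_def by (auto intro!: exI[of _ "{}"] exI[of _ "1::real"])
next
  fix S T :: "'a schwartz set"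
  assume S: "open S" and T: "open T"
  show "open (S \<inter> T)"
    unfolding open_schwartz_def
  proof
    fix \<phi> assume \<phi>: "\<phi> \<in> S \<inter> T"
    obtain I d where I: "finite I" "I \<subseteq> UNIV \<times> lists Basis" "0 < d"
      "{\<psi>. \<forall>(k, bs)\<in>I. schwartz_seminorm k bs (\<psi> - \<phi>) < d} \<subseteq> S"
      using bspec[OF S[unfolded open_schwartz_def] IntD1[OF \<phi>]] by (elim exE conjE)
    obtain J e where J: "finite J" "J \<subseteq> UNIV \<times> lists Basis" "0 < e"
      "{\<psi>. \<forall>(k, bs)\<in>J. schwartz_seminorm k bs (\<psi> - \<phi>) < e} \<subseteq> T"
      using bspec[OF T[unfolded open_schwartz_def] IntD2[OF \<phi>]] by (elim exE conjE)
    have "{\<psi>. \<forall>(k, bs)\<in>I \<union> J. schwartz_seminorm k bs (\<psi> - \<phi>) < min d e} \<subseteq> S \<inter> T"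
      using I(4) J(4) by fastforce
    then show "\<exists>I \<epsilon>. finite I \<and> I \<subseteq> UNIV \<times> lists Basis \<and> 0 < \<epsilon> \<and>
        {\<psi>. \<forall>(k, bs)\<in>I. schwartz_seminorm k bs (\<psi> - \<phi>) < \<epsilon>} \<subseteq> S \<inter> T"
      using I J by (intro exI[of _ "I \<union> J"] exI[of _ "min d e"]) auto
  qed
next
  fix K :: "'a schwartz set set"
  assume K: "\<forall>S\<in>K. open S"
  show "open (\<Union>K)"
    unfolding open_schwartz_def
  proof
    fix \<phi> assume "\<phi> \<in> \<Union>K"
    then obtain S where S: "S \<in> K" "\<phi> \<in> S" by blast
    then obtain I \<epsilon> where "finite I" "I \<subseteq> UNIV \<times> lists Basis" "0 < \<epsilon>"
      "{\<psi>. \<forall>(k, bs)\<in>I. schwartz_seminorm k bs (\<psi> - \<phi>) < \<epsilon>} \<subseteq> S"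
      using bspec[OF K[rule_format, OF S(1), unfolded open_schwartz_def] S(2)] by (elim exE conjE)
    then show "\<exists>I \<epsilon>. finite I \<and> I \<subseteq> UNIV \<times> lists Basis \<and> 0 < \<epsilon> \<and>
        {\<psi>. \<forall>(k, bs)\<in>I. schwartz_seminorm k bs (\<psi> - \<phi>) < \<epsilon>} \<subseteq> \<Union>K"
      using S by (intro exI[of _ I] exI[of _ \<epsilon>]) blast
  qed
qed

end

lemma schwartz_seminorm_upper:
  assumes "bs \<in> lists Basis"
  shows "(1 + norm x) ^ k * \<bar>partials bs (schwartz_fun \<phi>) x\<bar> \<le> schwartz_seminorm k bs \<phi>"
  unfolding schwartz_seminorm_def
  using assms schwartz_fun[of \<phi>] by (intro cSUP_upper) (auto simp: rapidly_decaying_def)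

lemma schwartz_seminorm_least:
  assumes "\<And>x. (1 + norm x) ^ k * \<bar>partials bs (schwartz_fun \<phi>) x\<bar> \<le> C"
  shows "schwartz_seminorm k bs \<phi> \<le> C"
  unfolding schwartz_seminorm_def using assms by (intro cSUP_least) auto

lemma continuous_functionalI:
  fixes u :: "'a::euclidean_space schwartz \<Rightarrow> real"
  assumes lin: "linear u" and bs: "bs \<in> lists Basis"
    and bound: "\<And>\<phi>. \<bar>u \<phi>\<bar> \<le> C * schwartz_seminorm k bs \<phi>"
  shows "continuous_on UNIV u"
proof (rule continuous_on_open_vimage[THEN iffD2, OF open_UNIV], intro allI impI)
  fix S :: "real set" assume S: "open S"
  have "open (u -` S)"
    unfolding open_schwartz_def
  proof
    fix \<phi> assume "\<phi> \<in> u -` S"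
    then obtain e where e: "0 < e" "\<And>y. dist y (u \<phi>) < e \<Longrightarrow> y \<in> S"
      using S unfolding open_dist by blast
    define d where "d = e / (\<bar>C\<bar> + 1)"
    have d: "0 < d" using e unfolding d_def by auto
    have "u \<psi> \<in> S" if "schwartz_seminorm k bs (\<psi> - \<phi>) < d" for \<psi>
    proof (rule e(2))
      have nn: "0 \<le> schwartz_seminorm k bs (\<psi> - \<phi>)"
        using schwartz_seminorm_upper[OF bs, of 0 k "\<psi> - \<phi>"] by (rule order_trans[rotated]) simp
      have "dist (u \<psi>) (u \<phi>) = \<bar>u (\<psi> - \<phi>)\<bar>"
        using linear_diff[OF lin] by (simp add: dist_real_def)
      also have "\<dots> \<le> (\<bar>C\<bar> + 1) * schwartz_seminorm k bs (\<psi> - \<phi>)"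
        using bound[of "\<psi> - \<phi>"] nn by (elim order_trans) (intro mult_right_mono, auto)
      also have "\<dots> < (\<bar>C\<bar> + 1) * d"
        using that by (intro mult_strict_left_mono) auto
      also have "\<dots> = e" unfolding d_def by (simp add: field_simps)
      finally show "dist (u \<psi>) (u \<phi>) < e" .
    qed
    then show "\<exists>I \<epsilon>. finite I \<and> I \<subseteq> UNIV \<times> lists Basis \<and> 0 < \<epsilon> \<and>
        {\<psi>. \<forall>(k, bs)\<in>I. schwartz_seminorm k bs (\<psi> - \<phi>) < \<epsilon>} \<subseteq> u -` S"
      using d bs by (intro exI[of _ "{(k, bs)}"] exI[of _ d]) auto
  qed
  then show "open (u -` S \<inter> UNIV)" by simp
qed

lift_definition shift_schwartz :: "'a::euclidean_space \<Rightarrow> 'a schwartz \<Rightarrow> 'a schwartz" is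
  "\<lambda>a \<phi> x. \<phi> (x - a)"
proof -
  fix a :: 'a and \<phi> :: "'a \<Rightarrow> real"
  assume *: "smooth \<phi> \<and> rapidly_decaying \<phi>"
  show "smooth (\<lambda>x. \<phi> (x - a)) \<and> rapidly_decaying (\<lambda>x. \<phi> (x - a))"
    by (rule conjI[OF smooth_shift[OF conjunct1[OF *]]
          rapidly_decaying_shift[OF conjunct1[OF *] conjunct2[OF *]]])
qed

lemma linear_shift_schwartz: "linear (shift_schwartz a)"
  by (rule linearI)
    (simp_all add: schwartz_fun_inject[symmetric] shift_schwartz.rep_eq plus_schwartz.rep_eq
      scaleR_schwartz.rep_eq)

lemma schwartz_seminorm_shift:
  assumes "bs \<in> lists Basis"
  shows "schwartz_seminorm k bs (shift_schwartz a \<phi>) \<le> (1 + norm a) ^ k * schwartz_seminorm k bs \<phi>"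
proof (rule schwartz_seminorm_least)
  show "(1 + norm x) ^ k * \<bar>partials bs (schwartz_fun (shift_schwartz a \<phi>)) x\<bar>
      \<le> (1 + norm a) ^ k * schwartz_seminorm k bs \<phi>" for x
    unfolding shift_schwartz.rep_eq
    using schwartz_fun[of \<phi>] assms by (intro shift_decay_bound schwartz_seminorm_upper) auto
qed

lemma continuous_on_shift_schwartz: "continuous_on UNIV (shift_schwartz a)"
proof (rule continuous_on_open_vimage[THEN iffD2, OF open_UNIV], intro allI impI)
  fix U :: "'a schwartz set" assume U: "open U"
  have "open (shift_schwartz a -` U)"
    unfolding open_schwartz_def
  proof
    fix \<phi> assume "\<phi> \<in> shift_schwartz a -` U"
    then have \<phi>: "shift_schwartz a \<phi> \<in> U" by simp
    obtain I e where I: "finite I" "I \<subseteq> UNIV \<times> lists Basis" "0 < e"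
      "{\<psi>. \<forall>(k, bs)\<in>I. schwartz_seminorm k bs (\<psi> - shift_schwartz a \<phi>) < e} \<subseteq> U"
      using bspec[OF U[unfolded open_schwartz_def] \<phi>] by (elim exE conjE)
    define K where "K = Max (insert 0 (fst ` I))"
    define d where "d = e / (1 + norm a) ^ K"
    have pos: "0 < 1 + norm a" by (simp add: add_pos_nonneg)
    have d: "0 < d" using I pos unfolding d_def by simp
    have "shift_schwartz a \<psi> \<in> U" if "\<forall>(k, bs)\<in>I. schwartz_seminorm k bs (\<psi> - \<phi>) < d" for \<psi>
    proof -
      have "schwartz_seminorm k bs (shift_schwartz a \<psi> - shift_schwartz a \<phi>) < e" if kbs: "(k, bs) \<in> I" for k bs
      proof -
        have bs: "bs \<in> lists Basis" using I kbs by auto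
        have k: "k \<le> K" unfolding K_def using I kbs by (intro Max_ge) force+
        have nn: "0 \<le> schwartz_seminorm k bs (\<psi> - \<phi>)"
          using schwartz_seminorm_upper[OF bs, of 0 k "\<psi> - \<phi>"] by (rule order_trans[rotated]) simp
        have "schwartz_seminorm k bs (shift_schwartz a \<psi> - shift_schwartz a \<phi>)
            = schwartz_seminorm k bs (shift_schwartz a (\<psi> - \<phi>))"
          by (simp add: linear_diff[OF linear_shift_schwartz])
        also have "\<dots> \<le> (1 + norm a) ^ k * schwartz_seminorm k bs (\<psi> - \<phi>)"
          by (rule schwartz_seminorm_shift[OF bs])
        also have "\<dots> \<le> (1 + norm a) ^ K * schwartz_seminorm k bs (\<psi> - \<phi>)"
          using k nn by (intro mult_right_mono power_increasing) auto
        also have "\<dots> < (1 + norm a) ^ K * d"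
          using that pos \<open>\<forall>(k, bs)\<in>I. schwartz_seminorm k bs (\<psi> - \<phi>) < d\<close> kbs
          by (intro mult_strict_left_mono) auto
        also have "\<dots> = e" unfolding d_def using pos by simp
        finally show ?thesis .
      qed
      then show ?thesis using I(4) by auto
    qed
    then show "\<exists>I \<epsilon>. finite I \<and> I \<subseteq> UNIV \<times> lists Basis \<and> 0 < \<epsilon> \<and>
        {\<psi>. \<forall>(k, bs)\<in>I. schwartz_seminorm k bs (\<psi> - \<phi>) < \<epsilon>} \<subseteq> shift_schwartz a -` U"
      using d I by (intro exI[of _ I] exI[of _ d]) auto
  qed
  then show "open (shift_schwartz a -` U \<inter> UNIV)" by simp
qed

section \<open>Tempered distributions\<close>

typedef (overloaded) 'a::euclidean_space tempered =
  "{u :: 'a schwartz \<Rightarrow> real. linear u \<and> continuous_on UNIV u}"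
  morphisms pairing Abs_tempered
proof
  show "(\<lambda>_. 0) \<in> {u :: 'a schwartz \<Rightarrow> real. linear u \<and> continuous_on UNIV u}"
    by (auto intro!: linearI)
qed

setup_lifting type_definition_tempered

instantiation tempered :: (euclidean_space) real_vector
begin

lift_definition zero_tempered :: "'a tempered" is "\<lambda>\<phi>. 0"
  by (auto intro!: linearI)

lift_definition plus_tempered :: "'a tempered \<Rightarrow> 'a tempered \<Rightarrow> 'a tempered" is
  "\<lambda>u v \<phi>. u \<phi> + v \<phi>"
  by (auto intro!: linear_compose_add continuous_on_add)

lift_definition scaleR_tempered :: "real \<Rightarrow> 'a tempered \<Rightarrow> 'a tempered" is
  "\<lambda>c u \<phi>. c * u \<phi>"
  by (auto intro!: linearI continuous_on_mult_left simp: linear_add linear_scale algebra_simps)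

lift_definition uminus_tempered :: "'a tempered \<Rightarrow> 'a tempered" is "\<lambda>u \<phi>. - u \<phi>"
  by (auto intro!: linear_compose_neg continuous_on_minus)

definition minus_tempered :: "'a tempered \<Rightarrow> 'a tempered \<Rightarrow> 'a tempered" where
  "u - v = u + (- v)" for u v :: "'a tempered"

instance
proof
  fix a b c :: "'a tempered" and r s :: real
  show "a + b + c = a + (b + c)" by transfer (simp add: add.assoc)
  show "a + b = b + a" by transfer (simp add: add.commute)
  show "0 + a = a" by transfer simp
  show "- a + a = 0" by transfer simp
  show "a - b = a + - b" by (rule minus_tempered_def)
  show "r *\<^sub>R (a + b) = r *\<^sub>R a + r *\<^sub>R b" by transfer (simp add: distrib_left)
  show "(r + s) *\<^sub>R a = r *\<^sub>R a + s *\<^sub>R a" by transfer (simp add: distrib_right)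
  show "r *\<^sub>R s *\<^sub>R a = (r * s) *\<^sub>R a" by transfer (simp add: mult.assoc)
  show "1 *\<^sub>R a = a" by transfer simp
qed

end

definition schwartz_bounded :: "'a::euclidean_space schwartz set \<Rightarrow> bool" where
  "schwartz_bounded B \<longleftrightarrow> (\<forall>k. \<forall>bs\<in>lists Basis. bdd_above (schwartz_seminorm k bs ` B))"

text \<open>
  The topological dual carries the strong topology, i.e. uniform convergence on bounded sets. Every
  functional that is continuous for the weak-star topology is continuous for it.
\<close>

instantiation tempered :: (euclidean_space) topological_space
begin

definition open_tempered :: "'a tempered set \<Rightarrow> bool" where
  "open_tempered U \<longleftrightarrow> (\<forall>u\<in>U. \<exists>B \<epsilon>. schwartz_bounded B \<and> 0 < \<epsilon> \<and>
     {v. \<forall>\<phi>\<in>B. \<bar>pairing v \<phi> - pairing u \<phi>\<bar> < \<epsilon>} \<subseteq> U)"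

instance
proof
  show "open (UNIV :: 'a tempered set)"
    unfolding open_tempered_def
    by (auto intro!: exI[of _ "{}"] exI[of _ "1::real"] simp: schwartz_bounded_def)
next
  fix S T :: "'a tempered set"
  assume S: "open S" and T: "open T"
  show "open (S \<inter> T)"
    unfolding open_tempered_def
  proof
    fix u assume u: "u \<in> S \<inter> T"
    obtain B d where B: "schwartz_bounded B" "0 < d"
      "{v. \<forall>\<phi>\<in>B. \<bar>pairing v \<phi> - pairing u \<phi>\<bar> < d} \<subseteq> S"
      using bspec[OF S[unfolded open_tempered_def] IntD1[OF u]] by (elim exE conjE)
    obtain C e where C: "schwartz_bounded C" "0 < e"
      "{v. \<forall>\<phi>\<in>C. \<bar>pairing v \<phi> - pairing u \<phi>\<bar> < e} \<subseteq> T"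
      using bspec[OF T[unfolded open_tempered_def] IntD2[OF u]] by (elim exE conjE)
    have "{v. \<forall>\<phi>\<in>B \<union> C. \<bar>pairing v \<phi> - pairing u \<phi>\<bar> < min d e} \<subseteq> S \<inter> T"
      using B(3) C(3) by fastforce
    moreover have "schwartz_bounded (B \<union> C)"
      using B(1) C(1) by (auto simp: schwartz_bounded_def image_Un)
    ultimately show "\<exists>B \<epsilon>. schwartz_bounded B \<and> 0 < \<epsilon> \<and>
        {v. \<forall>\<phi>\<in>B. \<bar>pairing v \<phi> - pairing u \<phi>\<bar> < \<epsilon>} \<subseteq> S \<inter> T"
      using B(2) C(2) by (intro exI[of _ "B \<union> C"] exI[of _ "min d e"]) auto
  qed
next
  fix K :: "'a tempered set set"
  assume K: "\<forall>S\<in>K. open S"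
  show "open (\<Union>K)"
    unfolding open_tempered_def
  proof
    fix u assume "u \<in> \<Union>K"
    then obtain S where S: "S \<in> K" "u \<in> S" by blast
    then obtain B \<epsilon> where "schwartz_bounded B" "0 < \<epsilon>"
      "{v. \<forall>\<phi>\<in>B. \<bar>pairing v \<phi> - pairing u \<phi>\<bar> < \<epsilon>} \<subseteq> S"
      using bspec[OF K[rule_format, OF S(1), unfolded open_tempered_def] S(2)] by (elim exE conjE)
    then show "\<exists>B \<epsilon>. schwartz_bounded B \<and> 0 < \<epsilon> \<and>
        {v. \<forall>\<phi>\<in>B. \<bar>pairing v \<phi> - pairing u \<phi>\<bar> < \<epsilon>} \<subseteq> \<Union>K"
      using S by (intro exI[of _ B] exI[of _ \<epsilon>]) blast
  qed
qed

end

lemma linear_pairing: "linear (pairing u)"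
  and continuous_on_pairing: "continuous_on UNIV (pairing u)"
  using pairing[of u] by auto

lemma continuous_on_evaluation: "continuous_on UNIV (\<lambda>u. pairing u \<phi>)"
proof (rule continuous_on_open_vimage[THEN iffD2, OF open_UNIV], intro allI impI)
  fix S :: "real set" assume S: "open S"
  have "open ((\<lambda>u. pairing u \<phi>) -` S)"
    unfolding open_tempered_def
  proof
    fix u assume "u \<in> (\<lambda>u. pairing u \<phi>) -` S"
    then obtain e where e: "0 < e" "\<And>y. dist y (pairing u \<phi>) < e \<Longrightarrow> y \<in> S"
      using S unfolding open_dist by blast
    then show "\<exists>B \<epsilon>. schwartz_bounded B \<and> 0 < \<epsilon> \<and>
        {v. \<forall>\<phi>\<in>B. \<bar>pairing v \<phi> - pairing u \<phi>\<bar> < \<epsilon>} \<subseteq> (\<lambda>u. pairing u \<phi>) -` S"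
      by (intro exI[of _ "{\<phi>}"] exI[of _ e]) (auto simp: schwartz_bounded_def dist_real_def)
  qed
  then show "open ((\<lambda>u. pairing u \<phi>) -` S \<inter> UNIV)" by simp
qed

lift_definition shift_tempered :: "'a::euclidean_space \<Rightarrow> 'a tempered \<Rightarrow> 'a tempered" is
  "\<lambda>a u \<phi>. u (shift_schwartz (- a) \<phi>)"
  using linear_compose[OF linear_shift_schwartz] continuous_on_shift_schwartz
  by (auto simp: o_def intro: continuous_on_compose2)

lift_definition dirac :: "'a::euclidean_space tempered" is "\<lambda>\<phi>. schwartz_fun \<phi> 0"
proof
  show lin: "linear (\<lambda>\<phi>. schwartz_fun \<phi> (0::'a))"
    by (rule linearI) (simp_all add: plus_schwartz.rep_eq scaleR_schwartz.rep_eq)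
  show "continuous_on UNIV (\<lambda>\<phi>. schwartz_fun \<phi> (0::'a))"
    using schwartz_seminorm_upper[of "[]" 0 0]
    by (intro continuous_functionalI[OF lin, of "[]" 1 0]) auto
qed

subsection \<open>Schwartz functions as tempered distributions\<close>

lemma integrable_inverse_square_prod:
  "integrable lborel (\<lambda>x::'a::euclidean_space. \<Prod>b\<in>Basis. inverse (1 + (x \<bullet> b)\<^sup>2))"
proof -
  interpret product_sigma_finite "\<lambda>_::'a. lborel :: real measure" ..
  have 1: "integrable lborel (\<lambda>t::real. inverse (1 + t\<^sup>2))"
    using integrable_inverse_1_plus_square by (simp add: set_integrable_def)
  have "integrable (\<Pi>\<^sub>M b\<in>(Basis::'a set). (lborel :: real measure)) (\<lambda>f. \<Prod>b\<in>Basis. inverse (1 + (f b)\<^sup>2))"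
    by (rule product_integrable_prod[OF finite_Basis, of "\<lambda>_ t. inverse (1 + t\<^sup>2)"]) (rule 1)
  moreover have "(\<Sum>c\<in>Basis. f c *\<^sub>R c) \<bullet> b = f b" if "b \<in> Basis" for f :: "'a \<Rightarrow> real" and b
    using that by (simp add: inner_sum_left_Basis)
  ultimately have "integrable (\<Pi>\<^sub>M b\<in>(Basis::'a set). (lborel :: real measure))
      (\<lambda>f. \<Prod>b\<in>Basis. inverse (1 + ((\<Sum>c\<in>Basis. f c *\<^sub>R c) \<bullet> b)\<^sup>2))"
    by (simp cong: prod.cong)
  then show ?thesis
    by (subst lborel_eq, subst integrable_distr_eq) (auto intro: borel_measurable_inverse)
qed

lemma schwartz_fun_borel [measurable]: "schwartz_fun \<phi> \<in> borel_measurable borel"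
proof -
  have "schwartz_fun \<phi> differentiable at x" for x
    using schwartz_fun[of \<phi>] by (auto simp: smooth_def dest: bspec[of _ _ "[]"])
  then have "continuous_on UNIV (schwartz_fun \<phi>)"
    by (auto intro!: continuous_at_imp_continuous_on differentiable_imp_continuous_within)
  then show ?thesis by (rule borel_measurable_continuous_onI)
qed

lemma integrable_schwartz_fun: "integrable lborel (schwartz_fun \<phi>)"
proof -
  let ?d = "DIM('a)"
  let ?C = "schwartz_seminorm (2 * ?d) [] \<phi>"
  show ?thesis
  proof (rule Bochner_Integration.integrable_bound)
    show "integrable lborel (\<lambda>x::'a. ?C * (\<Prod>b\<in>Basis. inverse (1 + (x \<bullet> b)\<^sup>2)))"
      by (intro integrable_mult_right impI integrable_inverse_square_prod)
    have "\<bar>schwartz_fun \<phi> x\<bar> \<le> ?C * (\<Prod>b\<in>Basis. inverse (1 + (x \<bullet> b)\<^sup>2))" for x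
    proof -
      have "(\<Prod>b\<in>Basis. 1 + (x \<bullet> b)\<^sup>2) \<le> (\<Prod>b\<in>(Basis::'a set). (1 + norm x)\<^sup>2)"
      proof (intro prod_mono conjI)
        fix b :: 'a assume "b \<in> Basis"
        then have "(x \<bullet> b)\<^sup>2 \<le> (norm x)\<^sup>2"
          using Basis_le_norm[of b x] by (simp add: abs_le_square_iff[symmetric])
        then show "1 + (x \<bullet> b)\<^sup>2 \<le> (1 + norm x)\<^sup>2"
          using norm_ge_zero[of x] by (simp add: power2_sum del: norm_ge_zero)
      qed auto
      also have "\<dots> = (1 + norm x) ^ (2 * ?d)" by (simp add: power_mult)
      finally have "(\<Prod>b\<in>Basis. 1 + (x \<bullet> b)\<^sup>2) * \<bar>schwartz_fun \<phi> x\<bar>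
          \<le> (1 + norm x) ^ (2 * ?d) * \<bar>schwartz_fun \<phi> x\<bar>"
        by (intro mult_right_mono) auto
      also have "\<dots> \<le> ?C"
        using schwartz_seminorm_upper[of "[]" x "2 * ?d" \<phi>] by simp
      finally have "(\<Prod>b\<in>Basis. 1 + (x \<bullet> b)\<^sup>2) * \<bar>schwartz_fun \<phi> x\<bar> \<le> ?C" .
      moreover have "0 < (\<Prod>b\<in>Basis. 1 + (x \<bullet> b)\<^sup>2)"
        by (intro prod_pos) (auto intro: add_pos_nonneg)
      ultimately show ?thesis
        unfolding prod_inversef[unfolded o_def]
        by (simp add: pos_le_divide_eq divide_inverse[symmetric] mult.commute)
    qed
    then show "AE x in lborel. norm (schwartz_fun \<phi> x)
        \<le> norm (?C * (\<Prod>b\<in>Basis. inverse (1 + (x \<bullet> b)\<^sup>2)))"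
      by (auto intro: order_trans[OF _ abs_ge_self])
  qed simp
qed

lemma abs_schwartz_fun_le: "\<bar>schwartz_fun \<psi> x\<bar> \<le> schwartz_seminorm 0 [] \<psi>"
  using schwartz_seminorm_upper[of "[]" x 0 \<psi>] by simp

lemma integrable_schwartz_fun_mult: "integrable lborel (\<lambda>x. schwartz_fun \<phi> x * schwartz_fun \<psi> x)"
proof (rule Bochner_Integration.integrable_bound)
  show "integrable lborel (\<lambda>x. schwartz_seminorm 0 [] \<psi> * schwartz_fun \<phi> x)"
    by (intro integrable_mult_right impI integrable_schwartz_fun)
  show "AE x in lborel. norm (schwartz_fun \<phi> x * schwartz_fun \<psi> x)
      \<le> norm (schwartz_seminorm 0 [] \<psi> * schwartz_fun \<phi> x)"
    using abs_schwartz_fun_le[of \<psi>]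
    by (intro AE_I2)
      (simp add: abs_mult mult.commute[of "\<bar>schwartz_fun \<phi> _\<bar>"] mult_right_mono order_trans[OF _ abs_ge_self])
qed simp

lift_definition tempered_of_schwartz :: "'a::euclidean_space schwartz \<Rightarrow> 'a tempered" is
  "\<lambda>\<phi> \<psi>. \<integral>x. schwartz_fun \<phi> x * schwartz_fun \<psi> x \<partial>lborel"
proof
  fix \<phi> :: "'a schwartz"
  let ?u = "\<lambda>\<psi>. \<integral>x. schwartz_fun \<phi> x * schwartz_fun \<psi> x \<partial>lborel"
  show lin: "linear ?u"
    by (rule linearI)
      (simp_all add: plus_schwartz.rep_eq scaleR_schwartz.rep_eq distrib_left
        integrable_schwartz_fun_mult mult.left_commute)
  show "continuous_on UNIV ?u"
  proof (rule continuous_functionalI[OF lin])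
    fix \<psi> :: "'a schwartz"
    have "\<bar>?u \<psi>\<bar> \<le> (\<integral>x. \<bar>schwartz_fun \<phi> x * schwartz_fun \<psi> x\<bar> \<partial>lborel)"
      by (rule integral_abs_bound)
    also have "\<dots> \<le> (\<integral>x. \<bar>schwartz_fun \<phi> x\<bar> * schwartz_seminorm 0 [] \<psi> \<partial>lborel)"
      using abs_schwartz_fun_le[of \<psi>] integrable_schwartz_fun[of \<phi>]
      by (intro integral_mono integrable_abs[OF integrable_schwartz_fun_mult])
        (auto simp: abs_mult intro!: mult_left_mono)
    also have "\<dots> = (\<integral>x. \<bar>schwartz_fun \<phi> x\<bar> \<partial>lborel) * schwartz_seminorm 0 [] \<psi>"
      by simp
    finally show "\<bar>?u \<psi>\<bar> \<le> (\<integral>x. \<bar>schwartz_fun \<phi> x\<bar> \<partial>lborel) * schwartz_seminorm 0 [] \<psi>" .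
  qed simp
qed

definition represents :: "('a::euclidean_space \<Rightarrow> real) \<Rightarrow> 'a tempered \<Rightarrow> bool" where
  "represents g u \<longleftrightarrow> g \<in> borel_measurable borel \<and>
     (\<forall>\<psi>. has_bochner_integral lborel (\<lambda>x. g x * schwartz_fun \<psi> x) (pairing u \<psi>))"

section \<open>Operators from the Schwartz space to tempered distributions\<close>

definition adjoint_op ::
  "('a::euclidean_space schwartz \<Rightarrow> 'a tempered) \<Rightarrow> 'a schwartz \<Rightarrow> 'a tempered" where
  "adjoint_op L \<phi> = Abs_tempered (\<lambda>\<psi>. pairing (L \<psi>) \<phi>)"

lemma pairing_adjoint_op:
  assumes "linear L" "continuous_on UNIV L"
  shows "pairing (adjoint_op L \<phi>) \<psi> = pairing (L \<psi>) \<phi>"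
proof -
  have "linear (\<lambda>\<psi>. pairing (L \<psi>) \<phi>)"
    by (rule linearI)
      (simp_all add: linear_add[OF assms(1)] linear_scale[OF assms(1)] plus_tempered.rep_eq
        scaleR_tempered.rep_eq)
  moreover have "continuous_on UNIV (\<lambda>\<psi>. pairing (L \<psi>) \<phi>)"
    by (rule continuous_on_compose2[OF continuous_on_evaluation assms(2)]) auto
  ultimately show ?thesis
    unfolding adjoint_op_def by (subst Abs_tempered_inverse) auto
qed

definition slow_growth :: "('a::euclidean_space \<Rightarrow> real) \<Rightarrow> bool" where
  "slow_growth \<rho> \<longleftrightarrow> (\<exists>C k. \<forall>x. \<bar>\<rho> x\<bar> \<le> C * (1 + norm x) ^ k)"

text \<open>
  The function \<open>\<rho>\<close> need not be a Schwartz function, so the equation \<open>L \<rho> = u\<close> is understood by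
  duality: \<open>\<langle>u, \<phi>\<rangle> = \<langle>\<rho>, L\<^sup>* \<phi>\<rangle>\<close>, where the distribution \<open>L\<^sup>* \<phi>\<close> is given by a function.
\<close>

definition maps_function_to ::
  "('a::euclidean_space schwartz \<Rightarrow> 'a tempered) \<Rightarrow> ('a \<Rightarrow> real) \<Rightarrow> 'a tempered \<Rightarrow> bool" where
  "maps_function_to L \<rho> u \<longleftrightarrow> (\<forall>\<phi>. \<exists>g. represents g (adjoint_op L \<phi>) \<and>
     has_bochner_integral lborel (\<lambda>x. \<rho> x * g x) (pairing u \<phi>))"

definition spline_admissible :: "('a::euclidean_space schwartz \<Rightarrow> 'a tempered) \<Rightarrow> bool" where
  "spline_admissible L \<longleftrightarrow> linear L \<and> continuous_on UNIV L \<and>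
     (\<forall>a \<phi>. L (shift_schwartz a \<phi>) = shift_tempered a (L \<phi>)) \<and>
     (\<exists>\<rho>. \<rho> \<in> borel_measurable borel \<and> slow_growth \<rho> \<and> maps_function_to L \<rho> dirac)"

section \<open>Levy exponents\<close>

definition levy_measure :: "real measure \<Rightarrow> bool" where
  "levy_measure V \<longleftrightarrow> sets V = sets borel \<and> emeasure V {0} = 0 \<and>
     (\<integral>\<^sup>+t. ennreal (min 1 (t\<^sup>2)) \<partial>V) < \<infinity>"

text \<open>The argument \<open>\<sigma>2\<close> is the Gaussian variance.\<close>

definition levy_triplet :: "(real \<Rightarrow> complex) \<Rightarrow> real \<Rightarrow> real \<Rightarrow> real measure \<Rightarrow> bool" where
  "levy_triplet f \<mu> \<sigma>2 V \<longleftrightarrow> 0 \<le> \<sigma>2 \<and> levy_measure V \<and>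
     (\<forall>\<xi>. f \<xi> = \<i> * \<mu> * \<xi> - \<sigma>2 * \<xi>\<^sup>2 / 2 +
        (\<integral>t. (iexp (\<xi> * t) - 1 - \<i> * \<xi> * t * indicator {t. \<bar>t\<bar> \<le> 1} t) \<partial>V))"

definition levy_exponent :: "(real \<Rightarrow> complex) \<Rightarrow> bool" where
  "levy_exponent f \<longleftrightarrow> (\<exists>\<mu> \<sigma>2 V. levy_triplet f \<mu> \<sigma>2 V)"

definition schwartz_condition :: "(real \<Rightarrow> complex) \<Rightarrow> bool" where
  "schwartz_condition f \<longleftrightarrow> (\<exists>\<mu> \<sigma>2 V \<epsilon>. levy_triplet f \<mu> \<sigma>2 V \<and> 0 < \<epsilon> \<and>
     (\<integral>\<^sup>+t\<in>{t. 1 \<le> \<bar>t\<bar>}. ennreal (\<bar>t\<bar> powr \<epsilon>) \<partial>V) < \<infinity>)"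

definition symmetric_measure :: "real measure \<Rightarrow> bool" where
  "symmetric_measure V \<longleftrightarrow> distr V borel uminus = V"

definition pp_exponent :: "real \<Rightarrow> real \<Rightarrow> (real \<Rightarrow> complex) \<Rightarrow> bool" where
  "pp_exponent pmin pmax f \<longleftrightarrow> 0 \<le> pmin \<and> pmin \<le> pmax \<and> pmax \<le> 2 \<and>
     (\<exists>\<mu> \<sigma>2 V p q. levy_triplet f \<mu> \<sigma>2 V \<and> pmin \<le> p \<and> p \<le> q \<and> q \<le> pmax \<and>
        (\<integral>\<^sup>+t\<in>{t. 1 \<le> \<bar>t\<bar>}. ennreal (\<bar>t\<bar> powr p) \<partial>V) < \<infinity> \<and>
        (\<integral>\<^sup>+t\<in>{t. \<bar>t\<bar> < 1}. ennreal (\<bar>t\<bar> powr q) \<partial>V) < \<infinity> \<and>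
        (\<not> symmetric_measure V \<or> \<mu> \<noteq> 0 \<longrightarrow> pmin = min p 1) \<and>
        (\<sigma>2 \<noteq> 0 \<longrightarrow> pmax = 2))"

section \<open>Generalized random processes\<close>

text \<open>
  Tuples of \<open>N\<close> reals are functions on \<open>{..<N}\<close>, and the product measurable space over \<open>{..<N}\<close>
  carries the Borel sets of \<open>N\<close>-dimensional space.
\<close>

definition cylindrical :: "'a::euclidean_space tempered measure" where
  "cylindrical = sigma UNIV
     {{v. (\<lambda>i\<in>{..<N}. pairing v (\<phi> i)) \<in> B} | N (\<phi> :: nat \<Rightarrow> 'a schwartz) B.
        1 \<le> N \<and> B \<in> sets (\<Pi>\<^sub>M i\<in>{..<N}. (borel :: real measure))}"

definition generalized_random_process ::
  "'b measure \<Rightarrow> ('b \<Rightarrow> 'a::euclidean_space tempered) \<Rightarrow> bool" where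
  "generalized_random_process M s \<longleftrightarrow> prob_space M \<and> s \<in> M \<rightarrow>\<^sub>M cylindrical"

definition process_law ::
  "'b measure \<Rightarrow> ('b \<Rightarrow> 'a::euclidean_space tempered) \<Rightarrow> 'a tempered measure" where
  "process_law M s = distr M cylindrical s"

definition char_functional ::
  "'b measure \<Rightarrow> ('b \<Rightarrow> 'a::euclidean_space tempered) \<Rightarrow> 'a schwartz \<Rightarrow> complex" where
  "char_functional M s \<phi> = (\<integral>\<omega>. iexp (pairing (s \<omega>) \<phi>) \<partial>M)"

definition converges_in_law ::
  "(nat \<Rightarrow> 'b measure) \<Rightarrow> (nat \<Rightarrow> 'b \<Rightarrow> 'a::euclidean_space tempered) \<Rightarrow>
   'c measure \<Rightarrow> ('c \<Rightarrow> 'a tempered) \<Rightarrow> bool" where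
  "converges_in_law M\<^sub>n s\<^sub>n M s \<longleftrightarrow>
     (\<forall>F :: 'a tempered \<Rightarrow> real. continuous_on UNIV F \<and> bounded (range F) \<longrightarrow>
        (\<lambda>n. \<integral>v. F v \<partial>process_law (M\<^sub>n n) (s\<^sub>n n)) \<longlonglongrightarrow> (\<integral>v. F v \<partial>process_law M s))"

text \<open>
  \<open>levy_functional f g c\<close> says that \<open>c = exp (\<integral> f (g x) dx)\<close>. It is a relation so that the formula is
  never read with the value \<open>0\<close> that the Bochner integral takes on non-integrable functions.
\<close>

definition levy_functional :: "(real \<Rightarrow> complex) \<Rightarrow> ('a::euclidean_space \<Rightarrow> real) \<Rightarrow> complex \<Rightarrow> bool" where
  "levy_functional f g c \<longleftrightarrow> (\<exists>J. has_bochner_integral lborel (\<lambda>x. f (g x)) J \<and> c = exp J)"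

definition levy_white_noise ::
  "(real \<Rightarrow> complex) \<Rightarrow> 'b measure \<Rightarrow> ('b \<Rightarrow> 'a::euclidean_space tempered) \<Rightarrow> bool" where
  "levy_white_noise f M w \<longleftrightarrow> levy_exponent f \<and> schwartz_condition f \<and>
     generalized_random_process M w \<and>
     (\<forall>\<phi>. levy_functional f (schwartz_fun \<phi>) (char_functional M w \<phi>))"

text \<open>
  Jumps of size \<open>0\<close> do not contribute to the characteristic functional, so \<open>P\<close> may have an atom
  at \<open>0\<close>. This is needed because the infinitely divisible law with exponent \<open>f / n\<close> may have one.
\<close>

definition impulsive_noise ::
  "real \<Rightarrow> real measure \<Rightarrow> 'b measure \<Rightarrow> ('b \<Rightarrow> 'a::euclidean_space tempered) \<Rightarrow> bool" where
  "impulsive_noise rate P M w \<longleftrightarrow> 0 < rate \<and> real_distribution P \<and>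
     (\<exists>\<epsilon>>0. (\<integral>\<^sup>+t. ennreal (\<bar>t\<bar> powr \<epsilon>) \<partial>P) < \<infinity>) \<and>
     generalized_random_process M w \<and>
     (\<forall>\<phi>. char_functional M w \<phi> =
        exp (rate * (\<integral>x. (\<integral>t. (iexp (schwartz_fun \<phi> x * t) - 1) \<partial>P) \<partial>lborel)))"

definition impulsive_noise_with_exponent ::
  "(real \<Rightarrow> complex) \<Rightarrow> 'b measure \<Rightarrow> ('b \<Rightarrow> 'a::euclidean_space tempered) \<Rightarrow> bool" where
  "impulsive_noise_with_exponent g M w \<longleftrightarrow>
     (\<exists>rate P. impulsive_noise rate P M w \<and> (\<forall>\<xi>. g \<xi> = rate * (char P \<xi> - 1)))"

section \<open>Compatibility and solutions of \<open>L s = w\<close>\<close>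

definition Lp_space :: "real \<Rightarrow> ('a::euclidean_space \<Rightarrow> real) set" where
  "Lp_space p = {g \<in> borel_measurable borel. integrable lborel (\<lambda>x. \<bar>g x\<bar> powr p)}"

text \<open>
  Elements of \<open>L\<^sub>p\<close> are given by representatives, whence the almost-everywhere equalities. For every
  \<open>p > 0\<close>, the topology of \<open>L\<^sub>p\<close> is that of \<open>\<integral>\<bar>g - h\<bar>\<^sup>p \<rightarrow> 0\<close>.
\<close>

definition linear_continuous_into_Lp ::
  "real \<Rightarrow> real \<Rightarrow> ('a::euclidean_space schwartz \<Rightarrow> 'a \<Rightarrow> real) \<Rightarrow> bool" where
  "linear_continuous_into_Lp p q T \<longleftrightarrow>
     (\<forall>\<phi>. T \<phi> \<in> Lp_space p \<inter> Lp_space q) \<and>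
     (\<forall>\<phi> \<psi>. AE x in lborel. T (\<phi> + \<psi>) x = T \<phi> x + T \<psi> x) \<and>
     (\<forall>c \<phi>. AE x in lborel. T (c *\<^sub>R \<phi>) x = c * T \<phi> x) \<and>
     (\<forall>r\<in>{p, q}. \<forall>\<phi>. ((\<lambda>\<psi>. \<integral>x. \<bar>T \<psi> x - T \<phi> x\<bar> powr r \<partial>lborel) \<longlongrightarrow> 0) (nhds \<phi>))"

text \<open>
  In general \<open>L\<^sup>*\<close> maps Schwartz functions to tempered distributions that are not Schwartz functions.
  For \<open>T (L\<^sup>* \<phi>)\<close> to make sense, \<open>T\<close> is therefore defined on tempered distributions, but linearity and
  continuity are required only on Schwartz functions, embedded as distributions.
\<close>

definition left_inverse_of_adjoint ::
  "('a::euclidean_space schwartz \<Rightarrow> 'a tempered) \<Rightarrow> ('a tempered \<Rightarrow> 'a \<Rightarrow> real) \<Rightarrow> bool" where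
  "left_inverse_of_adjoint L T \<longleftrightarrow> (\<forall>\<phi>. AE x in lborel. T (adjoint_op L \<phi>) x = schwartz_fun \<phi> x)"

definition compatible_via ::
  "real \<Rightarrow> real \<Rightarrow> ('a::euclidean_space tempered \<Rightarrow> 'a \<Rightarrow> real) \<Rightarrow>
   ('a schwartz \<Rightarrow> 'a tempered) \<Rightarrow> (real \<Rightarrow> complex) \<Rightarrow> bool" where
  "compatible_via pmin pmax T L f \<longleftrightarrow> 0 < pmin \<and> pmin \<le> pmax \<and> pmax \<le> 2 \<and>
     pp_exponent pmin pmax f \<and> left_inverse_of_adjoint L T \<and>
     linear_continuous_into_Lp pmin pmax (\<lambda>\<phi>. T (tempered_of_schwartz \<phi>))"

text \<open>
  \<open>inverse_process T f M s\<close> says that \<open>s = L\<^sup>-\<^sup>1 w\<close> for the white noise \<open>w\<close> with exponent \<open>f\<close>, the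
  operator \<open>L\<^sup>-\<^sup>1\<close> being the one determined by the left inverse \<open>T\<close>.
\<close>

definition inverse_process ::
  "('a::euclidean_space tempered \<Rightarrow> 'a \<Rightarrow> real) \<Rightarrow> (real \<Rightarrow> complex) \<Rightarrow>
   'b measure \<Rightarrow> ('b \<Rightarrow> 'a tempered) \<Rightarrow> bool" where
  "inverse_process T f M s \<longleftrightarrow> generalized_random_process M s \<and>
     (\<forall>\<phi>. levy_functional f (T (tempered_of_schwartz \<phi>)) (char_functional M s \<phi>))"

end

theory Submission
  imports Defs
begin

text \<open>
  Since \<open>Re f \<le> 0\<close>, we have \<open>\<bar>n (exp (f / n) - 1)\<bar> \<le> \<bar>f\<bar>\<close>, so dominated convergence gives pointwise
  convergence of the characteristic functionals. The rest is Levy's continuity theorem on the dual of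
  the Schwartz space for the strong topology, where the limit is already known to be the law of a process.

  The Hermite expansion \<open>\<phi> = \<Sum>\<^sub>j c\<^sub>j(\<phi>) \<psi>\<^sub>j\<close> has rapidly decreasing coefficients, so a tempered distribution
  is determined by its coordinates \<open>\<langle>v, \<psi>\<^sub>j\<rangle>\<close>, which grow at most polynomially. To prove tightness, evaluate the
  characteristic functionals at the random test function \<open>\<kappa> \<Sum>\<^sub>j g\<^sub>j b\<^sub>j \<psi>\<^sub>j\<close> with rapidly decreasing \<open>b\<close> and
  independent \<open>g\<^sub>j\<close>, uniform on \<open>[-1, 1]\<close>: the average is close to \<open>1\<close> for small \<open>\<kappa>\<close> and large \<open>n\<close>, whereas it
  would be far from \<open>1\<close> if some \<open>b\<^sub>j \<langle>v, \<psi>\<^sub>j\<rangle>\<close> were often large. As \<open>b\<close> is an arbitrary rapidly decreasing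
  sequence, a diagonal argument yields one polynomial bound on all coordinates. The distributions obeying such a
  bound are the image of a unit_cube \<open>[-1, 1]\<^sup>\<nat>\<close> under a continuous map, so there Stone--Weierstrass
  approximates a continuous function of \<open>v\<close> by a polynomial in the numbers \<open>sin (r\<^sub>j \<langle>v, \<psi>\<^sub>j\<rangle>)\<close>.
  This approximation is bounded everywhere, and its integrals converge because it is a
  trigonometric polynomial in the \<open>\<langle>v, \<psi>\<^sub>j\<rangle>\<close>.
\<close>

section \<open>Norms and operators on the Schwartz space\<close>

text \<open>Convergence of the characteristic functionals controls one number
  \<open>pairing v \<phi>\<close> at a time, while tightness concerns all Hermite coordinates at
  once. The random coefficients join the two: for almost every \<open>g\<close> the random series is
  a genuine test function, so the hypothesis applies to it, and dominated convergence passes to the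
  average. Uniform coefficients are bounded, which makes this series converge absolutely in every
  norm, and their characteristic function \<open>sin t / t\<close> is small for large
  \<open>t\<close>. The laws live on the cylindrical sigma-field, while the functions to be
  integrated are continuous for the strong topology; hence the compact sets are built explicitly
  from coordinates, and the approximating functions depend on pairings only, which makes them
  measurable. As for the Hermite functions themselves, ladder operators give orthogonality and the
  growth of all seminorms, powers of the harmonic oscillator give the decay of the coefficients, and
  completeness comes from testing against narrow Gaussians.\<close>

lemma smooth_schwartz_fun: "smooth (schwartz_fun \<phi>)"
  using schwartz_fun[of \<phi>] by auto

text \<open>Linearity of the Frechet derivative reduces it to its values on \<open>Basis\<close>. In
  this form termwise differentiation of a series can be carried out on the \<open>partials\<close>
  alone.\<close>

lemma smooth_has_derivative:
  assumes "smooth \<phi>" and bs: "bs \<in> lists Basis"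
  shows "(partials bs \<phi> has_derivative
    (\<lambda>h. \<Sum>b\<in>Basis. (h \<bullet> b) * partials (b # bs) \<phi> x)) (at x)"
proof -
  let ?D = "frechet_derivative (partials bs \<phi>) (at x)"
  have D: "(partials bs \<phi> has_derivative ?D) (at x)"
    by (rule iffD1[OF frechet_derivative_works smoothD[OF assms]])
  have lin: "linear ?D" by (rule has_derivative_linear[OF D])
  have "?D h = (\<Sum>b\<in>Basis. (h \<bullet> b) * partials (b # bs) \<phi> x)" for h
  proof -
    have "?D h = ?D (\<Sum>b\<in>Basis. (h \<bullet> b) *\<^sub>R b)" by (simp add: euclidean_representation)
    also have "\<dots> = (\<Sum>b\<in>Basis. (h \<bullet> b) * ?D b)" by (simp add: linear_sum[OF lin] linear_scale[OF lin])
    finally show ?thesis by simp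
  qed
  then have "?D = (\<lambda>h. \<Sum>b\<in>Basis. (h \<bullet> b) * partials (b # bs) \<phi> x)" by (rule ext)
  with D show ?thesis by (rule has_derivative_eq_rhs)
qed

lemma partials_append: "partials bs (partials cs \<phi>) = partials (bs @ cs) \<phi>"
  by (induction bs) auto

lemma frechet_derivative_eqI: "(f has_derivative f') (at x) \<Longrightarrow> frechet_derivative f (at x) = f'"
  by (rule frechet_derivative_at[symmetric])

lemma schwartz_seminorm_nonneg: "bs \<in> lists Basis \<Longrightarrow> 0 \<le> schwartz_seminorm k bs \<phi>"
  by (rule order_trans[OF _ schwartz_seminorm_upper[of bs 0 k \<phi>]]) auto

lemma schwartz_seminorm_scaleR_le:
  assumes bs: "bs \<in> lists Basis"
  shows "schwartz_seminorm k bs (c *\<^sub>R \<phi>) \<le> \<bar>c\<bar> * schwartz_seminorm k bs \<phi>"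
proof (rule schwartz_seminorm_least)
  fix x
  have "(1 + norm x) ^ k * \<bar>partials bs (schwartz_fun (c *\<^sub>R \<phi>)) x\<bar>
    = \<bar>c\<bar> * ((1 + norm x) ^ k * \<bar>partials bs (schwartz_fun \<phi>) x\<bar>)"
    by (simp add: scaleR_schwartz.rep_eq partials_scale[OF smooth_schwartz_fun bs] abs_mult)
  also have "\<dots> \<le> \<bar>c\<bar> * schwartz_seminorm k bs \<phi>"
    by (intro mult_left_mono schwartz_seminorm_upper bs) auto
  finally show "(1 + norm x) ^ k * \<bar>partials bs (schwartz_fun (c *\<^sub>R \<phi>)) x\<bar> \<le> \<bar>c\<bar> * schwartz_seminorm k bs \<phi>" .
qed

lemma schwartz_seminorm_add_le:
  assumes bs: "bs \<in> lists Basis"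
  shows "schwartz_seminorm k bs (\<phi> + \<psi>) \<le> schwartz_seminorm k bs \<phi> + schwartz_seminorm k bs \<psi>"
proof (rule schwartz_seminorm_least)
  fix x
  have "(1 + norm x) ^ k * \<bar>partials bs (schwartz_fun (\<phi> + \<psi>)) x\<bar>
    \<le> (1 + norm x) ^ k * (\<bar>partials bs (schwartz_fun \<phi>) x\<bar> + \<bar>partials bs (schwartz_fun \<psi>) x\<bar>)"
    by (simp add: plus_schwartz.rep_eq partials_add[OF smooth_schwartz_fun smooth_schwartz_fun bs] mult_left_mono abs_triangle_ineq)
  also have "\<dots> \<le> schwartz_seminorm k bs \<phi> + schwartz_seminorm k bs \<psi>"
    unfolding distrib_left by (intro add_mono schwartz_seminorm_upper bs)
  finally show "(1 + norm x) ^ k * \<bar>partials bs (schwartz_fun (\<phi> + \<psi>)) x\<bar>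
    \<le> schwartz_seminorm k bs \<phi> + schwartz_seminorm k bs \<psi>" .
qed

section \<open>Increasing norms and continuity estimates\<close>

definition seminorm_index :: "nat \<Rightarrow> (nat \<times> 'a::euclidean_space list) set" where
  "seminorm_index m = {..m} \<times> {bs. set bs \<subseteq> Basis \<and> length bs \<le> m}"

lemma finite_seminorm_index [simp]: "finite (seminorm_index m)"
  unfolding seminorm_index_def by (intro finite_cartesian_product finite_lists_length_le) auto

lemma seminorm_index_iff:
  "(k, bs) \<in> seminorm_index m \<longleftrightarrow> k \<le> m \<and> bs \<in> lists Basis \<and> length bs \<le> m"
  by (auto simp: seminorm_index_def)

text \<open>Summing all seminorms up to order \<open>m\<close> gives an increasing sequence of norms
  for the same topology, so a continuity estimate names one index instead of a finite set of
  seminorms.\<close>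

definition schwartz_norm :: "nat \<Rightarrow> 'a::euclidean_space schwartz \<Rightarrow> real" where
  "schwartz_norm m \<phi> = (\<Sum>(k, bs)\<in>seminorm_index m. schwartz_seminorm k bs \<phi>)"

lemma schwartz_norm_nonneg [simp]: "0 \<le> schwartz_norm m \<phi>"
  unfolding schwartz_norm_def
  by (intro sum_nonneg) (auto simp: seminorm_index_iff intro!: schwartz_seminorm_nonneg)

lemma schwartz_seminorm_le_norm:
  assumes "k \<le> m" "bs \<in> lists Basis" "length bs \<le> m"
  shows "schwartz_seminorm k bs \<phi> \<le> schwartz_norm m \<phi>"
proof -
  have "(\<lambda>(k, bs). schwartz_seminorm k bs \<phi>) (k, bs) \<le> schwartz_norm m \<phi>"
    unfolding schwartz_norm_def using assms
    by (intro member_le_sum) (auto simp: seminorm_index_iff intro!: schwartz_seminorm_nonneg)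
  then show ?thesis by simp
qed

lemma schwartz_norm_upper:
  assumes "k \<le> m" "bs \<in> lists Basis" "length bs \<le> m"
  shows "(1 + norm x) ^ k * \<bar>partials bs (schwartz_fun \<phi>) x\<bar> \<le> schwartz_norm m \<phi>"
  using schwartz_seminorm_upper[OF assms(2)] schwartz_seminorm_le_norm[OF assms] by (rule order_trans)

lemma schwartz_norm_le:
  fixes \<phi> :: "'a::euclidean_space schwartz"
  assumes "\<And>k bs. k \<le> m \<Longrightarrow> bs \<in> lists Basis \<Longrightarrow> length bs \<le> m \<Longrightarrow> schwartz_seminorm k bs \<phi> \<le> C"
  shows "schwartz_norm m \<phi> \<le> real (card (seminorm_index m :: (nat \<times> 'a list) set)) * C"
  unfolding schwartz_norm_def
  by (rule sum_bounded_above) (auto simp: seminorm_index_iff intro!: assms)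

lemma schwartz_norm_mono:
  assumes "m \<le> n"
  shows "schwartz_norm m \<phi> \<le> schwartz_norm n \<phi>"
  unfolding schwartz_norm_def using assms
  by (intro sum_mono2) (auto simp: seminorm_index_iff intro!: schwartz_seminorm_nonneg)

lemma schwartz_norm_scaleR_le: "schwartz_norm m (c *\<^sub>R \<phi>) \<le> \<bar>c\<bar> * schwartz_norm m \<phi>"
  unfolding schwartz_norm_def sum_distrib_left
  by (intro sum_mono) (auto simp: seminorm_index_iff intro!: schwartz_seminorm_scaleR_le)

lemma schwartz_norm_add_le: "schwartz_norm m (\<phi> + \<psi>) \<le> schwartz_norm m \<phi> + schwartz_norm m \<psi>"
  unfolding schwartz_norm_def sum.distrib[symmetric]
  by (intro sum_mono) (auto simp: seminorm_index_iff intro!: schwartz_seminorm_add_le)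

lemma schwartz_norm_diff_le: "schwartz_norm m (\<phi> - \<psi>) \<le> schwartz_norm m \<phi> + schwartz_norm m \<psi>"
  using schwartz_norm_add_le[of m \<phi> "(- 1) *\<^sub>R \<psi>"] schwartz_norm_scaleR_le[of m "- 1" \<psi>] by simp

lemma schwartz_norm_bounded:
  assumes "schwartz_bounded B"
  obtains C where "0 \<le> C" "\<And>\<phi>. \<phi> \<in> B \<Longrightarrow> schwartz_norm m \<phi> \<le> C"
proof -
  define C where "C k bs = Sup (schwartz_seminorm k bs ` B)" for k bs
  have C: "schwartz_seminorm k bs \<phi> \<le> C k bs" if "bs \<in> lists Basis" "\<phi> \<in> B" for k bs \<phi>
    unfolding C_def using assms that by (intro cSUP_upper) (auto simp: schwartz_bounded_def)
  have "schwartz_norm m \<phi> \<le> \<bar>\<Sum>(k, bs)\<in>seminorm_index m. C k bs\<bar>" if "\<phi> \<in> B" for \<phi>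
    unfolding schwartz_norm_def
    by (rule order_trans[OF sum_mono abs_ge_self]) (auto simp: seminorm_index_iff intro!: C that)
  then show ?thesis by (intro that[of "\<bar>\<Sum>(k, bs)\<in>seminorm_index m. C k bs\<bar>"]) auto
qed

text \<open>Scaling argument: the preimage of the unit ball contains a neighbourhood of 0 of the
  form \<open>schwartz_norm m \<psi> < e\<close>, and any \<open>\<phi>\<close> can be scaled into
  it.\<close>

lemma tempered_bound:
  obtains m C where "0 \<le> C" "\<And>\<phi>. \<bar>pairing u \<phi>\<bar> \<le> C * schwartz_norm m \<phi>"
proof -
  have "open (pairing u -` ball 0 1)"
    using continuous_on_pairing[of u] by (subst (asm) continuous_on_open_vimage) auto
  moreover have "0 \<in> pairing u -` ball 0 1" by (simp add: linear_0[OF linear_pairing])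
  ultimately obtain I e where I: "finite I" "I \<subseteq> UNIV \<times> lists Basis" "0 < e"
    "{\<psi>. \<forall>(k, bs)\<in>I. schwartz_seminorm k bs (\<psi> - 0) < e} \<subseteq> pairing u -` ball 0 1"
    unfolding open_schwartz_def by meson
  define m where "m = Max (insert 0 (fst ` I \<union> (length \<circ> snd) ` I))"
  have m: "k \<le> m \<and> length bs \<le> m" if "(k, bs) \<in> I" for k bs
    unfolding m_def using I(1) that by (auto intro!: Max_ge rev_image_eqI)
  have small: "\<bar>pairing u \<psi>\<bar> < 1" if "schwartz_norm m \<psi> < e" for \<psi>
  proof -
    have "schwartz_seminorm k bs \<psi> < e" if "(k, bs) \<in> I" for k bs
    proof -
      have "schwartz_seminorm k bs \<psi> \<le> schwartz_norm m \<psi>"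
        using m[OF that] that I(2) by (intro schwartz_seminorm_le_norm) auto
      then show ?thesis using \<open>schwartz_norm m \<psi> < e\<close> by simp
    qed
    then have "\<psi> \<in> {\<psi>. \<forall>(k, bs)\<in>I. schwartz_seminorm k bs (\<psi> - 0) < e}" by auto
    with I(4) show ?thesis by auto
  qed
  have "\<bar>pairing u \<phi>\<bar> \<le> 2 / e * schwartz_norm m \<phi>" for \<phi>
  proof (cases "schwartz_norm m \<phi> = 0")
    case True
    \<comment> \<open>All multiples of \<open>\<phi>\<close> stay in the neighbourhood of 0, so the
      pairing has to vanish.\<close>
    have "\<bar>pairing u \<phi>\<bar> * real n \<le> 1" for n
    proof -
      have "schwartz_norm m (real n *\<^sub>R \<phi>) < e"
        using schwartz_norm_scaleR_le[of m "real n" \<phi>] True I(3) by simp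
      from small[OF this] show ?thesis
        by (simp add: linear_scale[OF linear_pairing] abs_mult mult.commute)
    qed
    then have "\<not> 0 < \<bar>pairing u \<phi>\<bar>"
      using ex_less_of_nat_mult[of "\<bar>pairing u \<phi>\<bar>" 1] by (metis mult.commute not_le)
    then show ?thesis using True by simp
  next
    case False
    then have pos: "0 < schwartz_norm m \<phi>" using schwartz_norm_nonneg[of m \<phi>] by linarith
    \<comment> \<open>The factor 2 places \<open>c *\<^sub>R \<phi>\<close> strictly inside the
      neighbourhood; it reappears in the bound \<open>2 / e\<close>.\<close>
    define c where "c = e / (2 * schwartz_norm m \<phi>)"
    have c: "0 < c" using pos I(3) by (simp add: c_def)
    have "schwartz_norm m (c *\<^sub>R \<phi>) \<le> e / 2"
      using schwartz_norm_scaleR_le[of m c \<phi>] c pos I(3) by (simp add: c_def)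
    then have "\<bar>pairing u (c *\<^sub>R \<phi>)\<bar> < 1" using I(3) by (intro small) auto
    then have "c * \<bar>pairing u \<phi>\<bar> < 1" using c by (simp add: linear_scale[OF linear_pairing] abs_mult)
    then show ?thesis using pos I(3) by (simp add: c_def field_simps)
  qed
  then show ?thesis using I(3) by (intro that[of "2 / e" m]) auto
qed

text \<open>Converse of \<open>tempered_bound\<close>; it certifies that functionals given by a
  series are tempered.\<close>

lemma continuous_functional_normI:
  fixes u :: "'a::euclidean_space schwartz \<Rightarrow> real"
  assumes lin: "linear u" and bound: "\<And>\<phi>. \<bar>u \<phi>\<bar> \<le> C * schwartz_norm m \<phi>"
  shows "continuous_on UNIV u"
proof (rule continuous_on_open_vimage[THEN iffD2, OF open_UNIV], intro allI impI)
  fix S :: "real set" assume S: "open S"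
  have "open (u -` S)"
    unfolding open_schwartz_def
  proof
    fix \<phi> assume "\<phi> \<in> u -` S"
    then obtain e where e: "0 < e" "\<And>y. dist y (u \<phi>) < e \<Longrightarrow> y \<in> S"
      using S unfolding open_dist by blast
    define N where "N = card (seminorm_index m :: (nat \<times> 'a list) set)"
    \<comment> \<open>A norm is a sum of \<open>N\<close> seminorms, each kept below
      \<open>d\<close>. The two summands 1 make the divisor positive and the final estimate
      strict.\<close>
    define d where "d = e / ((\<bar>C\<bar> + 1) * (real N + 1))"
    have d: "0 < d" using e unfolding d_def by auto
    have "{\<psi>. \<forall>(k, bs)\<in>seminorm_index m. schwartz_seminorm k bs (\<psi> - \<phi>) < d} \<subseteq> u -` S"
    proof (intro subsetI vimageI2, drule CollectD)
      fix \<psi> assume *: "\<forall>(k, bs)\<in>seminorm_index m. schwartz_seminorm k bs (\<psi> - \<phi>) < d"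
      have "schwartz_norm m (\<psi> - \<phi>) \<le> N * d"
        unfolding N_def using * by (intro schwartz_norm_le less_imp_le) (auto simp: seminorm_index_iff)
      then have le: "schwartz_norm m (\<psi> - \<phi>) < (real N + 1) * d"
        using d by (simp add: algebra_simps)
      have "dist (u \<psi>) (u \<phi>) = \<bar>u (\<psi> - \<phi>)\<bar>"
        using linear_diff[OF lin] by (simp add: dist_real_def)
      also have "\<dots> \<le> (\<bar>C\<bar> + 1) * schwartz_norm m (\<psi> - \<phi>)"
        using bound[of "\<psi> - \<phi>"] by (elim order_trans) (intro mult_right_mono, auto)
      also have "\<dots> < (\<bar>C\<bar> + 1) * ((real N + 1) * d)"
        using le by (intro mult_strict_left_mono) auto
      also have "\<dots> = ((\<bar>C\<bar> + 1) * (real N + 1)) * d" by (simp only: mult.assoc)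
      also have "\<dots> = e" unfolding d_def by (simp add: nonzero_mult_div_cancel_left add_nonneg_eq_0_iff)
      finally show "u \<psi> \<in> S" by (rule e(2))
    qed
    moreover have "seminorm_index m \<subseteq> UNIV \<times> lists (Basis :: 'a set)"
      by (auto simp: seminorm_index_def)
    ultimately show "\<exists>I \<epsilon>. finite I \<and> I \<subseteq> UNIV \<times> lists Basis \<and> 0 < \<epsilon> \<and>
        {\<psi>. \<forall>(k, bs)\<in>I. schwartz_seminorm k bs (\<psi> - \<phi>) < \<epsilon>} \<subseteq> u -` S"
      by (intro exI[of _ "seminorm_index m"] exI[of _ d] conjI finite_seminorm_index d)
  qed
  then show "open (u -` S \<inter> UNIV)" by simp
qed

lemma schwartz_eqI: "(\<And>x. schwartz_fun \<phi> x = schwartz_fun \<psi> x) \<Longrightarrow> \<phi> = \<psi>"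
  by (rule iffD1[OF schwartz_fun_inject]) (rule ext)

lemma minus_schwartz_fun: "schwartz_fun (\<phi> - \<psi>) x = schwartz_fun \<phi> x - schwartz_fun \<psi> x"
  unfolding minus_schwartz_def plus_schwartz.rep_eq uminus_schwartz.rep_eq by (rule add_uminus_conv_diff)

lemma sum_schwartz_fun: "schwartz_fun (\<Sum>i\<in>A. f i) x = (\<Sum>i\<in>A. schwartz_fun (f i) x)"
  by (induction A rule: infinite_finite_induct) (auto simp: plus_schwartz.rep_eq zero_schwartz.rep_eq)

section \<open>Derivatives and multiplication by coordinates\<close>

text \<open>Smoothness and decay are stated for derivatives along \<open>Basis\<close> only, so
  other directions get the value 0 to make the operator total.\<close>

lift_definition partial_schwartz :: "'a::euclidean_space \<Rightarrow> 'a schwartz \<Rightarrow> 'a schwartz" is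
  "\<lambda>b \<phi>. if b \<in> Basis then partials [b] \<phi> else (\<lambda>x. 0)"
proof -
  fix b :: 'a and \<phi> :: "'a \<Rightarrow> real"
  assume \<phi>: "smooth \<phi> \<and> rapidly_decaying \<phi>"
  have "smooth (partials [b] \<phi>)" "rapidly_decaying (partials [b] \<phi>)" if "b \<in> Basis"
    using \<phi> that unfolding smooth_def rapidly_decaying_def partials_append
    by (auto simp del: partials.simps)
  then show "smooth (if b \<in> Basis then partials [b] \<phi> else (\<lambda>x. 0)) \<and>
      rapidly_decaying (if b \<in> Basis then partials [b] \<phi> else (\<lambda>x. 0))"
    by (auto simp: smooth_def rapidly_decaying_def partials_zero simp del: partials.simps)
qed

lemma partials_partial_schwartz:
  "b \<in> Basis \<Longrightarrow> partials bs (schwartz_fun (partial_schwartz b \<phi>)) = partials (bs @ [b]) (schwartz_fun \<phi>)"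
  by (simp add: partial_schwartz.rep_eq partials_append del: partials.simps)

lemma schwartz_norm_partial:
  assumes b: "b \<in> Basis"
  obtains C where "0 \<le> C" "\<And>\<phi>. schwartz_norm m (partial_schwartz b \<phi>) \<le> C * schwartz_norm (Suc m) \<phi>"
proof
  fix \<phi> :: "'a schwartz"
  show "schwartz_norm m (partial_schwartz b \<phi>)
    \<le> card (seminorm_index m :: (nat \<times> 'a list) set) * schwartz_norm (Suc m) \<phi>"
  proof (rule schwartz_norm_le, rule schwartz_seminorm_least)
    fix k bs x assume "k \<le> m" "bs \<in> lists (Basis :: 'a set)" "length bs \<le> m"
    then show "(1 + norm x) ^ k * \<bar>partials bs (schwartz_fun (partial_schwartz b \<phi>)) x\<bar>
        \<le> schwartz_norm (Suc m) \<phi>"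
      unfolding partials_partial_schwartz[OF b] using b by (intro schwartz_norm_upper) auto
  qed
qed simp

lemma schwartz_fun_partial_schwartz:
  "b \<in> Basis \<Longrightarrow> schwartz_fun (partial_schwartz b \<phi>) x = partials [b] (schwartz_fun \<phi>) x"
  by (simp add: partial_schwartz.rep_eq)

text \<open>Leibniz rule. The coordinate is linear, so at most one derivative hits it;
  \<open>take i bs @ drop (Suc i) bs\<close> is the list with that derivative deleted.\<close>

lemma partials_coord_mult:
  assumes sm: "smooth \<phi>" and "bs \<in> lists Basis"
  shows "partials bs (\<lambda>x. (x \<bullet> a) * \<phi> x) = (\<lambda>x. (x \<bullet> a) * partials bs \<phi> x +
    (\<Sum>i<length bs. (bs ! i \<bullet> a) * partials (take i bs @ drop (Suc i) bs) \<phi> x))"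
  using assms(2)
proof (induction bs)
  case Nil
  show ?case by simp
next
  case (Cons b bs)
  then have bs: "bs \<in> lists Basis" and b: "b \<in> Basis" by auto
  have del: "take i bs @ drop (Suc i) bs \<in> lists Basis" for i
    using bs by (auto dest: in_set_takeD in_set_dropD)
  have D: "(partials cs \<phi> has_derivative frechet_derivative (partials cs \<phi>) (at x)) (at x)"
    if "cs \<in> lists Basis" for cs x
    by (rule iffD1[OF frechet_derivative_works smoothD[OF sm that]])
  have "((\<lambda>x. (x \<bullet> a) * partials bs \<phi> x +
      (\<Sum>i<length bs. (bs ! i \<bullet> a) * partials (take i bs @ drop (Suc i) bs) \<phi> x)) has_derivative
    (\<lambda>h. (h \<bullet> a) * partials bs \<phi> x + (x \<bullet> a) * frechet_derivative (partials bs \<phi>) (at x) h +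
      (\<Sum>i<length bs. (bs ! i \<bullet> a) *
        frechet_derivative (partials (take i bs @ drop (Suc i) bs) \<phi>) (at x) h))) (at x)" for x
    by (auto intro!: derivative_eq_intros D[OF bs] D[OF del])
  from fun_cong[OF frechet_derivative_eqI[OF this], of _ b]
  have "frechet_derivative (partials bs (\<lambda>x. (x \<bullet> a) * \<phi> x)) (at x) b =
    (b \<bullet> a) * partials bs \<phi> x + (x \<bullet> a) * frechet_derivative (partials bs \<phi>) (at x) b +
      (\<Sum>i<length bs. (bs ! i \<bullet> a) *
        frechet_derivative (partials (take i bs @ drop (Suc i) bs) \<phi>) (at x) b)" for x
    unfolding Cons.IH .
  then show ?case
    by (simp add: sum.lessThan_Suc_shift add.assoc add.left_commute del: sum.lessThan_Suc)
qed

lemma lists_delete_nth: "bs \<in> lists A \<Longrightarrow> take i bs @ drop (Suc i) bs \<in> lists A"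
  by (auto dest: in_set_takeD in_set_dropD)

lemma partials_coord_mult_le:
  fixes a x :: "'a::euclidean_space"
  assumes sm: "smooth \<phi>" and bs: "bs \<in> lists Basis"
  shows "(1 + norm x) ^ k * \<bar>partials bs (\<lambda>x. (x \<bullet> a) * \<phi> x) x\<bar> \<le>
    norm a * ((1 + norm x) ^ Suc k * \<bar>partials bs \<phi> x\<bar>) +
    (\<Sum>i<length bs. norm a * ((1 + norm x) ^ k * \<bar>partials (take i bs @ drop (Suc i) bs) \<phi> x\<bar>))"
proof -
  let ?P = "\<lambda>i. partials (take i bs @ drop (Suc i) bs) \<phi> x"
  have "(1 + norm x) ^ k * \<bar>(x \<bullet> a) * partials bs \<phi> x + (\<Sum>i<length bs. (bs ! i \<bullet> a) * ?P i)\<bar>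
    \<le> (1 + norm x) ^ k * (\<bar>(x \<bullet> a) * partials bs \<phi> x\<bar> + (\<Sum>i<length bs. \<bar>(bs ! i \<bullet> a) * ?P i\<bar>))"
    by (intro mult_left_mono order_trans[OF abs_triangle_ineq] add_left_mono sum_abs) auto
  also have "\<dots> = \<bar>x \<bullet> a\<bar> * ((1 + norm x) ^ k * \<bar>partials bs \<phi> x\<bar>) +
      (\<Sum>i<length bs. \<bar>bs ! i \<bullet> a\<bar> * ((1 + norm x) ^ k * \<bar>?P i\<bar>))"
    by (simp add: distrib_left sum_distrib_left abs_mult mult.left_commute)
  also have "\<dots> \<le> (norm a * (1 + norm x)) * ((1 + norm x) ^ k * \<bar>partials bs \<phi> x\<bar>) +
      (\<Sum>i<length bs. norm a * ((1 + norm x) ^ k * \<bar>?P i\<bar>))"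
  proof (intro add_mono sum_mono mult_right_mono)
    have "\<bar>x \<bullet> a\<bar> \<le> norm x * norm a" by (rule Cauchy_Schwarz_ineq2)
    also have "\<dots> \<le> norm a * (1 + norm x)" by (simp add: algebra_simps)
    finally show "\<bar>x \<bullet> a\<bar> \<le> norm a * (1 + norm x)" .
    fix i assume "i \<in> {..<length bs}"
    then have "bs ! i \<in> Basis" using bs by (auto simp: in_lists_conv_set)
    then show "\<bar>bs ! i \<bullet> a\<bar> \<le> norm a" using Basis_le_norm[of "bs ! i" a] by (simp add: inner_commute)
  qed auto
  finally show ?thesis
    unfolding partials_coord_mult[OF sm bs] by (simp only: power_Suc mult.assoc)
qed

lift_definition coord_mult :: "'a::euclidean_space \<Rightarrow> 'a schwartz \<Rightarrow> 'a schwartz" is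
  "\<lambda>a \<phi> x. (x \<bullet> a) * \<phi> x"
proof -
  fix a :: 'a and \<phi> :: "'a \<Rightarrow> real"
  assume "smooth \<phi> \<and> rapidly_decaying \<phi>"
  then have sm: "smooth \<phi>" and rd: "rapidly_decaying \<phi>" by auto
  have "smooth (\<lambda>x. (x \<bullet> a) * \<phi> x)"
    unfolding smooth_def
  proof (intro ballI allI)
    fix bs :: "'a list" and x :: 'a
    assume bs: "bs \<in> lists Basis"
    show "partials bs (\<lambda>x. (x \<bullet> a) * \<phi> x) differentiable at x"
      unfolding partials_coord_mult[OF sm bs]
      by (intro differentiable_add differentiable_mult differentiable_sum ballI differentiable_const
          smoothD[OF sm bs] smoothD[OF sm lists_delete_nth[OF bs]]
          bounded_linear_imp_differentiable bounded_linear_inner_left) auto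
  qed
  moreover have "rapidly_decaying (\<lambda>x. (x \<bullet> a) * \<phi> x)"
    unfolding rapidly_decaying_def
  proof (intro ballI allI)
    fix bs :: "'a list" and k :: nat
    assume bs: "bs \<in> lists Basis"
    obtain C where C: "\<And>x. (1 + norm x) ^ Suc k * \<bar>partials bs \<phi> x\<bar> \<le> C"
      using rapidly_decayingD[OF rd bs] by blast
    have "\<exists>C. \<forall>x. (1 + norm x) ^ k * \<bar>partials (take i bs @ drop (Suc i) bs) \<phi> x\<bar> \<le> C" for i
      by (rule rapidly_decayingD[OF rd lists_delete_nth[OF bs]]) blast
    then have "\<exists>C. \<forall>i x. (1 + norm x) ^ k * \<bar>partials (take i bs @ drop (Suc i) bs) \<phi> x\<bar> \<le> C i"
      by (intro choice allI)
    then obtain D where D: "\<And>i x. (1 + norm x) ^ k * \<bar>partials (take i bs @ drop (Suc i) bs) \<phi> x\<bar> \<le> D i"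
      by blast
    have "(1 + norm x) ^ k * \<bar>partials bs (\<lambda>x. (x \<bullet> a) * \<phi> x) x\<bar> \<le> norm a * C + (\<Sum>i<length bs. norm a * D i)" for x
      by (rule order_trans[OF partials_coord_mult_le[OF sm bs]])
        (intro add_mono sum_mono mult_left_mono C D norm_ge_zero)
    then show "bdd_above (range (\<lambda>x. (1 + norm x) ^ k * \<bar>partials bs (\<lambda>x. (x \<bullet> a) * \<phi> x) x\<bar>))"
      by (intro bdd_aboveI2)
  qed
  ultimately show "smooth (\<lambda>x. (x \<bullet> a) * \<phi> x) \<and> rapidly_decaying (\<lambda>x. (x \<bullet> a) * \<phi> x)" ..
qed

lemma schwartz_norm_coord_mult:
  fixes a :: "'a::euclidean_space"
  obtains C where "0 \<le> C" "\<And>\<phi>. schwartz_norm m (coord_mult a \<phi>) \<le> C * schwartz_norm (Suc m) \<phi>"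
proof
  let ?N = "card (seminorm_index m :: (nat \<times> 'a list) set)"
  show "0 \<le> ?N * (norm a + m * norm a)" by simp
  fix \<phi> :: "'a schwartz"
  have "schwartz_norm m (coord_mult a \<phi>) \<le> ?N * ((norm a + m * norm a) * schwartz_norm (Suc m) \<phi>)"
  proof (rule schwartz_norm_le, rule schwartz_seminorm_least)
    fix k bs x assume k: "k \<le> m" and bs: "bs \<in> lists (Basis :: 'a set)" and len: "length bs \<le> m"
    have "(1 + norm x) ^ k * \<bar>partials bs (schwartz_fun (coord_mult a \<phi>)) x\<bar>
        \<le> norm a * schwartz_norm (Suc m) \<phi> + (\<Sum>i<length bs. norm a * schwartz_norm (Suc m) \<phi>)"
      unfolding coord_mult.rep_eq
      by (rule order_trans[OF partials_coord_mult_le[OF smooth_schwartz_fun bs]],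
          intro add_mono sum_mono mult_left_mono schwartz_norm_upper lists_delete_nth bs norm_ge_zero)
        (use k len in auto)
    also have "\<dots> \<le> (norm a + m * norm a) * schwartz_norm (Suc m) \<phi>"
      using len by (auto simp: distrib_right mult.assoc intro!: mult_right_mono)
    finally show "(1 + norm x) ^ k * \<bar>partials bs (schwartz_fun (coord_mult a \<phi>)) x\<bar>
        \<le> (norm a + m * norm a) * schwartz_norm (Suc m) \<phi>" .
  qed
  then show "schwartz_norm m (coord_mult a \<phi>) \<le> ?N * (norm a + m * norm a) * schwartz_norm (Suc m) \<phi>"
    by (simp add: mult.assoc)
qed

section \<open>Convergent series of test functions\<close>

lemma tempered_bound_tendsto:
  assumes "\<And>m. (\<lambda>i. schwartz_norm m (f i)) \<longlonglongrightarrow> 0"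
  shows "(\<lambda>i. pairing v (f i)) \<longlonglongrightarrow> 0"
proof -
  obtain m C where C: "0 \<le> C" "\<And>\<phi>. \<bar>pairing v \<phi>\<bar> \<le> C * schwartz_norm m \<phi>"
    by (rule tempered_bound[of v]) blast
  have "(\<lambda>i. C * schwartz_norm m (f i)) \<longlonglongrightarrow> 0"
    using tendsto_mult_left[OF assms, of C m] by simp
  then show ?thesis by (rule Lim_null_comparison[rotated]) (simp add: C)
qed

text \<open>Completeness of the Schwartz space, for absolutely convergent series. The tails
  \<open>R m\<close> are uniform in \<open>x\<close>, which allows termwise differentiation to every
  order. The sum is described by its pairings, the form in which it is used.\<close>

lemma schwartz_series:
  fixes f :: "nat \<Rightarrow> 'a::euclidean_space schwartz"
  assumes f: "\<And>m. summable (\<lambda>j. schwartz_norm m (f j))"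
  obtains \<phi> where "\<And>v. (\<lambda>j. pairing v (f j)) sums pairing v \<phi>"
proof -
  define p where "p bs j = partials bs (schwartz_fun (f j))" for bs j
  have p_le: "(1 + norm x) ^ k * \<bar>p bs j x\<bar> \<le> schwartz_norm m (f j)"
    if "bs \<in> lists Basis" "k \<le> m" "length bs \<le> m" for k m bs j x
    unfolding p_def by (intro schwartz_norm_upper that)
  have p_le': "\<bar>p bs j x\<bar> \<le> schwartz_norm (length bs) (f j)" if "bs \<in> lists Basis" for bs j x
    using p_le[OF that, of 0 "length bs"] by simp
  have p_summable: "summable (\<lambda>j. p bs j x)" if "bs \<in> lists Basis" for bs x
    using p_le'[OF that] by (intro summable_comparison_test'[OF f[of "length bs"]]) auto
  define P where "P bs x = (\<Sum>j. p bs j x)" for bs x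
  have p_sums: "(\<lambda>j. p bs j x) sums P bs x" if "bs \<in> lists Basis" for bs x
    unfolding P_def using p_summable[OF that] by (rule summable_sums)
  define R where "R m n = (\<Sum>j. schwartz_norm m (f (j + n)))" for m n
  have tail: "(1 + norm x) ^ k * \<bar>P bs x - (\<Sum>j<n. p bs j x)\<bar> \<le> R m n"
    if "bs \<in> lists Basis" "k \<le> m" "length bs \<le> m" for k m bs n x
  proof -
    have s: "summable (\<lambda>j. p bs (j + n) x)"
      by (rule summable_ignore_initial_segment[OF p_summable[OF that(1)]])
    have "P bs x - (\<Sum>j<n. p bs j x) = (\<Sum>j. p bs (j + n) x)"
      unfolding P_def using suminf_split_initial_segment[OF p_summable[OF that(1)], of x n] by simp
    then have "(1 + norm x) ^ k * \<bar>P bs x - (\<Sum>j<n. p bs j x)\<bar> = \<bar>\<Sum>j. (1 + norm x) ^ k * p bs (j + n) x\<bar>"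
      using suminf_mult[OF s, of "(1 + norm x) ^ k"] by (simp add: abs_mult)
    also have "\<dots> \<le> R m n"
    proof -
      have "norm (\<Sum>j. (1 + norm x) ^ k * p bs (j + n) x) \<le> (\<Sum>j. schwartz_norm m (f (j + n)))"
        using p_le[OF that(1,2,3)] summable_ignore_initial_segment[OF f[of m], of n]
        by (intro norm_suminf_le) (auto simp: abs_mult)
      then show ?thesis by (simp add: R_def)
    qed
    finally show ?thesis .
  qed
  have R_lim: "R m \<longlonglongrightarrow> 0" for m
  proof -
    have "R m n = (\<Sum>j. schwartz_norm m (f j)) - (\<Sum>j<n. schwartz_norm m (f j))" for n
      unfolding R_def using suminf_split_initial_segment[OF f[of m], of n] by simp
    then have "R m = (\<lambda>n. (\<Sum>j. schwartz_norm m (f j)) - (\<Sum>j<n. schwartz_norm m (f j)))" ..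
    moreover have "(\<lambda>n. (\<Sum>j. schwartz_norm m (f j)) - (\<Sum>j<n. schwartz_norm m (f j))) \<longlonglongrightarrow>
      (\<Sum>j. schwartz_norm m (f j)) - (\<Sum>j. schwartz_norm m (f j))"
      by (intro tendsto_intros summable_LIMSEQ f)
    ultimately show ?thesis by simp
  qed
  have tail0: "\<bar>P bs x - (\<Sum>j<n. p bs j x)\<bar> \<le> R (length bs) n" if "bs \<in> lists Basis" for bs n x
    using tail[OF that, of 0 "length bs" x n] by simp
  \<comment> \<open>The derivative of the \<open>n\<close>-th partial sum misses its limit by one
    tail per basis direction, with one more derivative: hence
    \<open>DIM('a) * R (Suc (length bs)) n\<close>.\<close>
  have deriv: "(P bs has_derivative (\<lambda>h. \<Sum>b\<in>Basis. (h \<bullet> b) * P (b # bs) x)) (at x)"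
    if bs: "bs \<in> lists Basis" for bs x
  proof -
    have "\<exists>g. \<forall>x\<in>UNIV. (\<lambda>j. p bs j x) sums g x \<and>
        (g has_derivative (\<lambda>h. \<Sum>b\<in>Basis. (h \<bullet> b) * P (b # bs) x)) (at x within UNIV)"
    proof (rule has_derivative_series)
      show "(p bs j has_derivative (\<lambda>h. \<Sum>b\<in>Basis. (h \<bullet> b) * p (b # bs) j x)) (at x within UNIV)" for j x
        unfolding p_def by (rule smooth_has_derivative[OF smooth_schwartz_fun bs])
      fix e :: real assume e: "e > 0"
      have "(\<lambda>n. DIM('a) * R (Suc (length bs)) n) \<longlonglongrightarrow> 0"
        using tendsto_mult_left[OF R_lim, of "DIM('a)"] by simp
      then have "\<forall>\<^sub>F n in sequentially. DIM('a) * R (Suc (length bs)) n < e"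
        using e by (rule order_tendstoD)
      then show "\<forall>\<^sub>F n in sequentially. \<forall>x\<in>UNIV. \<forall>h. norm ((\<Sum>i<n. \<Sum>b\<in>Basis. (h \<bullet> b) * p (b # bs) i x) -
          (\<Sum>b\<in>Basis. (h \<bullet> b) * P (b # bs) x)) \<le> e * norm h"
      proof (eventually_elim, intro ballI allI)
        fix n x and h :: 'a assume n: "DIM('a) * R (Suc (length bs)) n < e"
        have "(\<Sum>i<n. \<Sum>b\<in>Basis. (h \<bullet> b) * p (b # bs) i x) - (\<Sum>b\<in>Basis. (h \<bullet> b) * P (b # bs) x) =
          (\<Sum>b\<in>Basis. (h \<bullet> b) * ((\<Sum>i<n. p (b # bs) i x) - P (b # bs) x))"
          by (subst sum.swap) (simp add: right_diff_distrib sum_distrib_left sum_subtractf)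
        also have "norm \<dots> \<le> (\<Sum>b\<in>(Basis::'a set). norm h * R (Suc (length bs)) n)"
        proof (rule sum_norm_le)
          fix b :: 'a assume b: "b \<in> Basis"
          have "\<bar>(\<Sum>i<n. p (b # bs) i x) - P (b # bs) x\<bar> \<le> R (Suc (length bs)) n"
            using tail0[of "b # bs" x n] b bs by (simp add: abs_minus_commute)
          then show "norm ((h \<bullet> b) * ((\<Sum>i<n. p (b # bs) i x) - P (b # bs) x)) \<le> norm h * R (Suc (length bs)) n"
            using Basis_le_norm[OF b, of h] by (auto simp: abs_mult intro!: mult_mono)
        qed
        also have "\<dots> = (DIM('a) * R (Suc (length bs)) n) * norm h" by simp
        also have "\<dots> \<le> e * norm h" using n by (intro mult_right_mono) auto
        finally show "norm ((\<Sum>i<n. \<Sum>b\<in>Basis. (h \<bullet> b) * p (b # bs) i x) -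
          (\<Sum>b\<in>Basis. (h \<bullet> b) * P (b # bs) x)) \<le> e * norm h" .
      qed
    next
      show "(\<lambda>j. p bs j 0) sums P bs 0" by (rule p_sums[OF bs])
    qed auto
    then obtain g where g: "\<And>x. (\<lambda>j. p bs j x) sums g x"
      "\<And>x. (g has_derivative (\<lambda>h. \<Sum>b\<in>Basis. (h \<bullet> b) * P (b # bs) x)) (at x)" by auto
    have "g = P bs" using sums_unique2[OF g(1) p_sums[OF bs]] by (rule ext)
    with g(2) show ?thesis by simp
  qed
  have partials_P: "partials bs (P []) = P bs" if "bs \<in> lists Basis" for bs
    using that
  proof (induction bs)
    case (Cons b bs)
    have "(\<Sum>c\<in>Basis. (b \<bullet> c) * P (c # bs) x) = P (b # bs) x" for x
      using Cons.hyps by (simp add: inner_Basis if_distribR if_distrib[of "\<lambda>z. z * _"] sum.delta cong: if_cong)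
    with Cons show ?case
      by (simp add: frechet_derivative_eqI[OF deriv])
  qed simp
  have sm: "smooth (P [])"
    unfolding smooth_def
  proof (intro ballI allI)
    fix bs :: "'a list" and x :: 'a assume bs: "bs \<in> lists Basis"
    show "partials bs (P []) differentiable at x"
      unfolding partials_P[OF bs] using deriv[OF bs] by (rule differentiableI)
  qed
  have rd: "rapidly_decaying (P [])"
    unfolding rapidly_decaying_def
  proof (intro ballI allI)
    fix bs :: "'a list" and k assume bs: "bs \<in> lists Basis"
    show "bdd_above (range (\<lambda>x. (1 + norm x) ^ k * \<bar>partials bs (P []) x\<bar>))"
      \<comment> \<open>The empty partial sum turns the tail estimate into a bound on
        \<open>P bs\<close> itself; the index has to dominate both the weight and the order of
        differentiation.\<close>
      unfolding partials_P[OF bs] using tail[OF bs, of k "max k (length bs)" _ 0]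
      by (intro bdd_aboveI2[where M = "R (max k (length bs)) 0"]) simp
  qed
  define \<phi> where "\<phi> = Abs_schwartz (P [])"
  have \<phi>: "schwartz_fun \<phi> = P []"
    unfolding \<phi>_def using sm rd by (intro Abs_schwartz_inverse) simp
  have diff: "schwartz_norm m (\<phi> - (\<Sum>j<n. f j)) \<le> card (seminorm_index m :: (nat \<times> 'a list) set) * R m n" for m n
  proof (rule schwartz_norm_le, rule schwartz_seminorm_least)
    fix k bs x assume *: "k \<le> m" "bs \<in> lists (Basis :: 'a set)" "length bs \<le> m"
    have sum: "partials bs (schwartz_fun (\<Sum>j<n. f j)) x = (\<Sum>j<n. p bs j x)" for x
    proof (induction n)
      case 0
      then show ?case by (simp add: zero_schwartz.rep_eq partials_zero)
    next
      case (Suc n)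
      then show ?case
        by (simp add: plus_schwartz.rep_eq partials_add[OF smooth_schwartz_fun smooth_schwartz_fun *(2)] p_def)
    qed
    have "schwartz_fun (\<phi> - (\<Sum>j<n. f j)) = (\<lambda>x. P [] x + (- 1) * schwartz_fun (\<Sum>j<n. f j) x)"
      by (rule ext) (simp add: minus_schwartz_fun \<phi>)
    then have "partials bs (schwartz_fun (\<phi> - (\<Sum>j<n. f j))) x = P bs x + (- 1) * (\<Sum>j<n. p bs j x)"
      by (simp only: partials_add[OF sm smooth_scale[OF smooth_schwartz_fun] *(2)]
        partials_scale[OF smooth_schwartz_fun *(2)] partials_P[OF *(2)] sum)
    then show "(1 + norm x) ^ k * \<bar>partials bs (schwartz_fun (\<phi> - (\<Sum>j<n. f j))) x\<bar> \<le> R m n"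
      using tail[OF *(2,1,3)] by simp
  qed
  have "(\<lambda>j. pairing v (f j)) sums pairing v \<phi>" for v
  proof -
    have "(\<lambda>n. schwartz_norm m (\<phi> - (\<Sum>j<n. f j))) \<longlonglongrightarrow> 0" for m
    proof (rule Lim_null_comparison)
      show "(\<lambda>n. card (seminorm_index m :: (nat \<times> 'a list) set) * R m n) \<longlonglongrightarrow> 0"
        by (rule tendsto_mult_right_zero[OF R_lim])
    qed (use diff[of m] in simp)
    from tempered_bound_tendsto[OF this, of v]
    have "(\<lambda>n. pairing v \<phi> - (\<Sum>j<n. pairing v (f j))) \<longlonglongrightarrow> 0"
      by (simp add: linear_diff[OF linear_pairing] linear_sum[OF linear_pairing])
    from tendsto_diff[OF tendsto_const[of "pairing v \<phi>"] this] show ?thesis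
      by (simp add: sums_def)
  qed
  then show ?thesis by (rule that)
qed

subsection \<open>Integration by parts\<close>

text \<open>Comparison with the product of one-dimensional weights: each of its
  \<open>DIM('a)\<close> factors \<open>1 + (x \<bullet> b)\<^sup>2\<close> is at most
  \<open>(1 + norm x)\<^sup>2\<close>, whence the exponent.\<close>

lemma integrable_inverse_norm_power:
  "integrable lborel (\<lambda>x::'a::euclidean_space. inverse ((1 + norm x) ^ (2 * DIM('a))))"
proof (rule Bochner_Integration.integrable_bound[OF integrable_inverse_square_prod])
  show "AE x :: 'a in lborel. norm (inverse ((1 + norm x) ^ (2 * DIM('a)))) \<le>
    norm (\<Prod>b\<in>Basis. inverse (1 + (x \<bullet> b)\<^sup>2))"
  proof (intro AE_I2)
    fix x :: 'a
    have "(\<Prod>b\<in>Basis. 1 + (x \<bullet> b)\<^sup>2) \<le> (\<Prod>b\<in>(Basis::'a set). (1 + norm x)\<^sup>2)"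
    proof (intro prod_mono conjI)
      fix b :: 'a assume "b \<in> Basis"
      then have "(x \<bullet> b)\<^sup>2 \<le> (norm x)\<^sup>2"
        using Basis_le_norm[of b x] by (simp add: abs_le_square_iff[symmetric])
      then show "1 + (x \<bullet> b)\<^sup>2 \<le> (1 + norm x)\<^sup>2"
        using norm_ge_zero[of x] by (simp add: power2_sum del: norm_ge_zero)
    qed auto
    also have "\<dots> = (1 + norm x) ^ (2 * DIM('a))" by (simp add: power_mult)
    finally have "(\<Prod>b\<in>Basis. 1 + (x \<bullet> b)\<^sup>2) \<le> (1 + norm x) ^ (2 * DIM('a))" .
    moreover have "0 < (\<Prod>b\<in>Basis. 1 + (x \<bullet> b)\<^sup>2)"
      by (intro prod_pos) (auto intro: add_pos_nonneg)
    ultimately have "inverse ((1 + norm x) ^ (2 * DIM('a))) \<le> inverse (\<Prod>b\<in>Basis. 1 + (x \<bullet> b)\<^sup>2)"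
      by (rule le_imp_inverse_le)
    also have "\<dots> = (\<Prod>b\<in>Basis. inverse (1 + (x \<bullet> b)\<^sup>2))" by (simp add: prod_inversef[unfolded o_def, symmetric])
    finally show "norm (inverse ((1 + norm x) ^ (2 * DIM('a)))) \<le>
        norm (\<Prod>b\<in>Basis. inverse (1 + (x \<bullet> b)\<^sup>2))"
      using abs_ge_self by (simp add: order_trans)
  qed
qed simp

text \<open>Differentiate the translation-invariant integral \<open>\<integral> F (x + t b) dx\<close> in \<open>t\<close>.\<close>

lemma integral_directional_derivative:
  fixes F :: "'a::euclidean_space \<Rightarrow> real"
  assumes F: "integrable lborel F" and D: "\<And>x. (F has_derivative F' x) (at x)"
    and bound: "\<And>x. (1 + norm x) ^ (2 * DIM('a)) * \<bar>F' x b\<bar> \<le> C"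
  shows "has_bochner_integral lborel (\<lambda>x. F' x b) 0"
proof -
  let ?N = "2 * DIM('a)"
  define G where "G n x = real (Suc n) * (F (x + inverse (real (Suc n)) *\<^sub>R b) - F x)" for n x
  have C: "0 \<le> C" using bound[of 0] by (rule order_trans[rotated]) auto
  have meas_F[measurable]: "F \<in> borel_measurable borel" using F by auto
  have shift: "integrable lborel (\<lambda>x. F (x + a))" "(\<integral>x. F (x + a) \<partial>lborel) = (\<integral>x. F x \<partial>lborel)" for a
    using F integrable_distr_eq[of "(+) a" lborel borel F] integral_distr[of "(+) a" lborel borel F]
    by (simp_all add: lborel_distr_plus add.commute)
  have G_lim: "(\<lambda>n. G n x) \<longlonglongrightarrow> F' x b" for x
  proof -
    have "((\<lambda>t. F (x + t *\<^sub>R b)) has_field_derivative F' x b) (at 0)"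
    proof -
      have "((\<lambda>t. x + t *\<^sub>R b) has_derivative (\<lambda>t. t *\<^sub>R b)) (at 0)"
        by (auto intro!: derivative_eq_intros)
      from has_derivative_compose[OF this, of F "F' x"] D[of x]
      have "((\<lambda>t. F (x + t *\<^sub>R b)) has_derivative (\<lambda>t. F' x (t *\<^sub>R b))) (at 0)" by simp
      moreover have "F' x (t *\<^sub>R b) = F' x b * t" for t
        using linear_scale[OF has_derivative_linear[OF D]] by simp
      ultimately show ?thesis by (simp add: has_field_derivative_def)
    qed
    then have "((\<lambda>t. (F (x + t *\<^sub>R b) - F x) / t) \<longlongrightarrow> F' x b) (at 0)"
      by (simp add: DERIV_def)
    moreover have "filterlim (\<lambda>n. inverse (real (Suc n))) (at 0) sequentially"
      using LIMSEQ_inverse_real_of_nat by (auto simp: filterlim_at)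
    ultimately have "((\<lambda>n. (F (x + inverse (real (Suc n)) *\<^sub>R b) - F x) / inverse (real (Suc n))) \<longlonglongrightarrow> F' x b)"
      by (rule filterlim_compose)
    then show ?thesis unfolding G_def by (simp add: divide_inverse mult.commute)
  qed
  \<comment> \<open>By the mean value theorem, \<open>G n x\<close> is a derivative at a point
    within distance \<open>norm b\<close> of \<open>x\<close>. Moving the weight from that point
    back to \<open>x\<close> costs the factor \<open>(1 + norm b) ^ ?N\<close>.\<close>
  have G_le: "\<bar>G n x\<bar> \<le> C * (1 + norm b) ^ ?N * inverse ((1 + norm x) ^ ?N)" for n x
  proof -
    let ?t = "inverse (real (Suc n))"
    have t: "0 < ?t" "?t \<le> 1" by (auto simp: field_simps)
    have "\<exists>z\<in>{0<..<?t}. F (x + ?t *\<^sub>R b) - F (x + 0 *\<^sub>R b) = F' (x + z *\<^sub>R b) (?t *\<^sub>R b)"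
    proof -
      have d: "((\<lambda>t. F (x + t *\<^sub>R b)) has_derivative (\<lambda>s. F' (x + t *\<^sub>R b) (s *\<^sub>R b))) (at t)" for t
      proof -
        have "((\<lambda>t. x + t *\<^sub>R b) has_derivative (\<lambda>t. t *\<^sub>R b)) (at t)"
          by (auto intro!: derivative_eq_intros)
        from has_derivative_compose[OF this, of F "F' (x + t *\<^sub>R b)"] D show ?thesis by simp
      qed
      have cont: "continuous_on {0..?t} (\<lambda>t. F (x + t *\<^sub>R b))"
        by (intro continuous_at_imp_continuous_on ballI has_derivative_continuous[OF d])
      show ?thesis
        by (rule mvt[OF t(1) cont d]) auto
    qed
    then obtain z where z: "0 < z" "z < ?t" "F (x + ?t *\<^sub>R b) - F x = F' (x + z *\<^sub>R b) (?t *\<^sub>R b)"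
      by auto
    have "F' (x + z *\<^sub>R b) (?t *\<^sub>R b) = ?t * F' (x + z *\<^sub>R b) b"
      using linear_scale[OF has_derivative_linear[OF D], of "x + z *\<^sub>R b" ?t b] by simp
    then have G: "G n x = F' (x + z *\<^sub>R b) b"
      unfolding G_def z(3) by simp
    let ?y = "x + z *\<^sub>R b"
    have "(1 + norm x) ^ ?N \<le> (1 + norm (- (z *\<^sub>R b))) ^ ?N * (1 + norm ?y) ^ ?N"
      using one_plus_norm_add_power[of ?y "- (z *\<^sub>R b)" ?N] by simp
    also have "\<dots> \<le> (1 + norm b) ^ ?N * (1 + norm ?y) ^ ?N"
      using z t by (intro mult_right_mono power_mono) (auto intro!: mult_left_le_one_le)
    finally have "(1 + norm x) ^ ?N * \<bar>G n x\<bar> \<le> (1 + norm b) ^ ?N * ((1 + norm ?y) ^ ?N * \<bar>F' ?y b\<bar>)"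
      unfolding G mult.assoc[symmetric] by (intro mult_right_mono) auto
    also have "\<dots> \<le> (1 + norm b) ^ ?N * C" by (intro mult_left_mono bound) auto
    finally have "(1 + norm x) ^ ?N * \<bar>G n x\<bar> \<le> C * (1 + norm b) ^ ?N" by (simp add: mult.commute)
    moreover have "0 < (1 + norm x) ^ ?N" by (simp add: add_pos_nonneg)
    ultimately show ?thesis
      by (simp add: pos_le_divide_eq divide_inverse[symmetric] mult.commute[of "\<bar>G n x\<bar>"])
  qed
  have w: "integrable lborel (\<lambda>x::'a. C * (1 + norm b) ^ ?N * inverse ((1 + norm x) ^ ?N))"
    by (intro integrable_mult_right impI integrable_inverse_norm_power)
  have G_meas: "G n \<in> borel_measurable lborel" for n unfolding G_def by measurable
  have F'_meas: "(\<lambda>x. F' x b) \<in> borel_measurable lborel"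
    using G_lim G_meas by (rule borel_measurable_LIMSEQ_real)
  note dct = F'_meas G_meas w AE_I2[OF G_lim] AE_I2[OF G_le[folded real_norm_def]]
  have int: "integrable lborel (\<lambda>x. F' x b)"
    by (rule integrable_dominated_convergence[OF dct])
  have lim: "(\<lambda>n. \<integral>x. G n x \<partial>lborel) \<longlonglongrightarrow> (\<integral>x. F' x b \<partial>lborel)"
    by (rule integral_dominated_convergence[OF dct])
  have "(\<integral>x. G n x \<partial>lborel) = 0" for n
    unfolding G_def using shift F by simp
  then have "(\<integral>x. F' x b \<partial>lborel) = 0"
    using LIMSEQ_unique[OF lim, of 0] by simp
  with int show ?thesis by (simp add: has_bochner_integral_iff)
qed

definition schwartz_inner :: "'a::euclidean_space schwartz \<Rightarrow> 'a schwartz \<Rightarrow> real" where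
  "schwartz_inner \<phi> \<psi> = (\<integral>x. schwartz_fun \<phi> x * schwartz_fun \<psi> x \<partial>lborel)"

lemma schwartz_inner_add: "schwartz_inner \<phi> (\<psi> + \<theta>) = schwartz_inner \<phi> \<psi> + schwartz_inner \<phi> \<theta>"
  and schwartz_inner_diff: "schwartz_inner \<phi> (\<psi> - \<theta>) = schwartz_inner \<phi> \<psi> - schwartz_inner \<phi> \<theta>"
  and schwartz_inner_scaleR: "schwartz_inner \<phi> (c *\<^sub>R \<psi>) = c * schwartz_inner \<phi> \<psi>"
  and schwartz_inner_commute: "schwartz_inner \<phi> \<psi> = schwartz_inner \<psi> \<phi>"
  by (simp_all add: schwartz_inner_def plus_schwartz.rep_eq minus_schwartz_fun scaleR_schwartz.rep_eq
    distrib_left right_diff_distrib mult.left_commute integrable_schwartz_fun_mult mult.commute)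

lemma pairing_tempered_of_schwartz: "pairing (tempered_of_schwartz \<phi>) \<psi> = schwartz_inner \<phi> \<psi>"
  by (simp add: tempered_of_schwartz.rep_eq schwartz_inner_def)

lemma schwartz_inner_coord_mult: "schwartz_inner (coord_mult a \<phi>) \<psi> = schwartz_inner \<phi> (coord_mult a \<psi>)"
  by (simp add: schwartz_inner_def coord_mult.rep_eq mult_ac)

text \<open>By the product rule the two sides differ by the integral of a directional derivative of
  the product, which vanishes.\<close>

lemma schwartz_inner_partial:
  fixes \<phi> \<psi> :: "'a::euclidean_space schwartz"
  assumes b: "b \<in> Basis"
  shows "schwartz_inner (partial_schwartz b \<phi>) \<psi> = - schwartz_inner \<phi> (partial_schwartz b \<psi>)"
proof -
  let ?N = "2 * DIM('a)"
  let ?d = "\<lambda>\<phi> x h. \<Sum>c\<in>Basis. (h \<bullet> c) * partials [c] (schwartz_fun \<phi>) x"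
  have d: "(schwartz_fun \<phi> has_derivative ?d \<phi> x) (at x)" for x and \<phi> :: "'a schwartz"
    using smooth_has_derivative[OF smooth_schwartz_fun, of "[]"] by (simp del: partials.simps(2))
  have d_b: "?d \<phi> x b = schwartz_fun (partial_schwartz b \<phi>) x" for x and \<phi> :: "'a schwartz"
    using b by (simp add: inner_Basis if_distribR if_distrib[of "\<lambda>z. z * _"] sum.delta schwartz_fun_partial_schwartz cong: if_cong del: partials.simps)
  let ?F' = "\<lambda>x h. schwartz_fun \<phi> x * ?d \<psi> x h + ?d \<phi> x h * schwartz_fun \<psi> x"
  have "has_bochner_integral lborel (\<lambda>x. ?F' x b) 0"
  proof (rule integral_directional_derivative)
    show "integrable lborel (\<lambda>x. schwartz_fun \<phi> x * schwartz_fun \<psi> x)"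
      by (rule integrable_schwartz_fun_mult)
    show "((\<lambda>x. schwartz_fun \<phi> x * schwartz_fun \<psi> x) has_derivative ?F' x) (at x)" for x
      by (rule has_derivative_mult[OF d d])
    fix x :: 'a
    have le: "(1 + norm x) ^ ?N * \<bar>schwartz_fun \<phi> x * schwartz_fun \<psi> x\<bar> \<le> schwartz_norm ?N \<phi> * schwartz_norm 0 \<psi>"
      for \<phi> \<psi> :: "'a schwartz"
    proof -
      have "((1 + norm x) ^ ?N * \<bar>schwartz_fun \<phi> x\<bar>) * \<bar>schwartz_fun \<psi> x\<bar> \<le> schwartz_norm ?N \<phi> * schwartz_norm 0 \<psi>"
        using schwartz_norm_upper[of ?N ?N "[]" x \<phi>] schwartz_norm_upper[of 0 0 "[]" x \<psi>]
        by (intro mult_mono) auto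
      then show ?thesis by (simp add: abs_mult mult.assoc)
    qed
    have "(1 + norm x) ^ ?N * \<bar>?F' x b\<bar> \<le>
      (1 + norm x) ^ ?N * \<bar>schwartz_fun \<phi> x * schwartz_fun (partial_schwartz b \<psi>) x\<bar> +
      (1 + norm x) ^ ?N * \<bar>schwartz_fun (partial_schwartz b \<phi>) x * schwartz_fun \<psi> x\<bar>"
      unfolding d_b distrib_left[symmetric] by (intro mult_left_mono abs_triangle_ineq) auto
    also have "\<dots> \<le> schwartz_norm ?N \<phi> * schwartz_norm 0 (partial_schwartz b \<psi>) +
        schwartz_norm ?N (partial_schwartz b \<phi>) * schwartz_norm 0 \<psi>"
      by (intro add_mono le)
    finally show "(1 + norm x) ^ ?N * \<bar>?F' x b\<bar> \<le> \<dots>" .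
  qed
  then have "(\<integral>x. schwartz_fun \<phi> x * schwartz_fun (partial_schwartz b \<psi>) x +
      schwartz_fun (partial_schwartz b \<phi>) x * schwartz_fun \<psi> x \<partial>lborel) = 0"
    unfolding d_b by (rule has_bochner_integral_integral_eq)
  then show ?thesis by (simp add: schwartz_inner_def integrable_schwartz_fun_mult)
qed

section \<open>Hermite functions\<close>

text \<open>Normalised so that all of them have the same \<open>L\<^sup>2\<close> norm. In the recurrences below, \<open>hermite (n - 1)\<close>
  has the coefficient \<open>0\<close> when \<open>n = 0\<close>.\<close>

fun hermite :: "nat \<Rightarrow> real \<Rightarrow> real" where
  "hermite 0 t = exp (- (t\<^sup>2 / 2))"
| "hermite (Suc 0) t = 2 * t * exp (- (t\<^sup>2 / 2)) / sqrt 2"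
| "hermite (Suc (Suc n)) t =
    (2 * t * hermite (Suc n) t - sqrt (2 * real (Suc n)) * hermite n t) / sqrt (2 * real (Suc (Suc n)))"

lemma hermite_mult:
  "2 * (t * hermite n t) =
    sqrt (2 * real n) * hermite (n - 1) t + sqrt (2 * real (Suc n)) * hermite (Suc n) t"
proof (cases n)
  case (Suc m)
  then show ?thesis by (simp del: of_nat_Suc)
qed simp

text \<open>The induction closes on this unsymmetric form, in which \<open>t * hermite n t\<close>
  is kept. The recurrence then yields the ladder form.\<close>

lemma hermite_has_derivative_aux:
  "(hermite n has_real_derivative sqrt (2 * real n) * hermite (n - 1) t - t * hermite n t) (at t)"
proof (induction n arbitrary: t rule: induct_nat_012)
  case 0
  have "((\<lambda>t. exp (- (t\<^sup>2 / 2))) has_real_derivative - (t * exp (- (t\<^sup>2 / 2)))) (at t)" for t :: real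
    by (auto intro!: derivative_eq_intros)
  then show ?case by simp
next
  case 1
  have "((\<lambda>t. 2 * t * exp (- (t\<^sup>2 / 2)) / sqrt 2) has_real_derivative
    sqrt 2 * exp (- (t\<^sup>2 / 2)) - t * (2 * t * exp (- (t\<^sup>2 / 2)) / sqrt 2)) (at t)" for t
    by (auto intro!: derivative_eq_intros simp: field_simps)
  moreover have "hermite (Suc 0) = (\<lambda>t. 2 * t * exp (- (t\<^sup>2 / 2)) / sqrt 2)" by (rule ext) simp
  ultimately show ?case by simp
next
  case (ge2 n)
  define r where "r = sqrt (2 * real (Suc (Suc n)))"
  define q where "q = sqrt (2 * real (Suc n))"
  have r: "r > 0" "r * r = 2 * real (Suc (Suc n))" and q: "q * q = 2 * real (Suc n)"
    by (simp_all add: r_def q_def)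
  have eq: "hermite (Suc (Suc n)) = (\<lambda>t. (2 * t * hermite (Suc n) t - q * hermite n t) / r)"
    by (rule ext) (simp add: r_def q_def)
  have *: "(hermite (Suc (Suc n)) has_real_derivative
      r * hermite (Suc n) t - t * hermite (Suc (Suc n)) t) (at t)" for t
  proof -
    \<comment> \<open>The recurrence rewrites the induction hypothesis for \<open>n\<close> so that
      it involves \<open>hermite n\<close> and \<open>hermite (Suc n)\<close> in place of
      \<open>hermite (n - 1)\<close>.\<close>
    have 1: "(hermite n has_real_derivative (t * hermite n t - q * hermite (Suc n) t)) (at t)"
    proof -
      have "sqrt (2 * real n) * hermite (n - 1) t - t * hermite n t = t * hermite n t - q * hermite (Suc n) t"
        using hermite_mult[of t n] unfolding q_def by (simp only: diff_eq_eq)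
      with ge2(1)[of t] show ?thesis by (simp only:)
    qed
    have 2: "(hermite (Suc n) has_real_derivative (q * hermite n t - t * hermite (Suc n) t)) (at t)"
      using ge2(2)[of t] by (simp add: q_def)
    have "((\<lambda>t. (2 * t * hermite (Suc n) t - q * hermite n t) / r) has_real_derivative
      (2 * hermite (Suc n) t + 2 * t * (q * hermite n t - t * hermite (Suc n) t)
        - q * (t * hermite n t - q * hermite (Suc n) t)) / r) (at t)"
      using r(1) by (auto intro!: derivative_eq_intros 1 2)
    also have "(2 * hermite (Suc n) t + 2 * t * (q * hermite n t - t * hermite (Suc n) t)
        - q * (t * hermite n t - q * hermite (Suc n) t)) / r =
      ((2 + q * q) * hermite (Suc n) t + (2 * t * (q * hermite n t - t * hermite (Suc n) t)
        - q * t * hermite n t)) / r"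
      by (simp add: algebra_simps)
    \<comment> \<open>This identity between consecutive normalising constants reproduces the factor
      \<open>r\<close> of the claim.\<close>
    also have "2 + q * q = r * r" by (simp add: r q)
    also have "((r * r) * hermite (Suc n) t + (2 * t * (q * hermite n t - t * hermite (Suc n) t)
        - q * t * hermite n t)) / r = r * hermite (Suc n) t - t * hermite (Suc (Suc n)) t"
      unfolding eq using r(1) by (simp add: field_simps)
    finally show ?thesis unfolding eq .
  qed
  then show ?case by (simp add: r_def del: hermite.simps)
qed

lemma hermite_has_derivative:
  "(hermite n has_real_derivative
    (sqrt (2 * real n) * hermite (n - 1) t - sqrt (2 * real (Suc n)) * hermite (Suc n) t) / 2) (at t)"
proof -
  have eq: "sqrt (2 * real n) * hermite (n - 1) t - t * hermite n t =
      (sqrt (2 * real n) * hermite (n - 1) t - sqrt (2 * real (Suc n)) * hermite (Suc n) t) / 2"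
  proof -
    have "2 * x = a + b \<Longrightarrow> a - x = (a - b) / 2" for x a b :: real by simp
    then show ?thesis using hermite_mult[of t n] by blast
  qed
  from hermite_has_derivative_aux[of n t] show ?thesis by (simp only: eq)
qed

text \<open>Raise \<open>y \<le> exp y\<close> with \<open>y = t\<^sup>2 / (2 * (k + 1))\<close> to
  the power \<open>k + 1\<close>; this explains the constant \<open>?C\<close>. Powers of lower
  degree are absorbed by adding 1.\<close>

lemma power_times_gaussian_bounded: "\<exists>C. \<forall>t::real. \<bar>t ^ k * exp (- (t\<^sup>2 / 2))\<bar> \<le> C"
proof (intro exI allI)
  fix t :: real
  let ?C = "real (2 * Suc k) ^ Suc k"
  have "t\<^sup>2 / (2 * real (Suc k)) \<le> exp (t\<^sup>2 / (2 * real (Suc k)))"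
    using exp_ge_add_one_self[of "t\<^sup>2 / (2 * real (Suc k))"] by linarith
  then have "(t\<^sup>2 / (2 * real (Suc k))) ^ Suc k \<le> exp (t\<^sup>2 / (2 * real (Suc k))) ^ Suc k"
    by (intro power_mono) auto
  also have "\<dots> = exp (t\<^sup>2 / 2)"
    by (subst exp_of_nat_mult[symmetric]) (simp add: field_simps)
  finally have "(t\<^sup>2) ^ Suc k \<le> ?C * exp (t\<^sup>2 / 2)"
    by (simp add: power_divide divide_le_eq mult.commute del: power_Suc)
  moreover have "\<bar>t\<bar> ^ k \<le> 1 + (t\<^sup>2) ^ Suc k"
  proof (cases "\<bar>t\<bar> \<le> 1")
    case True
    then have "\<bar>t\<bar> ^ k \<le> 1" by (intro power_le_one abs_ge_zero)
    moreover have "0 \<le> (t\<^sup>2) ^ Suc k" by (rule zero_le_power[OF zero_le_power2])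
    ultimately show ?thesis by linarith
  next
    case False
    then have "1 \<le> \<bar>t\<bar>" by simp
    then have "\<bar>t\<bar> ^ k \<le> \<bar>t\<bar> ^ (2 * Suc k)" by (intro power_increasing) simp_all
    also have "\<dots> = (t\<^sup>2) ^ Suc k" by (simp only: power_mult power2_abs)
    finally show ?thesis by simp
  qed
  ultimately have "\<bar>t\<bar> ^ k \<le> 1 + ?C * exp (t\<^sup>2 / 2)" by linarith
  also have "\<dots> \<le> (1 + ?C) * exp (t\<^sup>2 / 2)" by (simp add: distrib_right del: power_Suc)
  finally have "\<bar>t\<bar> ^ k * exp (- (t\<^sup>2 / 2)) \<le> (1 + ?C) * exp (t\<^sup>2 / 2) * exp (- (t\<^sup>2 / 2))"
    by (intro mult_right_mono) auto
  also have "\<dots> = 1 + ?C" by (simp add: mult.assoc exp_add[symmetric] del: power_Suc)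
  finally show "\<bar>t ^ k * exp (- (t\<^sup>2 / 2))\<bar> \<le> 1 + ?C"
    by (simp add: abs_mult power_abs del: power_Suc)
qed

text \<open>The recurrence trades a step in \<open>n\<close> for one more power of \<open>t\<close>,
  so the induction runs over all \<open>k\<close> simultaneously.\<close>

lemma power_times_hermite_bounded: "\<exists>C. \<forall>t. \<bar>t ^ k * hermite n t\<bar> \<le> C"
proof (induction n arbitrary: k rule: less_induct)
  case (less n)
  consider "n = 0" | "n = Suc 0" | m where "n = Suc (Suc m)"
    by (metis not0_implies_Suc)
  then show ?case
  proof cases
    case 1
    then show ?thesis using power_times_gaussian_bounded[of k] by simp
  next
    case 2
    obtain C where C: "\<And>t::real. \<bar>t ^ Suc k * exp (- (t\<^sup>2 / 2))\<bar> \<le> C"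
      using power_times_gaussian_bounded[of "Suc k"] by blast
    have "\<bar>t ^ k * hermite n t\<bar> \<le> 2 * C / sqrt 2" for t
      using C[of t] 2 by (simp add: abs_mult mult_ac divide_right_mono)
    then show ?thesis by blast
  next
    case (3 m)
    obtain C where C: "\<And>t. \<bar>t ^ Suc k * hermite (Suc m) t\<bar> \<le> C" using less[of "Suc m" "Suc k"] 3 by auto
    obtain D where D: "\<And>t. \<bar>t ^ k * hermite m t\<bar> \<le> D" using less[of m k] 3 by auto
    let ?r = "sqrt (2 * real (Suc (Suc m)))" and ?q = "sqrt (2 * real (Suc m))"
    have "\<bar>t ^ k * hermite n t\<bar> \<le> (2 * C + ?q * D) / ?r" for t
    proof -
      have "t ^ k * hermite n t = (2 * (t ^ Suc k * hermite (Suc m) t) - ?q * (t ^ k * hermite m t)) / ?r"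
        by (simp add: 3 algebra_simps diff_divide_distrib del: of_nat_Suc)
      also have "\<bar>\<dots>\<bar> = \<bar>2 * (t ^ Suc k * hermite (Suc m) t) - ?q * (t ^ k * hermite m t)\<bar> / ?r"
        by (simp add: abs_divide del: of_nat_Suc power_Suc)
      also have "\<dots> \<le> (2 * C + ?q * D) / ?r"
      proof (rule divide_right_mono)
        have "\<bar>2 * (t ^ Suc k * hermite (Suc m) t) - ?q * (t ^ k * hermite m t)\<bar> \<le>
          2 * \<bar>t ^ Suc k * hermite (Suc m) t\<bar> + ?q * \<bar>t ^ k * hermite m t\<bar>"
          by (rule order_trans[OF abs_triangle_ineq4]) (simp add: abs_mult del: of_nat_Suc power_Suc)
        also have "\<dots> \<le> 2 * C + ?q * D" by (intro add_mono mult_left_mono C D) auto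
        finally show "\<bar>2 * (t ^ Suc k * hermite (Suc m) t) - ?q * (t ^ k * hermite m t)\<bar> \<le> 2 * C + ?q * D" .
      qed simp
      finally show ?thesis .
    qed
    then show ?thesis by blast
  qed
qed

section \<open>Hermite functions in several variables\<close>

text \<open>The multi-index is a function on the whole space of which only the values on
  \<open>Basis\<close> count; hence \<open>herm_cong\<close> and the restriction to
  \<open>Basis\<close> in \<open>herm_enumeration\<close>.\<close>

definition herm_fun :: "('a::euclidean_space \<Rightarrow> nat) \<Rightarrow> 'a \<Rightarrow> real" where
  "herm_fun \<alpha> x = (\<Prod>b\<in>Basis. hermite (\<alpha> b) (x \<bullet> b))"

lemma herm_fun_split:
  assumes "b \<in> Basis"
  shows "herm_fun (\<alpha>(b := n)) x = hermite n (x \<bullet> b) * (\<Prod>c\<in>Basis - {b}. hermite (\<alpha> c) (x \<bullet> c))"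
proof -
  have "(\<Prod>c\<in>Basis - {b}. hermite ((\<alpha>(b := n)) c) (x \<bullet> c)) = (\<Prod>c\<in>Basis - {b}. hermite (\<alpha> c) (x \<bullet> c))"
    by (intro prod.cong) auto
  then show ?thesis
    unfolding herm_fun_def prod.remove[OF finite_Basis assms] by simp
qed

lemma herm_fun_mult:
  assumes "b \<in> Basis"
  shows "(x \<bullet> b) * herm_fun \<alpha> x =
    (sqrt (2 * real (\<alpha> b)) * herm_fun (\<alpha>(b := \<alpha> b - 1)) x +
     sqrt (2 * real (Suc (\<alpha> b))) * herm_fun (\<alpha>(b := Suc (\<alpha> b))) x) / 2"
proof -
  let ?p = "\<Prod>c\<in>Basis - {b}. hermite (\<alpha> c) (x \<bullet> c)"
  have "(x \<bullet> b) * herm_fun \<alpha> x = (2 * ((x \<bullet> b) * hermite (\<alpha> b) (x \<bullet> b))) * ?p / 2"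
    using herm_fun_split[OF assms, of \<alpha> "\<alpha> b" x] by simp
  also have "\<dots> = (sqrt (2 * real (\<alpha> b)) * (hermite (\<alpha> b - 1) (x \<bullet> b) * ?p) +
     sqrt (2 * real (Suc (\<alpha> b))) * (hermite (Suc (\<alpha> b)) (x \<bullet> b) * ?p)) / 2"
    unfolding hermite_mult by (simp only: distrib_right mult.assoc)
  finally show ?thesis unfolding herm_fun_split[OF assms] .
qed

lemma herm_fun_has_derivative:
  "(herm_fun \<alpha> has_derivative (\<lambda>h. \<Sum>b\<in>Basis. (h \<bullet> b) *
    ((sqrt (2 * real (\<alpha> b)) * herm_fun (\<alpha>(b := \<alpha> b - 1)) x -
     sqrt (2 * real (Suc (\<alpha> b))) * herm_fun (\<alpha>(b := Suc (\<alpha> b))) x) / 2))) (at x)"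
proof -
  let ?d = "\<lambda>b. (sqrt (2 * real (\<alpha> b)) * hermite (\<alpha> b - 1) (x \<bullet> b)
    - sqrt (2 * real (Suc (\<alpha> b))) * hermite (Suc (\<alpha> b)) (x \<bullet> b)) / 2"
  have "((\<lambda>x. \<Prod>b\<in>Basis. hermite (\<alpha> b) (x \<bullet> b)) has_derivative
    (\<lambda>h. \<Sum>b\<in>Basis. (h \<bullet> b) * ?d b * (\<Prod>c\<in>Basis - {b}. hermite (\<alpha> c) (x \<bullet> c)))) (at x)"
  proof (rule has_derivative_prod)
    fix b :: 'a
    have "((\<lambda>x. x \<bullet> b) has_derivative (\<lambda>h. h \<bullet> b)) (at x)"
      by (auto intro!: derivative_eq_intros)
    from has_derivative_compose[OF this hermite_has_derivative[unfolded has_field_derivative_def]]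
    show "((\<lambda>x. hermite (\<alpha> b) (x \<bullet> b)) has_derivative (\<lambda>h. (h \<bullet> b) * ?d b)) (at x)"
      by (simp add: mult.commute)
  qed
  moreover have "(h \<bullet> b) * ?d b * (\<Prod>c\<in>Basis - {b}. hermite (\<alpha> c) (x \<bullet> c)) =
    (h \<bullet> b) * ((sqrt (2 * real (\<alpha> b)) * herm_fun (\<alpha>(b := \<alpha> b - 1)) x -
     sqrt (2 * real (Suc (\<alpha> b))) * herm_fun (\<alpha>(b := Suc (\<alpha> b))) x) / 2)" if "b \<in> Basis" for b h
    unfolding herm_fun_split[OF that] by (simp add: algebra_simps diff_divide_distrib del: of_nat_Suc)
  moreover have "herm_fun \<alpha> = (\<lambda>x. \<Prod>b\<in>Basis. hermite (\<alpha> b) (x \<bullet> b))"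
    by (rule ext) (rule herm_fun_def)
  ultimately show ?thesis
    by (simp only:) (erule has_derivative_eq_rhs, intro ext sum.cong refl, assumption)
qed

lemma herm_fun_bounded: "\<exists>C. \<forall>x. \<bar>herm_fun \<alpha> x\<bar> \<le> C"
proof -
  have "\<exists>C. \<forall>t. \<bar>hermite n t\<bar> \<le> C" for n
    using power_times_hermite_bounded[of 0 n] by simp
  then obtain C where C: "\<And>n t. \<bar>hermite n t\<bar> \<le> C n" by metis
  have "\<bar>herm_fun \<alpha> x\<bar> \<le> (\<Prod>b\<in>Basis. C (\<alpha> b))" for x
    unfolding herm_fun_def abs_prod by (intro prod_mono conjI C) auto
  then show ?thesis by blast
qed

text \<open>The linear span of the Hermite functions is stable under partial derivatives and under
  multiplication by coordinates, so boundedness of its elements already yields rapid decay.\<close>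

inductive herm_comb :: "('a::euclidean_space \<Rightarrow> real) \<Rightarrow> bool" where
  base: "herm_comb (herm_fun \<alpha>)"
| add: "herm_comb f \<Longrightarrow> herm_comb g \<Longrightarrow> herm_comb (\<lambda>x. f x + g x)"
| scale: "herm_comb f \<Longrightarrow> herm_comb (\<lambda>x. c * f x)"

lemma herm_comb_mult: "herm_comb f \<Longrightarrow> b \<in> Basis \<Longrightarrow> herm_comb (\<lambda>x. (x \<bullet> b) * f x)"
proof (induction rule: herm_comb.induct)
  case (base \<alpha>)
  have "(\<lambda>x. (x \<bullet> b) * herm_fun \<alpha> x) = (\<lambda>x. (sqrt (2 * real (\<alpha> b)) / 2) * herm_fun (\<alpha>(b := \<alpha> b - 1)) x +
     (sqrt (2 * real (Suc (\<alpha> b))) / 2) * herm_fun (\<alpha>(b := Suc (\<alpha> b))) x)"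
    unfolding herm_fun_mult[OF base] by (simp add: add_divide_distrib)
  then show ?case by (simp only: herm_comb.intros)
next
  case (add f g)
  from herm_comb.add[OF add.IH] add.prems show ?case by (simp add: distrib_left)
next
  case (scale f c)
  from herm_comb.scale[OF scale.IH, of c] scale.prems show ?case by (simp add: mult.left_commute)
qed

lemma sum_inner_Basis: "b \<in> Basis \<Longrightarrow> (\<Sum>c\<in>Basis. (b \<bullet> c) * f c) = f b"
  by (simp add: inner_Basis if_distribR if_distrib[of "\<lambda>z. z * _"] sum.delta cong: if_cong)

lemma herm_comb_derivative:
  "herm_comb f \<Longrightarrow> \<exists>f'. (\<forall>x. (f has_derivative f' x) (at x)) \<and> (\<forall>b\<in>Basis. herm_comb (\<lambda>x. f' x b))"
proof (induction rule: herm_comb.induct)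
  case (base \<alpha>)
  let ?d = "\<lambda>x b. (sqrt (2 * real (\<alpha> b)) / 2) * herm_fun (\<alpha>(b := \<alpha> b - 1)) x +
     (- sqrt (2 * real (Suc (\<alpha> b))) / 2) * herm_fun (\<alpha>(b := Suc (\<alpha> b))) x"
  have "(herm_fun \<alpha> has_derivative (\<lambda>h. \<Sum>b\<in>Basis. (h \<bullet> b) * ?d x b)) (at x)" for x
    using herm_fun_has_derivative[of \<alpha> x] by (simp add: diff_divide_distrib)
  moreover have "herm_comb (\<lambda>x. \<Sum>c\<in>Basis. (b \<bullet> c) * ?d x c)" if "b \<in> Basis" for b
  proof -
    have "(\<lambda>x. \<Sum>c\<in>Basis. (b \<bullet> c) * ?d x c) = (\<lambda>x. ?d x b)"
      using that by (simp only: sum_inner_Basis)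
    then show ?thesis by (simp only: herm_comb.intros)
  qed
  ultimately show ?case by (intro exI[of _ "\<lambda>x h. \<Sum>b\<in>Basis. (h \<bullet> b) * ?d x b"]) auto
next
  case (add f g)
  then obtain f' g' where "\<And>x. (f has_derivative f' x) (at x)" "\<And>b. b \<in> Basis \<Longrightarrow> herm_comb (\<lambda>x. f' x b)"
    "\<And>x. (g has_derivative g' x) (at x)" "\<And>b. b \<in> Basis \<Longrightarrow> herm_comb (\<lambda>x. g' x b)" by blast
  then show ?case
    by (intro exI[of _ "\<lambda>x h. f' x h + g' x h"]) (auto intro!: has_derivative_add herm_comb.add)
next
  case (scale f c)
  then obtain f' where "\<And>x. (f has_derivative f' x) (at x)" "\<And>b. b \<in> Basis \<Longrightarrow> herm_comb (\<lambda>x. f' x b)"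
    by blast
  then show ?case
    by (intro exI[of _ "\<lambda>x h. c * f' x h"]) (auto intro!: has_derivative_mult_right herm_comb.scale)
qed

lemma herm_comb_partials:
  assumes "herm_comb f" "bs \<in> lists Basis"
  shows "herm_comb (partials bs f)"
  using assms(2)
proof (induction bs)
  case (Cons b bs)
  then obtain f' where f': "\<And>x. (partials bs f has_derivative f' x) (at x)" "\<And>b. b \<in> Basis \<Longrightarrow> herm_comb (\<lambda>x. f' x b)"
    using herm_comb_derivative[of "partials bs f"] by blast
  then show ?case using Cons.hyps by (simp add: frechet_derivative_eqI[OF f'(1)])
qed (use assms in simp)

lemma herm_comb_bounded: "herm_comb f \<Longrightarrow> \<exists>C. \<forall>x. \<bar>f x\<bar> \<le> C"
proof (induction rule: herm_comb.induct)
  case (base \<alpha>)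
  show ?case by (rule herm_fun_bounded)
next
  case (add f g)
  then obtain C D where "\<And>x. \<bar>f x\<bar> \<le> C" "\<And>x. \<bar>g x\<bar> \<le> D" by blast
  then have "\<bar>f x + g x\<bar> \<le> C + D" for x
    by (meson abs_triangle_ineq add_mono order_trans)
  then show ?case by blast
next
  case (scale f c)
  then obtain C where "\<And>x. \<bar>f x\<bar> \<le> C" by blast
  then have "\<bar>c * f x\<bar> \<le> \<bar>c\<bar> * C" for x by (simp add: abs_mult mult_left_mono)
  then show ?case by blast
qed

text \<open>Both 1 and every coordinate are bounded by their maximum \<open>m\<close>, and the power
  of a maximum is bounded by the sum of the powers.\<close>

lemma one_plus_norm_power_le:
  fixes x :: "'a::euclidean_space"
  shows "(1 + norm x) ^ k \<le> real (1 + DIM('a)) ^ k * (1 + (\<Sum>b\<in>Basis. \<bar>x \<bullet> b\<bar> ^ k))"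
proof -
  define m where "m = Max (insert 1 ((\<lambda>b. \<bar>x \<bullet> b\<bar>) ` Basis))"
  have m: "1 \<le> m" "\<bar>x \<bullet> b\<bar> \<le> m" if "b \<in> Basis" for b
    unfolding m_def using that by (intro Max_ge; blast intro: finite_imageI finite_Basis)+
  have "norm x \<le> (\<Sum>b\<in>Basis. \<bar>x \<bullet> b\<bar>)" by (rule norm_le_l1)
  also have "\<dots> \<le> (\<Sum>b\<in>(Basis::'a set). m)" by (intro sum_mono m)
  finally have "1 + norm x \<le> (1 + DIM('a)) * m" using m(1)[OF SOME_Basis] by (simp add: distrib_right)
  then have "(1 + norm x) ^ k \<le> ((1 + DIM('a)) * m) ^ k" by (intro power_mono) auto
  also have "\<dots> = real (1 + DIM('a)) ^ k * m ^ k" by (rule power_mult_distrib)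
  also have "m ^ k \<le> 1 + (\<Sum>b\<in>Basis. \<bar>x \<bullet> b\<bar> ^ k)"
  proof -
    have "m \<in> insert 1 ((\<lambda>b. \<bar>x \<bullet> b\<bar>) ` Basis)" unfolding m_def by (intro Max_in) auto
    then consider "m = 1" | b where "b \<in> Basis" "m = \<bar>x \<bullet> b\<bar>" by auto
    then show ?thesis
    proof cases
      case 1
      then show ?thesis by (simp add: sum_nonneg)
    next
      case (2 b)
      have "\<bar>x \<bullet> b\<bar> ^ k \<le> (\<Sum>b\<in>Basis. \<bar>x \<bullet> b\<bar> ^ k)"
        using 2(1) by (intro member_le_sum) auto
      then show ?thesis using 2(2) by simp
    qed
  qed
  finally show ?thesis by (simp add: mult_left_mono)
qed

text \<open>Reduces a weighted bound to plain bounds on products with powers of single coordinates,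
  under which the Hermite span is stable.\<close>

lemma weighted_abs_le:
  fixes x :: "'a::euclidean_space"
  shows "(1 + norm x) ^ k * \<bar>g\<bar> \<le> real (1 + DIM('a)) ^ k * (\<bar>g\<bar> + (\<Sum>b\<in>Basis. \<bar>(x \<bullet> b) ^ k * g\<bar>))"
proof -
  have "(1 + norm x) ^ k * \<bar>g\<bar> \<le> real (1 + DIM('a)) ^ k * (1 + (\<Sum>b\<in>Basis. \<bar>x \<bullet> b\<bar> ^ k)) * \<bar>g\<bar>"
    by (intro mult_right_mono one_plus_norm_power_le) auto
  also have "\<dots> = real (1 + DIM('a)) ^ k * (\<bar>g\<bar> + (\<Sum>b\<in>Basis. \<bar>(x \<bullet> b) ^ k * g\<bar>))"
    by (simp add: distrib_right sum_distrib_right abs_mult power_abs mult.assoc)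
  finally show ?thesis .
qed

lemma herm_comb_mult_power: "herm_comb f \<Longrightarrow> b \<in> Basis \<Longrightarrow> herm_comb (\<lambda>x. (x \<bullet> b) ^ k * f x)"
proof (induction k)
  case (Suc k)
  from herm_comb_mult[OF Suc.IH[OF Suc.prems] Suc.prems(2)] show ?case by (simp add: mult.assoc)
qed simp

lemma herm_comb_schwartz:
  assumes "herm_comb f"
  shows "smooth f" "rapidly_decaying f"
proof -
  show "smooth f"
    unfolding smooth_def
  proof (intro ballI allI)
    fix bs :: "'a list" and x :: 'a
    assume "bs \<in> lists Basis"
    from herm_comb_derivative[OF herm_comb_partials[OF assms this]]
    show "partials bs f differentiable at x" by (auto intro: differentiableI)
  qed
  show "rapidly_decaying f"
    unfolding rapidly_decaying_def
  proof (intro ballI allI)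
    fix bs :: "'a list" and k assume bs: "bs \<in> lists Basis"
    let ?g = "partials bs f"
    have g: "herm_comb ?g" by (rule herm_comb_partials[OF assms bs])
    obtain C where C: "\<And>x. \<bar>?g x\<bar> \<le> C" using herm_comb_bounded[OF g] by blast
    have "\<forall>b\<in>Basis. \<exists>D. \<forall>x. \<bar>(x \<bullet> b) ^ k * ?g x\<bar> \<le> D"
      using herm_comb_bounded[OF herm_comb_mult_power[OF g]] by blast
    then obtain D where D: "\<And>b x. b \<in> Basis \<Longrightarrow> \<bar>(x \<bullet> b) ^ k * ?g x\<bar> \<le> D b" by metis
    have "(1 + norm x) ^ k * \<bar>?g x\<bar> \<le> real (1 + DIM('a)) ^ k * (C + (\<Sum>b\<in>Basis. D b))" for x
      by (rule order_trans[OF weighted_abs_le]) (intro mult_left_mono add_mono sum_mono C D, auto)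
    then show "bdd_above (range (\<lambda>x. (1 + norm x) ^ k * \<bar>?g x\<bar>))" by (intro bdd_aboveI2)
  qed
qed

lift_definition herm :: "('a::euclidean_space \<Rightarrow> nat) \<Rightarrow> 'a schwartz" is herm_fun
  by (intro conjI herm_comb_schwartz herm_comb.base)

lemma herm_cong: "(\<And>b. b \<in> Basis \<Longrightarrow> \<alpha> b = \<beta> b) \<Longrightarrow> herm \<alpha> = herm \<beta>"
  by (rule schwartz_eqI) (simp add: herm.rep_eq herm_fun_def)

lemma coord_mult_herm:
  "b \<in> Basis \<Longrightarrow> coord_mult b (herm \<alpha>) =
    (sqrt (2 * real (\<alpha> b)) / 2) *\<^sub>R herm (\<alpha>(b := \<alpha> b - 1)) +
    (sqrt (2 * real (Suc (\<alpha> b))) / 2) *\<^sub>R herm (\<alpha>(b := Suc (\<alpha> b)))"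
  by (rule schwartz_eqI)
    (simp add: coord_mult.rep_eq herm.rep_eq herm_fun_mult plus_schwartz.rep_eq scaleR_schwartz.rep_eq add_divide_distrib)

lemma partial_schwartz_herm:
  assumes b: "b \<in> Basis"
  shows "partial_schwartz b (herm \<alpha>) =
    (sqrt (2 * real (\<alpha> b)) / 2) *\<^sub>R herm (\<alpha>(b := \<alpha> b - 1)) -
    (sqrt (2 * real (Suc (\<alpha> b))) / 2) *\<^sub>R herm (\<alpha>(b := Suc (\<alpha> b)))"
proof (rule schwartz_eqI)
  fix x
  have "schwartz_fun (partial_schwartz b (herm \<alpha>)) x = frechet_derivative (herm_fun \<alpha>) (at x) b"
    using b by (simp add: schwartz_fun_partial_schwartz herm.rep_eq)
  also have "\<dots> = (sqrt (2 * real (\<alpha> b)) * herm_fun (\<alpha>(b := \<alpha> b - 1)) x -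
     sqrt (2 * real (Suc (\<alpha> b))) * herm_fun (\<alpha>(b := Suc (\<alpha> b))) x) / 2"
    unfolding frechet_derivative_eqI[OF herm_fun_has_derivative]
    using b by (simp only: sum_inner_Basis)
  finally show "schwartz_fun (partial_schwartz b (herm \<alpha>)) x = schwartz_fun
    ((sqrt (2 * real (\<alpha> b)) / 2) *\<^sub>R herm (\<alpha>(b := \<alpha> b - 1)) -
    (sqrt (2 * real (Suc (\<alpha> b))) / 2) *\<^sub>R herm (\<alpha>(b := Suc (\<alpha> b)))) x"
    by (simp add: minus_schwartz_fun scaleR_schwartz.rep_eq herm.rep_eq diff_divide_distrib)
qed

section \<open>Ladder operators and orthogonality\<close>

definition lowering :: "'a::euclidean_space \<Rightarrow> 'a schwartz \<Rightarrow> 'a schwartz" where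
  "lowering b \<phi> = coord_mult b \<phi> + partial_schwartz b \<phi>"

definition raising :: "'a::euclidean_space \<Rightarrow> 'a schwartz \<Rightarrow> 'a schwartz" where
  "raising b \<phi> = coord_mult b \<phi> - partial_schwartz b \<phi>"

text \<open>Multiplication by the squared coordinate minus the second derivative in direction
  \<open>b\<close>, that is, the harmonic oscillator. The factored form shows its symmetry and its
  eigenvalues \<open>2 * \<alpha> b + 1\<close>.\<close>

definition oscillator :: "'a::euclidean_space \<Rightarrow> 'a schwartz \<Rightarrow> 'a schwartz" where
  "oscillator b \<phi> = raising b (lowering b \<phi>) + \<phi>"

lemma lowering_herm:
  assumes "b \<in> Basis"
  shows "lowering b (herm \<alpha>) = sqrt (2 * real (\<alpha> b)) *\<^sub>R herm (\<alpha>(b := \<alpha> b - 1))"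
proof -
  have "(r / 2) *\<^sub>R \<phi> + (r / 2) *\<^sub>R \<phi> = r *\<^sub>R \<phi>" for r and \<phi> :: "'a schwartz"
    by (simp add: scaleR_add_left[symmetric])
  then show ?thesis
    unfolding lowering_def coord_mult_herm[OF assms] partial_schwartz_herm[OF assms]
    by (simp add: algebra_simps)
qed

lemma raising_herm:
  assumes "b \<in> Basis"
  shows "raising b (herm \<alpha>) = sqrt (2 * real (Suc (\<alpha> b))) *\<^sub>R herm (\<alpha>(b := Suc (\<alpha> b)))"
proof -
  have "(r / 2) *\<^sub>R \<phi> + (r / 2) *\<^sub>R \<phi> = r *\<^sub>R \<phi>" for r and \<phi> :: "'a schwartz"
    by (simp add: scaleR_add_left[symmetric])
  then show ?thesis
    unfolding raising_def coord_mult_herm[OF assms] partial_schwartz_herm[OF assms]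
    by (simp add: algebra_simps)
qed

lemma schwartz_inner_add_left: "schwartz_inner (\<phi> + \<psi>) \<theta> = schwartz_inner \<phi> \<theta> + schwartz_inner \<psi> \<theta>"
  and schwartz_inner_diff_left: "schwartz_inner (\<phi> - \<psi>) \<theta> = schwartz_inner \<phi> \<theta> - schwartz_inner \<psi> \<theta>"
  and schwartz_inner_scaleR_left: "schwartz_inner (c *\<^sub>R \<phi>) \<theta> = c * schwartz_inner \<phi> \<theta>"
  by (simp_all only: schwartz_inner_commute[of _ \<theta>] schwartz_inner_add schwartz_inner_diff schwartz_inner_scaleR)

lemma schwartz_inner_raising:
  "b \<in> Basis \<Longrightarrow> schwartz_inner (raising b \<phi>) \<psi> = schwartz_inner \<phi> (lowering b \<psi>)"
  by (simp add: raising_def lowering_def schwartz_inner_diff_left schwartz_inner_add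
    schwartz_inner_coord_mult schwartz_inner_partial)

lemma schwartz_inner_lowering:
  "b \<in> Basis \<Longrightarrow> schwartz_inner (lowering b \<phi>) \<psi> = schwartz_inner \<phi> (raising b \<psi>)"
  by (metis schwartz_inner_raising schwartz_inner_commute)

lemma schwartz_inner_oscillator:
  "b \<in> Basis \<Longrightarrow> schwartz_inner (oscillator b \<phi>) \<psi> = schwartz_inner \<phi> (oscillator b \<psi>)"
  by (simp add: oscillator_def schwartz_inner_add_left schwartz_inner_add
    schwartz_inner_raising schwartz_inner_lowering)

lemma coord_mult_linear: "coord_mult a (\<phi> + \<psi>) = coord_mult a \<phi> + coord_mult a \<psi>"
  "coord_mult a (c *\<^sub>R \<phi>) = c *\<^sub>R coord_mult a \<phi>"
  by (rule schwartz_eqI; simp add: coord_mult.rep_eq plus_schwartz.rep_eq scaleR_schwartz.rep_eq algebra_simps)+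

lemma partial_schwartz_linear:
  assumes b: "b \<in> Basis"
  shows "partial_schwartz b (\<phi> + \<psi>) = partial_schwartz b \<phi> + partial_schwartz b \<psi>"
    "partial_schwartz b (c *\<^sub>R \<phi>) = c *\<^sub>R partial_schwartz b \<phi>"
  using b partials_add[OF smooth_schwartz_fun smooth_schwartz_fun, of "[b]" \<phi> \<psi>]
    partials_scale[OF smooth_schwartz_fun, of "[b]" c \<phi>]
  by (auto intro!: schwartz_eqI simp: schwartz_fun_partial_schwartz plus_schwartz.rep_eq scaleR_schwartz.rep_eq
    simp del: partials.simps)

lemma oscillator_herm:
  assumes "b \<in> Basis"
  shows "oscillator b (herm \<alpha>) = (2 * real (\<alpha> b) + 1) *\<^sub>R herm \<alpha>"
proof -
  have "raising b (c *\<^sub>R \<phi>) = c *\<^sub>R raising b \<phi>" for c \<phi>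
    by (simp add: raising_def coord_mult_linear partial_schwartz_linear[OF assms] scaleR_diff_right)
  note scale = this
  have "raising b (lowering b (herm \<alpha>)) = (2 * real (\<alpha> b)) *\<^sub>R herm \<alpha>"
  proof (cases "\<alpha> b")
    case 0
    then show ?thesis using scale[of 0 0] by (simp add: lowering_herm[OF assms])
  next
    case (Suc n)
    then have "\<alpha>(b := Suc n) = \<alpha>" by (simp add: fun_upd_idem)
    with Suc show ?thesis
      by (simp add: lowering_herm[OF assms] raising_herm[OF assms] scale del: of_nat_Suc)
  qed
  then show ?thesis by (simp add: oscillator_def scaleR_add_left)
qed

text \<open>Eigenvectors of the symmetric operator \<open>oscillator b\<close> with distinct
  eigenvalues.\<close>

lemma schwartz_inner_herm_neq:
  assumes "b \<in> Basis" "\<alpha> b \<noteq> \<beta> b"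
  shows "schwartz_inner (herm \<alpha>) (herm \<beta>) = 0"
  using schwartz_inner_oscillator[OF assms(1), of "herm \<alpha>" "herm \<beta>"] assms
  by (simp add: oscillator_herm schwartz_inner_scaleR schwartz_inner_scaleR_left)

text \<open>Raising the lower function and lowering the upper one produce the same factor, and the
  two operators are adjoint; so the norm is unchanged when one index decreases by 1.\<close>

lemma schwartz_inner_herm_same:
  fixes \<alpha> :: "'a::euclidean_space \<Rightarrow> nat"
  shows "schwartz_inner (herm \<alpha>) (herm \<alpha>) = schwartz_inner (herm (\<lambda>_. 0) :: 'a schwartz) (herm (\<lambda>_. 0))"
proof (induction "\<Sum>b\<in>Basis. \<alpha> b" arbitrary: \<alpha>)
  case 0
  then have "herm \<alpha> = herm (\<lambda>_. 0)" by (intro herm_cong) auto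
  then show ?case by (simp only:)
next
  case (Suc n)
  then obtain b where b: "b \<in> Basis" "\<alpha> b \<noteq> 0" by (metis sum.neutral nat.distinct(1))
  then obtain m where m: "\<alpha> b = Suc m" by (cases "\<alpha> b") auto
  let ?\<beta> = "\<alpha>(b := m)"
  have "(\<Sum>c\<in>Basis. \<alpha> c) = \<alpha> b + (\<Sum>c\<in>Basis - {b}. \<alpha> c)"
    "(\<Sum>c\<in>Basis. ?\<beta> c) = m + (\<Sum>c\<in>Basis - {b}. \<alpha> c)"
    using b(1) by (simp_all add: sum.remove[OF finite_Basis b(1)])
  then have IH: "schwartz_inner (herm ?\<beta>) (herm ?\<beta>) = schwartz_inner (herm (\<lambda>_. 0) :: 'a schwartz) (herm (\<lambda>_. 0))"
    using Suc(2) m by (intro Suc(1)) simp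
  have \<alpha>: "?\<beta>(b := Suc m) = \<alpha>" using m by auto
  have "sqrt (2 * real (Suc m)) * schwartz_inner (herm \<alpha>) (herm \<alpha>) = schwartz_inner (raising b (herm ?\<beta>)) (herm \<alpha>)"
    using raising_herm[OF b(1), of ?\<beta>] m by (simp add: schwartz_inner_scaleR_left fun_upd_idem del: of_nat_Suc)
  also have "\<dots> = sqrt (2 * real (Suc m)) * schwartz_inner (herm ?\<beta>) (herm ?\<beta>)"
    unfolding schwartz_inner_raising[OF b(1)] lowering_herm[OF b(1)]
    using m by (simp add: schwartz_inner_scaleR del: of_nat_Suc)
  finally show ?case using IH by simp
qed

text \<open>The common squared norm of all Hermite functions, kept as a symbol. It depends on the
  space alone, so its argument is a type.\<close>

definition herm_norm :: "'a::euclidean_space itself \<Rightarrow> real" where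
  "herm_norm _ = schwartz_inner (herm (\<lambda>_. 0) :: 'a schwartz) (herm (\<lambda>_. 0))"

lemma power2_norm_eq_sum: "(norm x)\<^sup>2 = (\<Sum>b\<in>Basis. (x \<bullet> b)\<^sup>2)" for x :: "'a::euclidean_space"
  unfolding power2_norm_eq_inner by (subst euclidean_inner) (simp add: power2_eq_square)

lemma schwartz_fun_herm_0: "schwartz_fun (herm (\<lambda>_. 0)) x = exp (- ((norm x)\<^sup>2 / 2))"
  by (simp add: herm.rep_eq herm_fun_def exp_sum[symmetric] sum_negf sum_divide_distrib[symmetric]
    power2_norm_eq_sum)

lemma herm_norm_pos: "0 < herm_norm TYPE('a::euclidean_space)"
proof -
  let ?h = "\<lambda>x. schwartz_fun (herm (\<lambda>_. 0) :: 'a schwartz) x * schwartz_fun (herm (\<lambda>_. 0)) x"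
  have pos: "0 < ?h x" for x by (simp add: schwartz_fun_herm_0)
  have "(\<integral>x. ?h x \<partial>lborel) \<noteq> 0"
  proof
    assume "(\<integral>x. ?h x \<partial>lborel) = 0"
    then have "AE x in lborel. ?h x = 0"
      using pos by (subst (asm) integral_nonneg_eq_0_iff_AE)
        (auto intro: integrable_schwartz_fun_mult less_imp_le)
    then have "AE x::'a in lborel. False" using pos by (auto simp: less_le elim: eventually_mono)
    then have "emeasure lborel (UNIV :: 'a set) = 0"
      using emeasure_eq_0_AE[of "\<lambda>_. True" "lborel :: 'a measure"] by simp
    then show False by simp
  qed
  moreover have "0 \<le> (\<integral>x. ?h x \<partial>lborel)" by (intro integral_nonneg_AE AE_I2 less_imp_le pos)
  ultimately show ?thesis unfolding herm_norm_def schwartz_inner_def by linarith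
qed

subsection \<open>Completeness of the Hermite functions\<close>

definition herm_orthogonal :: "'a::euclidean_space schwartz \<Rightarrow> bool" where
  "herm_orthogonal g \<longleftrightarrow> (\<forall>\<alpha>. schwartz_inner (herm \<alpha>) g = 0)"

lemma herm_orthogonal_add: "herm_orthogonal g \<Longrightarrow> herm_orthogonal h \<Longrightarrow> herm_orthogonal (g + h)"
  and herm_orthogonal_scaleR: "herm_orthogonal g \<Longrightarrow> herm_orthogonal (c *\<^sub>R g)"
  by (simp_all add: herm_orthogonal_def schwartz_inner_add schwartz_inner_scaleR)

lemma herm_orthogonal_sum: "(\<And>i. i \<in> A \<Longrightarrow> herm_orthogonal (f i)) \<Longrightarrow> herm_orthogonal (\<Sum>i\<in>A. f i)"
proof (induction A rule: infinite_finite_induct)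
  case (insert x F)
  then show ?case by (simp add: herm_orthogonal_add)
qed (use herm_orthogonal_scaleR[of _ 0] in \<open>auto simp: herm_orthogonal_def schwartz_inner_def zero_schwartz.rep_eq\<close>)

text \<open>Multiplication by a coordinate is symmetric and maps Hermite functions to combinations
  of their neighbours.\<close>

lemma herm_orthogonal_coord_mult:
  fixes a :: "'a::euclidean_space"
  assumes "herm_orthogonal g"
  shows "herm_orthogonal (coord_mult a g)"
proof -
  have "herm_orthogonal (coord_mult b g)" if "b \<in> Basis" for b
    using assms unfolding herm_orthogonal_def
    by (simp add: schwartz_inner_coord_mult[symmetric] coord_mult_herm[OF that]
      schwartz_inner_add_left schwartz_inner_scaleR_left)
  then have "herm_orthogonal (\<Sum>b\<in>Basis. (a \<bullet> b) *\<^sub>R coord_mult b g)"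
    by (intro herm_orthogonal_sum herm_orthogonal_scaleR)
  moreover have "coord_mult a g = (\<Sum>b\<in>Basis. (a \<bullet> b) *\<^sub>R coord_mult b g)"
  proof (rule schwartz_eqI)
    fix x
    show "schwartz_fun (coord_mult a g) x = schwartz_fun (\<Sum>b\<in>Basis. (a \<bullet> b) *\<^sub>R coord_mult b g) x"
      by (simp add: coord_mult.rep_eq sum_schwartz_fun scaleR_schwartz.rep_eq euclidean_inner[of x a]
        sum_distrib_left mult_ac)
  qed
  ultimately show ?thesis by simp
qed

text \<open>
  Expanding \<open>exp q\<close> in a series replaces the weight \<open>K\<close> by \<open>K exp q\<close>. From the Gaussian \<open>herm (\<lambda>_. 0)\<close> one thus reaches
  arbitrarily narrow Gaussians around any point, without Fourier inversion in several variables.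
\<close>

lemma herm_orthogonal_exp_step:
  fixes Q :: "'a::euclidean_space schwartz \<Rightarrow> 'a schwartz"
  assumes Q: "\<And>g x. schwartz_fun (Q g) x = q x * schwartz_fun g x"
    and Q_orth: "\<And>g. herm_orthogonal g \<Longrightarrow> herm_orthogonal (Q g)"
    and K: "\<And>g. herm_orthogonal g \<Longrightarrow> (\<integral>x. schwartz_fun g x * K x \<partial>lborel) = 0"
    and meas: "K \<in> borel_measurable borel" "q \<in> borel_measurable borel"
    and bound: "\<And>x. \<bar>K x\<bar> * exp \<bar>q x\<bar> \<le> C" and g: "herm_orthogonal g"
  shows "(\<integral>x. schwartz_fun g x * (K x * exp (q x)) \<partial>lborel) = 0"
proof -
  note meas[measurable]
  \<comment> \<open>\<open>Q\<close> realises multiplication by \<open>q\<close> inside the Schwartz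
    space, so each term of the exponential series is covered by the hypothesis on
    \<open>K\<close>.\<close>
  have Qn: "herm_orthogonal ((Q ^^ n) g)" "schwartz_fun ((Q ^^ n) g) x = q x ^ n * schwartz_fun g x" for n x
    by (induction n) (auto simp: g Q_orth Q)
  have K_le: "\<bar>K x\<bar> \<le> C" for x
  proof -
    have "\<bar>K x\<bar> * 1 \<le> \<bar>K x\<bar> * exp \<bar>q x\<bar>" by (intro mult_left_mono) auto
    with bound[of x] show ?thesis by simp
  qed
  have C: "0 \<le> C" using K_le[of 0] by linarith
  have int: "integrable lborel (\<lambda>x. schwartz_fun h x * K x)" for h
  proof (rule Bochner_Integration.integrable_bound)
    show "integrable lborel (\<lambda>x. C * schwartz_fun h x)"
      by (intro integrable_mult_right impI integrable_schwartz_fun)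
    show "AE x in lborel. norm (schwartz_fun h x * K x) \<le> norm (C * schwartz_fun h x)"
      using K_le C by (intro AE_I2) (simp add: abs_mult mult.commute mult_right_mono)
  qed simp
  define s where "s n x = (\<Sum>i<n. q x ^ i / fact i) * (schwartz_fun g x * K x)" for n x
  have "(\<integral>x. s n x \<partial>lborel) = 0" for n
  proof -
    have "(\<integral>x. s n x \<partial>lborel) = (\<integral>x. (\<Sum>i<n. (1 / fact i) * (schwartz_fun ((Q ^^ i) g) x * K x)) \<partial>lborel)"
      by (intro Bochner_Integration.integral_cong refl) (simp add: s_def Qn sum_distrib_left mult_ac)
    also have "\<dots> = (\<Sum>i<n. (1 / fact i) * (\<integral>x. schwartz_fun ((Q ^^ i) g) x * K x \<partial>lborel))"
      by (subst Bochner_Integration.integral_sum) (auto intro!: integrable_mult_right int)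
    finally show ?thesis using K[OF Qn(1)] by simp
  qed
  moreover have "(\<lambda>n. \<integral>x. s n x \<partial>lborel) \<longlonglongrightarrow> (\<integral>x. exp (q x) * (schwartz_fun g x * K x) \<partial>lborel)"
  proof (rule integral_dominated_convergence)
    show "integrable lborel (\<lambda>x. C * \<bar>schwartz_fun g x\<bar>)"
      by (intro integrable_mult_right impI integrable_abs integrable_schwartz_fun)
    show "AE x in lborel. (\<lambda>n. s n x) \<longlonglongrightarrow> exp (q x) * (schwartz_fun g x * K x)"
      unfolding s_def
    proof (intro AE_I2 tendsto_mult_right)
      fix x
      show "(\<lambda>n. \<Sum>i<n. q x ^ i / fact i) \<longlonglongrightarrow> exp (q x)"
        using exp_converges[of "q x"] by (simp add: sums_def divide_inverse mult.commute)
    qed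
    \<comment> \<open>The partial sums are dominated by \<open>exp \<bar>q x\<bar>\<close>, which is
      why the hypothesis bounds \<open>\<bar>K x\<bar> * exp \<bar>q x\<bar>\<close> and not the
      limit weight.\<close>
    show "AE x in lborel. norm (s n x) \<le> C * \<bar>schwartz_fun g x\<bar>" for n
    proof (intro AE_I2)
      fix x
      have "\<bar>\<Sum>i<n. q x ^ i / fact i\<bar> \<le> (\<Sum>i<n. \<bar>q x\<bar> ^ i / fact i)"
        by (rule order_trans[OF sum_abs]) (simp add: power_abs)
      also have "\<dots> \<le> (\<Sum>i. \<bar>q x\<bar> ^ i / fact i)"
        using summable_exp[of "\<bar>q x\<bar>"] by (intro sum_le_suminf) (auto simp: divide_inverse mult.commute)
      also have "\<dots> = exp \<bar>q x\<bar>"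
        using exp_converges[of "\<bar>q x\<bar>"] by (simp add: sums_iff divide_inverse mult.commute)
      finally have "\<bar>\<Sum>i<n. q x ^ i / fact i\<bar> * \<bar>K x\<bar> \<le> exp \<bar>q x\<bar> * \<bar>K x\<bar>"
        by (intro mult_right_mono) auto
      also have "\<dots> \<le> C" using bound[of x] by (simp add: mult.commute)
      finally have "(\<bar>\<Sum>i<n. q x ^ i / fact i\<bar> * \<bar>K x\<bar>) * \<bar>schwartz_fun g x\<bar> \<le> C * \<bar>schwartz_fun g x\<bar>"
        by (intro mult_right_mono) auto
      then show "norm (s n x) \<le> C * \<bar>schwartz_fun g x\<bar>" by (simp add: s_def abs_mult mult_ac)
    qed
  qed (simp_all add: s_def)
  ultimately have "(\<integral>x. exp (q x) * (schwartz_fun g x * K x) \<partial>lborel) = 0"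
    by (simp add: LIMSEQ_const_iff)
  then show ?thesis by (simp add: mult_ac)
qed

text \<open>The exponent \<open>x \<bullet> a\<close> moves the centre of the Gaussian to
  \<open>a\<close>, up to a constant factor; after that, \<open>- (norm (x - a))\<^sup>2 / 2\<close>
  narrows it by one unit at a time. An increment larger than the exponent already reached would
  violate the bound required by \<open>herm_orthogonal_exp_step\<close>, hence the
  induction.\<close>

lemma herm_orthogonal_gaussian:
  fixes a :: "'a::euclidean_space"
  assumes "herm_orthogonal g"
  shows "(\<integral>x. schwartz_fun g x * exp (- (real (Suc k) * (norm (x - a))\<^sup>2 / 2)) \<partial>lborel) = 0"
  using assms
proof (induction k arbitrary: g)
  case 0
  note g = this
  have Z: "(\<integral>x. schwartz_fun g x * exp (- ((norm x)\<^sup>2 / 2)) \<partial>lborel) = 0" if "herm_orthogonal g" for g :: "'a schwartz"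
  proof -
    have "schwartz_inner (herm (\<lambda>_. 0)) g = 0" using that unfolding herm_orthogonal_def by blast
    then show ?thesis by (simp add: schwartz_inner_def schwartz_fun_herm_0 mult.commute)
  qed
  have "(\<integral>x. schwartz_fun g x * (exp (- ((norm x)\<^sup>2 / 2)) * exp (x \<bullet> a)) \<partial>lborel) = 0"
  proof (rule herm_orthogonal_exp_step[where Q = "coord_mult a"])
    show "\<bar>exp (- ((norm x)\<^sup>2 / 2))\<bar> * exp \<bar>x \<bullet> a\<bar> \<le> exp ((norm a)\<^sup>2 / 2)" for x :: 'a
    proof -
      have "\<bar>x \<bullet> a\<bar> \<le> norm x * norm a" by (rule Cauchy_Schwarz_ineq2)
      also have "\<dots> \<le> ((norm x)\<^sup>2 + (norm a)\<^sup>2) / 2"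
        using sum_squares_bound[of "norm x" "norm a"] by simp
      finally show ?thesis by (simp add: exp_add[symmetric] field_simps)
    qed
  qed (auto simp: coord_mult.rep_eq herm_orthogonal_coord_mult Z g
      intro!: borel_measurable_inner borel_measurable_exp)
  moreover have "exp (- ((norm x)\<^sup>2 / 2)) * exp (x \<bullet> a) = exp ((norm a)\<^sup>2 / 2) * exp (- ((norm (x - a))\<^sup>2 / 2))" for x
    by (simp add: exp_add[symmetric] power2_norm_eq_inner inner_diff_left inner_diff_right inner_commute field_simps)
  ultimately have "(\<integral>x. exp ((norm a)\<^sup>2 / 2) * (schwartz_fun g x * exp (- ((norm (x - a))\<^sup>2 / 2))) \<partial>lborel) = 0"
    by (simp add: mult_ac)
  then show ?case by simp
next
  case (Suc k)
  let ?L = "\<lambda>b g. coord_mult b g - (a \<bullet> b) *\<^sub>R g"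
  \<comment> \<open>The squared distance to \<open>a\<close> is a sum of squares of shifted
    coordinates, so multiplication by it is built from operators that preserve
    orthogonality.\<close>
  let ?Q = "\<lambda>g. (- (1 / 2)) *\<^sub>R (\<Sum>b\<in>Basis. ?L b (?L b g))"
  have L: "herm_orthogonal (?L b g)" if "herm_orthogonal g" for b and g :: "'a schwartz"
    using herm_orthogonal_add[OF herm_orthogonal_coord_mult[OF that] herm_orthogonal_scaleR[OF that, of "- (a \<bullet> b)"]]
    by simp
  have "(\<integral>x. schwartz_fun g x * (exp (- (real (Suc k) * (norm (x - a))\<^sup>2 / 2)) * exp (- ((norm (x - a))\<^sup>2 / 2))) \<partial>lborel) = 0"
  proof (rule herm_orthogonal_exp_step[where Q = ?Q])
    show "schwartz_fun (?Q g) x = - ((norm (x - a))\<^sup>2 / 2) * schwartz_fun g x" for g x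
    proof -
      have "schwartz_fun (?L b g) x = ((x - a) \<bullet> b) * schwartz_fun g x" for b and g :: "'a schwartz"
        by (simp add: minus_schwartz_fun coord_mult.rep_eq scaleR_schwartz.rep_eq inner_diff_left left_diff_distrib)
      then have "schwartz_fun (\<Sum>b\<in>Basis. ?L b (?L b g)) x = (norm (x - a))\<^sup>2 * schwartz_fun g x"
        unfolding power2_norm_eq_sum by (simp add: sum_schwartz_fun power2_eq_square sum_distrib_right mult.assoc)
      then show ?thesis
        by (simp only: scaleR_schwartz.rep_eq)
    qed
    show "herm_orthogonal (?Q g)" if "herm_orthogonal g" for g
      by (intro herm_orthogonal_scaleR herm_orthogonal_sum L that)
    show "\<bar>exp (- (real (Suc k) * (norm (x - a))\<^sup>2 / 2))\<bar> * exp \<bar>- ((norm (x - a))\<^sup>2 / 2)\<bar> \<le> 1" for x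
      by (simp add: exp_add[symmetric] field_simps)
  qed (use Suc in auto)
  moreover have "exp (- (real (Suc k) * r / 2)) * exp (- (r / 2)) = exp (- (real (Suc (Suc k)) * r / 2))" for r :: real
    by (simp add: exp_add[symmetric] algebra_simps add_divide_distrib)
  ultimately show ?case by (simp only:)
qed

text \<open>At a point where \<open>g\<close> is nonzero, narrow Gaussians, scaled up, would give an
  integral against \<open>g\<close> that grows with \<open>k\<close>, whereas all these integrals
  vanish.\<close>

lemma herm_orthogonal_eq_0:
  fixes g :: "'a::euclidean_space schwartz"
  assumes g: "herm_orthogonal g"
  shows "g = 0"
proof (rule schwartz_eqI, rule ccontr)
  fix a :: 'a
  assume ne: "schwartz_fun g a \<noteq> schwartz_fun 0 a"
  \<comment> \<open>The sign makes the value at \<open>a\<close> positive. Half that value is then a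
    lower bound \<open>e\<close> on a whole ball.\<close>
  define h where "h = sgn (schwartz_fun g a) *\<^sub>R g"
  have h: "herm_orthogonal h" unfolding h_def by (rule herm_orthogonal_scaleR[OF g])
  define e where "e = schwartz_fun h a / 2"
  have e: "e > 0" using ne by (simp add: e_def h_def scaleR_schwartz.rep_eq zero_schwartz.rep_eq sgn_real_def)
  have "schwartz_fun h differentiable at a"
    using smoothD[OF smooth_schwartz_fun, of "[]"] by simp
  then have "isCont (schwartz_fun h) a" by (rule differentiable_imp_continuous_within)
  then obtain d where d: "d > 0" "\<And>x. dist x a < d \<Longrightarrow> \<bar>schwartz_fun h x - schwartz_fun h a\<bar> < e"
    using e unfolding continuous_at_eps_delta dist_real_def by blast
  have pos: "schwartz_fun h x > e" if "dist x a < d" for x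
    using d(2)[OF that] unfolding e_def abs_diff_less_iff by linarith
  let ?B = "ball a (d / 2)"
  let ?m = "measure lborel ?B"
  have B: "emeasure lborel ?B < \<infinity>" by (rule emeasure_bounded_finite) simp
  have le: "real k * (e * (3 * d\<^sup>2 / 8) * ?m) \<le> (\<integral>x. \<bar>schwartz_fun h x\<bar> \<partial>lborel)" if k: "k \<noteq> 0" for k
  proof -
    \<comment> \<open>Scaled to equal 1 on the sphere of radius \<open>d\<close>: at most 1 outside
      it, and at least linear in \<open>k\<close> on the ball of half the radius. In the shell
      between, \<open>h\<close> is positive and only helps.\<close>
    let ?E = "\<lambda>x. exp (- (real k * ((norm (x - a))\<^sup>2 - d\<^sup>2) / 2))"
    have E: "?E x = exp (real k * d\<^sup>2 / 2) * exp (- (real k * (norm (x - a))\<^sup>2 / 2))" for x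
      by (simp add: exp_add[symmetric] field_simps)
    have lower: "e * (real k * (3 * d\<^sup>2 / 8)) * indicator ?B x - \<bar>schwartz_fun h x\<bar> \<le> schwartz_fun h x * ?E x" for x
    proof -
      consider "dist x a < d / 2" | "d / 2 \<le> dist x a" "dist x a < d" | "d \<le> dist x a" by linarith
      then show ?thesis
      proof cases
        case 1
        then have "(norm (x - a))\<^sup>2 \<le> (d / 2)\<^sup>2" by (intro power_mono) (auto simp: dist_norm)
        then have "real k * (3 * d\<^sup>2 / 4) \<le> real k * (d\<^sup>2 - (norm (x - a))\<^sup>2)"
          by (intro mult_left_mono) (auto simp: power_divide)
        then have "real k * (3 * d\<^sup>2 / 8) \<le> - (real k * ((norm (x - a))\<^sup>2 - d\<^sup>2) / 2)"
        proof -
          assume *: "real k * (3 * d\<^sup>2 / 4) \<le> real k * (d\<^sup>2 - (norm (x - a))\<^sup>2)"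
          have "real k * (3 * d\<^sup>2 / 8) = (real k * (3 * d\<^sup>2 / 4)) / 2" by simp
          also have "\<dots> \<le> real k * (d\<^sup>2 - (norm (x - a))\<^sup>2) / 2"
            using * by (rule divide_right_mono) simp
          also have "\<dots> = - (real k * ((norm (x - a))\<^sup>2 - d\<^sup>2) / 2)"
            by (simp add: right_diff_distrib diff_divide_distrib)
          finally show ?thesis .
        qed
        \<comment> \<open>The constant \<open>3 * d\<^sup>2 / 8\<close> is half of
          \<open>d\<^sup>2 - (d / 2)\<^sup>2\<close>; the inequality
          \<open>1 + y \<le> exp y\<close> turns it into linear growth in \<open>k\<close>.\<close>
        also have "\<dots> \<le> ?E x" using exp_ge_add_one_self[of "- (real k * ((norm (x - a))\<^sup>2 - d\<^sup>2) / 2)"] by linarith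
        finally have "e * (real k * (3 * d\<^sup>2 / 8)) \<le> schwartz_fun h x * ?E x"
          using pos[of x] e 1 d(1) by (intro mult_mono) auto
        moreover have "x \<in> ?B" using 1 by (simp add: dist_commute)
        ultimately show ?thesis by simp
      next
        case 2
        then have "x \<notin> ?B" by (simp add: dist_commute)
        moreover have "0 \<le> schwartz_fun h x * ?E x" using pos[of x] e 2 by simp
        ultimately show ?thesis by simp
      next
        case 3
        then have "x \<notin> ?B" using d(1) by (simp add: dist_commute)
        have "d\<^sup>2 \<le> (norm (x - a))\<^sup>2" using 3 d(1) by (intro power_mono) (auto simp: dist_norm)
        then have "?E x \<le> 1" by simp
        then have "\<bar>schwartz_fun h x\<bar> * ?E x \<le> \<bar>schwartz_fun h x\<bar>" by (simp add: mult_left_le)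
        moreover have "- (\<bar>schwartz_fun h x\<bar> * ?E x) \<le> schwartz_fun h x * ?E x"
          using mult_right_mono[of "- \<bar>schwartz_fun h x\<bar>" "schwartz_fun h x" "?E x"] by simp
        ultimately show ?thesis using \<open>x \<notin> ?B\<close> by simp
      qed
    qed
    obtain j where j: "k = Suc j" using k by (cases k) auto
    have "(\<integral>x. schwartz_fun h x * ?E x \<partial>lborel) =
        exp (real k * d\<^sup>2 / 2) * (\<integral>x. schwartz_fun h x * exp (- (real k * (norm (x - a))\<^sup>2 / 2)) \<partial>lborel)"
      unfolding E by (simp only: mult.left_commute[of "schwartz_fun h _" "exp (real k * d\<^sup>2 / 2)"] Bochner_Integration.integral_mult_right_zero)
    then have zero: "(\<integral>x. schwartz_fun h x * ?E x \<partial>lborel) = 0"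
      using herm_orthogonal_gaussian[OF h, of j a] j by simp
    have int_ind: "integrable lborel (\<lambda>x. e * (real k * (3 * d\<^sup>2 / 8)) * indicator ?B x)"
      using B by (intro integrable_mult_right impI) simp
    have int_abs: "integrable lborel (\<lambda>x. \<bar>schwartz_fun h x\<bar>)"
      by (intro integrable_abs integrable_schwartz_fun)
    have int_E: "integrable lborel (\<lambda>x. schwartz_fun h x * ?E x)"
    proof (rule Bochner_Integration.integrable_bound)
      show "integrable lborel (\<lambda>x. exp (real k * d\<^sup>2 / 2) * schwartz_fun h x)"
        by (intro integrable_mult_right impI integrable_schwartz_fun)
      have "?E x \<le> exp (real k * d\<^sup>2 / 2)" for x unfolding E by (simp add: mult_left_le)
      then have "\<bar>schwartz_fun h x\<bar> * ?E x \<le> \<bar>schwartz_fun h x\<bar> * exp (real k * d\<^sup>2 / 2)" for x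
        by (rule mult_left_mono) simp
      then show "AE x in lborel. norm (schwartz_fun h x * ?E x) \<le> norm (exp (real k * d\<^sup>2 / 2) * schwartz_fun h x)"
        by (intro AE_I2) (simp only: real_norm_def abs_mult abs_exp_cancel mult.commute)
    qed simp
    have "(\<integral>x. e * (real k * (3 * d\<^sup>2 / 8)) * indicator ?B x - \<bar>schwartz_fun h x\<bar> \<partial>lborel) \<le> (\<integral>x. schwartz_fun h x * ?E x \<partial>lborel)"
      by (intro integral_mono Bochner_Integration.integrable_diff int_ind int_abs int_E lower)
    then have "e * (real k * (3 * d\<^sup>2 / 8)) * ?m \<le> (\<integral>x. \<bar>schwartz_fun h x\<bar> \<partial>lborel)"
      unfolding zero using int_ind int_abs by (simp add: Bochner_Integration.integral_diff)
    then show ?thesis by (simp add: mult_ac)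
  qed
  have m: "0 < ?m" using content_ball_pos[of "d / 2" a] d(1) by (simp add: measure_completion)
  then have "0 < e * (3 * d\<^sup>2 / 8) * ?m" using e d(1) by simp
  from ex_less_of_nat_mult[OF this, of "\<integral>x. \<bar>schwartz_fun h x\<bar> \<partial>lborel"]
  obtain k where k: "(\<integral>x. \<bar>schwartz_fun h x\<bar> \<partial>lborel) < real k * (e * (3 * d\<^sup>2 / 8) * ?m)" by blast
  moreover have "0 \<le> (\<integral>x. \<bar>schwartz_fun h x\<bar> \<partial>lborel)" by (intro integral_nonneg_AE AE_I2) simp
  ultimately have "k \<noteq> 0" by (intro notI) simp
  from le[OF this] k show False by simp
qed

subsection \<open>Expansion in Hermite functions\<close>

text \<open>Sobolev inequality: the increment of the squared function is the integral of
  \<open>2 * f * f'\<close>, at most that of \<open>f * f + f' * f'\<close>; then the left end point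
  is sent to minus infinity.\<close>

lemma schwartz_sup_bound_1d:
  fixes \<phi> :: "real schwartz"
  shows "(schwartz_fun \<phi> t)\<^sup>2 \<le> schwartz_inner \<phi> \<phi> + schwartz_inner (partial_schwartz 1 \<phi>) (partial_schwartz 1 \<phi>)"
proof -
  let ?f = "schwartz_fun \<phi>" and ?f' = "schwartz_fun (partial_schwartz 1 \<phi>)"
  let ?I = "schwartz_inner \<phi> \<phi> + schwartz_inner (partial_schwartz 1 \<phi>) (partial_schwartz 1 \<phi>)"
  have deriv: "(?f has_real_derivative ?f' x) (at x)" for x
    using smooth_has_derivative[OF smooth_schwartz_fun, of "[]" \<phi> x]
    by (simp add: has_field_derivative_def schwartz_fun_partial_schwartz mult.commute[of _ "frechet_derivative _ _ _"] del: frechet_derivative_works)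
  have cont: "isCont (schwartz_fun \<psi>) x" for \<psi> :: "real schwartz" and x
    using smoothD[OF smooth_schwartz_fun, of "[]" \<psi> x] differentiable_imp_continuous_within by auto
  have step: "(?f t)\<^sup>2 \<le> (?f s)\<^sup>2 + ?I" if "s \<le> t" for s
  proof -
    have FTC: "has_bochner_integral lborel (\<lambda>x. 2 * ?f x * ?f' x * indicator {s..t} x) ((?f t)\<^sup>2 - (?f s)\<^sup>2)"
    proof (rule has_bochner_integral_FTC_Icc_real[OF that])
      show "DERIV (\<lambda>x. (?f x)\<^sup>2) x :> 2 * ?f x * ?f' x" for x
        by (auto intro!: derivative_eq_intros deriv)
      show "isCont (\<lambda>x. 2 * ?f x * ?f' x) x" for x by (intro continuous_intros cont)
    qed
    have "(?f t)\<^sup>2 - (?f s)\<^sup>2 = (\<integral>x. 2 * ?f x * ?f' x * indicator {s..t} x \<partial>lborel)"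
      using has_bochner_integral_integral_eq[OF FTC] by simp
    also have "\<dots> \<le> (\<integral>x. ?f x * ?f x + ?f' x * ?f' x \<partial>lborel)"
    proof (rule integral_mono)
      show "integrable lborel (\<lambda>x. 2 * ?f x * ?f' x * indicator {s..t} x)" using FTC by (rule integrable.intros)
      show "integrable lborel (\<lambda>x. ?f x * ?f x + ?f' x * ?f' x)"
        by (intro Bochner_Integration.integrable_add integrable_schwartz_fun_mult)
      show "2 * ?f x * ?f' x * indicator {s..t} x \<le> ?f x * ?f x + ?f' x * ?f' x" for x
        using sum_squares_bound[of "?f x" "?f' x"] by (auto simp: indicator_def power2_eq_square)
    qed
    also have "\<dots> = ?I" by (simp add: schwartz_inner_def integrable_schwartz_fun_mult)
    finally show ?thesis by simp
  qed
  have decay: "\<bar>?f (- real n)\<bar> \<le> schwartz_norm 1 \<phi> * inverse (real (Suc n))" for n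
    using schwartz_norm_upper[of 1 1 "[]" "- real n" \<phi>] by (simp add: field_simps)
  have "(\<lambda>n. schwartz_norm 1 \<phi> * inverse (real (Suc n))) \<longlonglongrightarrow> 0"
    by (rule tendsto_mult_right_zero[OF LIMSEQ_inverse_real_of_nat])
  then have "(\<lambda>n. ?f (- real n)) \<longlonglongrightarrow> 0" by (rule Lim_null_comparison[rotated], intro always_eventually allI) (simp only: real_norm_def decay)
  then have "(\<lambda>n. (?f (- real n))\<^sup>2 + ?I) \<longlonglongrightarrow> 0\<^sup>2 + ?I" by (intro tendsto_intros)
  then have "(\<lambda>n. (?f (- real n))\<^sup>2 + ?I) \<longlonglongrightarrow> ?I" by simp
  then show ?thesis
  proof (rule LIMSEQ_le_const)
    obtain N where N: "- t \<le> real N" using real_arch_simple by blast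
    have "(?f t)\<^sup>2 \<le> (?f (- real n))\<^sup>2 + ?I" if "N \<le> n" for n
      using N that by (intro step) (meson minus_le_iff of_nat_le_iff order_trans)
    then show "\<exists>N. \<forall>n\<ge>N. (?f t)\<^sup>2 \<le> (?f (- real n))\<^sup>2 + ?I" by blast
  qed
qed

text \<open>The ladder form of the derivative and orthogonality give it the squared norm
  \<open>(n + 1 / 2) * ?Z\<close>, to which the Sobolev inequality applies. The cruder linear bound
  is stated because its product over the coordinates is a multiple of
  \<open>herm_weight\<close>.\<close>

lemma hermite_bound: "\<exists>K\<ge>1. \<forall>n t. \<bar>hermite n t\<bar> \<le> K * (2 * real n + 1)"
proof -
  let ?Z = "herm_norm TYPE(real)"
  have Z: "schwartz_inner (herm \<alpha>) (herm \<alpha>) = ?Z" for \<alpha> :: "real \<Rightarrow> nat"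
    unfolding herm_norm_def by (rule schwartz_inner_herm_same)
  define K where "K = max 1 (sqrt (2 * ?Z))"
  have "\<bar>hermite n t\<bar> \<le> K * (2 * real n + 1)" for n t
  proof -
    let ?\<alpha> = "\<lambda>_::real. n"
    have f: "schwartz_fun (herm ?\<alpha>) t = hermite n t" by (simp add: herm.rep_eq herm_fun_def)
    have orth: "schwartz_inner (herm (?\<alpha>(1 := n - 1))) (herm (?\<alpha>(1 := Suc n))) = 0"
      "schwartz_inner (herm (?\<alpha>(1 := Suc n))) (herm (?\<alpha>(1 := n - 1))) = 0"
      by (rule schwartz_inner_herm_neq[of 1]; simp)+
    have "schwartz_inner (partial_schwartz 1 (herm ?\<alpha>)) (partial_schwartz 1 (herm ?\<alpha>)) = (real n + 1 / 2) * ?Z"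
      using orth by (simp add: partial_schwartz_herm schwartz_inner_diff schwartz_inner_diff_left
        schwartz_inner_scaleR schwartz_inner_scaleR_left Z) (simp add: field_simps)
    then have "(hermite n t)\<^sup>2 \<le> (real n + 3 / 2) * ?Z"
      using schwartz_sup_bound_1d[of "herm ?\<alpha>" t] by (simp add: f Z algebra_simps)
    also have "\<dots> \<le> (2 * ?Z) * (2 * real n + 1)\<^sup>2"
      using herm_norm_pos[where 'a = real] by (simp add: power2_eq_square algebra_simps)
    also have "\<dots> \<le> K\<^sup>2 * (2 * real n + 1)\<^sup>2"
    proof (intro mult_right_mono)
      have "2 * ?Z = (sqrt (2 * ?Z))\<^sup>2" using herm_norm_pos[where 'a = real] by simp
      also have "\<dots> \<le> K\<^sup>2" unfolding K_def using herm_norm_pos[where 'a = real] by (intro power_mono) auto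
      finally show "2 * ?Z \<le> K\<^sup>2" .
    qed simp
    finally have "\<bar>hermite n t\<bar>\<^sup>2 \<le> (K * (2 * real n + 1))\<^sup>2" by (simp add: power_mult_distrib)
    then show ?thesis by (rule power2_le_imp_le) (simp add: K_def)
  qed
  then show ?thesis by (intro exI[of _ K]) (auto simp: K_def)
qed

section \<open>Growth of Hermite functions and decay of coefficients\<close>

text \<open>The eigenvalue on \<open>herm \<alpha>\<close> of the product of all oscillators. Growth
  and decay are measured in powers of it.\<close>

definition herm_weight :: "('a::euclidean_space \<Rightarrow> nat) \<Rightarrow> real" where
  "herm_weight \<alpha> = (\<Prod>b\<in>Basis. 2 * real (\<alpha> b) + 1)"

lemma herm_weight_split:
  assumes "b \<in> Basis"
  shows "herm_weight (\<alpha>(b := n)) = (2 * real n + 1) * (\<Prod>c\<in>Basis - {b}. 2 * real (\<alpha> c) + 1)"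
proof -
  have "(\<Prod>c\<in>Basis - {b}. 2 * real ((\<alpha>(b := n)) c) + 1) = (\<Prod>c\<in>Basis - {b}. 2 * real (\<alpha> c) + 1)"
    by (intro prod.cong) auto
  then show ?thesis
    unfolding herm_weight_def prod.remove[OF finite_Basis assms] by simp
qed

lemma herm_weight_rest: "1 \<le> (\<Prod>c\<in>Basis - {b}. 2 * real (\<alpha> c) + 1)"
  by (intro prod_ge_1) auto

lemma herm_weight_ge_1: "1 \<le> herm_weight \<alpha>"
  unfolding herm_weight_def by (intro prod_ge_1) auto

lemma herm_weight_component:
  assumes "b \<in> Basis"
  shows "2 * real (\<alpha> b) + 1 \<le> herm_weight \<alpha>"
  using herm_weight_split[OF assms, of \<alpha> "\<alpha> b"]
    mult_left_mono[OF herm_weight_rest[of \<alpha> b], of "2 * real (\<alpha> b) + 1"] by simp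

text \<open>The factor 3 is attained when \<open>\<alpha> b\<close> goes from 0 to 1. The last two
  bounds concern the coefficients of the ladder relations.\<close>

lemma herm_weight_neighbours:
  assumes b: "b \<in> Basis"
  shows "herm_weight (\<alpha>(b := \<alpha> b - 1)) \<le> 3 * herm_weight \<alpha>"
    and "herm_weight (\<alpha>(b := Suc (\<alpha> b))) \<le> 3 * herm_weight \<alpha>"
    and "sqrt (2 * real (\<alpha> b)) / 2 \<le> herm_weight \<alpha>"
    and "sqrt (2 * real (Suc (\<alpha> b))) / 2 \<le> herm_weight \<alpha>"
proof -
  let ?p = "\<Prod>c\<in>Basis - {b}. 2 * real (\<alpha> c) + 1"
  have p: "0 \<le> ?p" using herm_weight_rest[of \<alpha> b] by linarith
  have w: "herm_weight \<alpha> = (2 * real (\<alpha> b) + 1) * ?p"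
    using herm_weight_split[OF b, of \<alpha> "\<alpha> b"] by simp
  show "herm_weight (\<alpha>(b := \<alpha> b - 1)) \<le> 3 * herm_weight \<alpha>"
    "herm_weight (\<alpha>(b := Suc (\<alpha> b))) \<le> 3 * herm_weight \<alpha>"
    unfolding herm_weight_split[OF b] w mult.assoc[symmetric] by (intro mult_right_mono p; simp)+
  have sqrt: "sqrt y / 2 \<le> y / 4 + 1 / 4" if "0 \<le> y" for y :: real
    using sum_squares_bound[of "sqrt y" 1] that by simp
  have "sqrt (2 * real (\<alpha> b)) / 2 \<le> 2 * real (\<alpha> b) / 4 + 1 / 4" by (rule sqrt) simp
  then show "sqrt (2 * real (\<alpha> b)) / 2 \<le> herm_weight \<alpha>"
    using herm_weight_component[OF b, of \<alpha>] herm_weight_ge_1[of \<alpha>] by linarith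
  have "sqrt (2 * real (Suc (\<alpha> b))) / 2 \<le> 2 * real (Suc (\<alpha> b)) / 4 + 1 / 4" by (rule sqrt) simp
  also have "\<dots> \<le> 2 * real (\<alpha> b) + 1" by (simp add: field_simps)
  also have "\<dots> \<le> herm_weight \<alpha>" by (rule herm_weight_component[OF b])
  finally show "sqrt (2 * real (Suc (\<alpha> b))) / 2 \<le> herm_weight \<alpha>" .
qed

text \<open>Polynomial growth in the weight. It survives precomposition with derivatives and
  coordinate multiplications, so every seminorm of the Hermite functions is reached by
  induction.\<close>

definition herm_tame :: "('a::euclidean_space schwartz \<Rightarrow> 'a schwartz) \<Rightarrow> bool" where
  "herm_tame A \<longleftrightarrow> (\<exists>C p. 0 \<le> C \<and> (\<forall>\<alpha> x. \<bar>schwartz_fun (A (herm \<alpha>)) x\<bar> \<le> C * herm_weight \<alpha> ^ p))"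

lemma herm_fun_le: "\<exists>K\<ge>0. \<forall>\<alpha> (x::'a::euclidean_space). \<bar>herm_fun \<alpha> x\<bar> \<le> K * herm_weight \<alpha>"
proof -
  obtain K where K: "1 \<le> K" "\<And>n t. \<bar>hermite n t\<bar> \<le> K * (2 * real n + 1)"
    using hermite_bound by blast
  have "\<bar>herm_fun \<alpha> x\<bar> \<le> K ^ DIM('a) * herm_weight \<alpha>" for \<alpha> and x :: 'a
  proof -
    have "\<bar>herm_fun \<alpha> x\<bar> \<le> (\<Prod>b\<in>(Basis::'a set). K * (2 * real (\<alpha> b) + 1))"
      unfolding herm_fun_def abs_prod by (intro prod_mono conjI K) auto
    also have "\<dots> = K ^ DIM('a) * herm_weight \<alpha>"
      by (simp add: prod.distrib herm_weight_def)
    finally show ?thesis .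
  qed
  with K(1) show ?thesis by (intro exI[of _ "K ^ DIM('a)"]) auto
qed

lemma herm_tame_id: "herm_tame (\<lambda>\<phi>::'a::euclidean_space schwartz. \<phi>)"
proof -
  obtain K where "0 \<le> K" "\<And>\<alpha> x::'a. \<bar>herm_fun \<alpha> x\<bar> \<le> K * herm_weight \<alpha>" using herm_fun_le by blast
  then show ?thesis
    unfolding herm_tame_def by (intro exI[of _ K] exI[of _ 1]) (simp add: herm.rep_eq)
qed

text \<open>\<open>c = 1\<close> is multiplication by a coordinate, \<open>c = - 1\<close> is a
  derivative. Each moves one index by 1, at the price of a factor at most 3 in the weight and a
  coefficient at most the weight, so the exponent grows by 1.\<close>

lemma herm_tame_ladder:
  fixes A B :: "'a::euclidean_space schwartz \<Rightarrow> 'a schwartz"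
  assumes A: "linear A" "herm_tame A" and b: "b \<in> Basis" and c: "\<bar>c\<bar> = 1"
    and B: "\<And>\<alpha>. B (herm \<alpha>) = (sqrt (2 * real (\<alpha> b)) / 2) *\<^sub>R herm (\<alpha>(b := \<alpha> b - 1)) +
      (c * (sqrt (2 * real (Suc (\<alpha> b))) / 2)) *\<^sub>R herm (\<alpha>(b := Suc (\<alpha> b)))"
  shows "herm_tame (\<lambda>\<phi>. A (B \<phi>))"
proof -
  obtain C p where C: "0 \<le> C" "\<And>\<alpha> x. \<bar>schwartz_fun (A (herm \<alpha>)) x\<bar> \<le> C * herm_weight \<alpha> ^ p"
    using A(2) unfolding herm_tame_def by blast
  have "\<bar>schwartz_fun (A (B (herm \<alpha>))) x\<bar> \<le> (2 * (C * 3 ^ p)) * herm_weight \<alpha> ^ Suc p" for \<alpha> x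
  proof -
    let ?w = "herm_weight \<alpha>" and ?\<beta> = "\<alpha>(b := \<alpha> b - 1)" and ?\<gamma> = "\<alpha>(b := Suc (\<alpha> b))"
    let ?r = "sqrt (2 * real (\<alpha> b)) / 2" and ?q = "sqrt (2 * real (Suc (\<alpha> b))) / 2"
    have w: "1 \<le> ?w" by (rule herm_weight_ge_1)
    have bound: "\<bar>schwartz_fun (A (herm \<delta>)) x\<bar> \<le> C * 3 ^ p * ?w ^ p" if "herm_weight \<delta> \<le> 3 * ?w" for \<delta>
    proof -
      have "\<bar>schwartz_fun (A (herm \<delta>)) x\<bar> \<le> C * herm_weight \<delta> ^ p" by (rule C)
      also have "\<dots> \<le> C * (3 * ?w) ^ p"
        using herm_weight_ge_1[of \<delta>] by (intro mult_left_mono power_mono that C(1)) auto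
      finally show ?thesis by (simp add: power_mult_distrib mult.assoc)
    qed
    have "schwartz_fun (A (B (herm \<alpha>))) x =
        ?r * schwartz_fun (A (herm ?\<beta>)) x + (c * ?q) * schwartz_fun (A (herm ?\<gamma>)) x"
      by (simp only: B linear_add[OF A(1)] linear_scale[OF A(1)] plus_schwartz.rep_eq scaleR_schwartz.rep_eq)
    also have "\<bar>\<dots>\<bar> \<le> ?r * \<bar>schwartz_fun (A (herm ?\<beta>)) x\<bar> + ?q * \<bar>schwartz_fun (A (herm ?\<gamma>)) x\<bar>"
      by (rule order_trans[OF abs_triangle_ineq]) (simp add: abs_mult c)
    also have "\<dots> \<le> ?w * (C * 3 ^ p * ?w ^ p) + ?w * (C * 3 ^ p * ?w ^ p)"
      using w herm_weight_neighbours[OF b, of \<alpha>] by (intro add_mono mult_mono bound) auto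
    also have "\<dots> = (2 * (C * 3 ^ p)) * ?w ^ Suc p" by simp
    finally show ?thesis .
  qed
  then show ?thesis
    unfolding herm_tame_def using C(1) by (intro exI[of _ "2 * (C * 3 ^ p)"] exI[of _ "Suc p"]) auto
qed

lemma linear_coord_mult: "linear (coord_mult a)"
  by (rule linearI) (simp_all add: coord_mult_linear)

lemma linear_partial_schwartz: "b \<in> Basis \<Longrightarrow> linear (partial_schwartz b)"
  by (rule linearI) (simp_all add: partial_schwartz_linear)

lemma herm_tame_coord_mult:
  "linear A \<Longrightarrow> herm_tame A \<Longrightarrow> b \<in> Basis \<Longrightarrow> herm_tame (\<lambda>\<phi>. A (coord_mult b \<phi>))"
  by (rule herm_tame_ladder[where c = 1]) (simp_all add: coord_mult_herm)

lemma herm_tame_partial: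
  "linear A \<Longrightarrow> herm_tame A \<Longrightarrow> b \<in> Basis \<Longrightarrow> herm_tame (\<lambda>\<phi>. A (partial_schwartz b \<phi>))"
  by (rule herm_tame_ladder[where c = "- 1"]) (simp_all add: partial_schwartz_herm)

lemma linear_coord_mult_power: "linear (coord_mult b ^^ k)"
  by (induction k) (auto simp: linear_id intro: linear_compose[unfolded o_def] linear_coord_mult simp flip: id_def)

lemma herm_tame_coord_mult_power: "b \<in> Basis \<Longrightarrow> herm_tame (coord_mult b ^^ k)"
proof (induction k)
  case 0
  show ?case using herm_tame_id by (simp add: id_def)
next
  case (Suc k)
  then show ?case
    using herm_tame_coord_mult[OF linear_coord_mult_power[of k b], of b] by (simp add: funpow_Suc_right o_def del: funpow.simps)
qed

lemma linear_foldr_partial: "bs \<in> lists Basis \<Longrightarrow> linear (foldr partial_schwartz bs)"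
proof (induction bs)
  case (Cons b bs)
  then show ?case using linear_compose[OF _ linear_partial_schwartz, of "foldr partial_schwartz bs" b] by (simp add: o_def)
qed (simp add: linear_id)

lemma herm_tame_partials:
  assumes "linear A" "herm_tame A" "bs \<in> lists Basis"
  shows "herm_tame (\<lambda>\<phi>. A (foldr partial_schwartz bs \<phi>))"
  using assms(3)
proof (induction bs rule: rev_induct)
  case Nil
  show ?case using assms(2) by simp
next
  case (snoc b bs)
  then have bs: "set bs \<subseteq> Basis" and b: "b \<in> Basis" by auto
  have lin: "linear (\<lambda>\<phi>. A (foldr partial_schwartz bs \<phi>))"
    using linear_compose[OF linear_foldr_partial assms(1)] bs by (auto simp: o_def)
  show ?case using herm_tame_partial[OF lin _ b] snoc by simp
qed

lemma schwartz_fun_foldr_partial: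
  "bs \<in> lists Basis \<Longrightarrow> schwartz_fun (foldr partial_schwartz bs \<phi>) = partials bs (schwartz_fun \<phi>)"
  by (induction bs) (auto simp: partial_schwartz.rep_eq)

lemma schwartz_fun_coord_mult_power: "schwartz_fun ((coord_mult b ^^ k) \<phi>) x = (x \<bullet> b) ^ k * schwartz_fun \<phi> x"
  by (induction k) (auto simp: coord_mult.rep_eq)

lemma schwartz_seminorm_herm:
  assumes bs: "bs \<in> lists Basis"
  shows "\<exists>C p. 0 \<le> C \<and> (\<forall>\<alpha>. schwartz_seminorm k bs (herm \<alpha> :: 'a::euclidean_space schwartz) \<le> C * herm_weight \<alpha> ^ p)"
proof -
  have tame: "\<exists>C p. 0 \<le> C \<and> (\<forall>\<alpha> x. \<bar>(x \<bullet> b) ^ j * partials bs (schwartz_fun (herm \<alpha>)) x\<bar> \<le> C * herm_weight \<alpha> ^ p)"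
    if "b \<in> Basis" for b :: 'a and j
    using herm_tame_partials[OF linear_coord_mult_power herm_tame_coord_mult_power[OF that] bs, of j]
    by (simp add: herm_tame_def schwartz_fun_coord_mult_power schwartz_fun_foldr_partial[OF bs])
  then have "\<forall>b. \<exists>C p. b \<in> Basis \<longrightarrow> 0 \<le> C \<and> (\<forall>\<alpha> x. \<bar>(x \<bullet> b) ^ k * partials bs (schwartz_fun (herm \<alpha>)) x\<bar> \<le> C * herm_weight \<alpha> ^ p)"
    by blast
  then obtain C p where Cp: "\<And>b. b \<in> Basis \<Longrightarrow> 0 \<le> C b" "\<And>b \<alpha> x. b \<in> Basis \<Longrightarrow>
    \<bar>(x \<bullet> b) ^ k * partials bs (schwartz_fun (herm \<alpha>)) x\<bar> \<le> C b * herm_weight \<alpha> ^ p b" by metis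
  obtain D q where Dq: "0 \<le> D" "\<And>\<alpha> x. \<bar>partials bs (schwartz_fun (herm \<alpha>)) x\<bar> \<le> D * herm_weight \<alpha> ^ q"
    using tame[OF SOME_Basis, of 0] by auto
  \<comment> \<open>Weights are at least 1, so finitely many exponents may all be raised to their
    sum.\<close>
  define P where "P = q + (\<Sum>b\<in>Basis. p b)"
  define E where "E = real (1 + DIM('a)) ^ k * (D + (\<Sum>b\<in>Basis. C b))"
  have "schwartz_seminorm k bs (herm \<alpha>) \<le> E * herm_weight \<alpha> ^ P" for \<alpha> :: "'a \<Rightarrow> nat"
  proof (rule schwartz_seminorm_least)
    fix x
    let ?g = "partials bs (schwartz_fun (herm \<alpha>)) x" and ?w = "herm_weight \<alpha>"
    have up: "c * ?w ^ i \<le> c * ?w ^ P" if "i \<le> P" "0 \<le> c" for i c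
      using herm_weight_ge_1[of \<alpha>] that by (intro mult_left_mono power_increasing) auto
    have "(1 + norm x) ^ k * \<bar>?g\<bar> \<le> real (1 + DIM('a)) ^ k * (\<bar>?g\<bar> + (\<Sum>b\<in>Basis. \<bar>(x \<bullet> b) ^ k * ?g\<bar>))"
      by (rule weighted_abs_le)
    also have "\<dots> \<le> real (1 + DIM('a)) ^ k * (D * ?w ^ P + (\<Sum>b\<in>Basis. C b * ?w ^ P))"
    proof (intro mult_left_mono add_mono sum_mono)
      show "\<bar>?g\<bar> \<le> D * ?w ^ P" by (rule order_trans[OF Dq(2) up]) (auto simp: P_def Dq)
      fix b :: 'a assume b: "b \<in> Basis"
      then have "p b \<le> P" unfolding P_def by (intro trans_le_add2 member_le_sum) auto
      then show "\<bar>(x \<bullet> b) ^ k * ?g\<bar> \<le> C b * ?w ^ P" by (intro order_trans[OF Cp(2)[OF b] up] Cp(1) b)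
    qed auto
    also have "\<dots> = E * ?w ^ P" by (simp add: E_def distrib_right sum_distrib_right mult.assoc)
    finally show "(1 + norm x) ^ k * \<bar>?g\<bar> \<le> E * ?w ^ P" .
  qed
  moreover have "0 \<le> E" unfolding E_def by (intro mult_nonneg_nonneg add_nonneg_nonneg sum_nonneg Dq Cp) auto
  ultimately show ?thesis by blast
qed

lemma schwartz_norm_herm:
  "\<exists>C p. 0 \<le> C \<and> (\<forall>\<alpha>. schwartz_norm m (herm \<alpha> :: 'a::euclidean_space schwartz) \<le> C * herm_weight \<alpha> ^ p)"
proof -
  let ?I = "seminorm_index m :: (nat \<times> 'a list) set"
  have "\<forall>i. \<exists>C p. i \<in> ?I \<longrightarrow> 0 \<le> C \<and> (\<forall>\<alpha>. schwartz_seminorm (fst i) (snd i) (herm \<alpha> :: 'a schwartz) \<le> C * herm_weight \<alpha> ^ p)"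
    using schwartz_seminorm_herm by (auto simp: seminorm_index_iff)
  then obtain C p where Cp: "\<And>i. i \<in> ?I \<Longrightarrow> 0 \<le> C i"
    "\<And>i \<alpha>. i \<in> ?I \<Longrightarrow> schwartz_seminorm (fst i) (snd i) (herm \<alpha> :: 'a schwartz) \<le> C i * herm_weight \<alpha> ^ p i" by metis
  define P where "P = (\<Sum>i\<in>?I. p i)"
  have "schwartz_norm m (herm \<alpha>) \<le> (\<Sum>i\<in>?I. C i) * herm_weight \<alpha> ^ P" for \<alpha> :: "'a \<Rightarrow> nat"
    unfolding schwartz_norm_def case_prod_unfold sum_distrib_right
  proof (intro sum_mono)
    fix i assume i: "i \<in> ?I"
    then have "p i \<le> P" unfolding P_def by (intro member_le_sum) auto
    then have "C i * herm_weight \<alpha> ^ p i \<le> C i * herm_weight \<alpha> ^ P"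
      using herm_weight_ge_1[of \<alpha>] by (intro mult_left_mono power_increasing Cp i) auto
    with Cp(2)[OF i, of \<alpha>] show "schwartz_seminorm (fst i) (snd i) (herm \<alpha>) \<le> C i * herm_weight \<alpha> ^ P" by linarith
  qed
  moreover have "0 \<le> (\<Sum>i\<in>?I. C i)" by (intro sum_nonneg Cp)
  ultimately show ?thesis by blast
qed

definition schwartz_norm_bounded_op :: "('a::euclidean_space schwartz \<Rightarrow> 'a schwartz) \<Rightarrow> bool" where
  "schwartz_norm_bounded_op A \<longleftrightarrow> (\<forall>m. \<exists>n C. 0 \<le> C \<and> (\<forall>\<phi>. schwartz_norm m (A \<phi>) \<le> C * schwartz_norm n \<phi>))"

lemma schwartz_norm_bounded_op_compose:
  assumes "schwartz_norm_bounded_op A" "schwartz_norm_bounded_op B"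
  shows "schwartz_norm_bounded_op (\<lambda>\<phi>. A (B \<phi>))"
  unfolding schwartz_norm_bounded_op_def
proof
  fix m
  obtain n C where C: "0 \<le> C" "\<And>\<phi>. schwartz_norm m (A \<phi>) \<le> C * schwartz_norm n \<phi>"
    using assms(1) unfolding schwartz_norm_bounded_op_def by blast
  obtain l D where D: "0 \<le> D" "\<And>\<phi>. schwartz_norm n (B \<phi>) \<le> D * schwartz_norm l \<phi>"
    using assms(2) unfolding schwartz_norm_bounded_op_def by blast
  have "schwartz_norm m (A (B \<phi>)) \<le> (C * D) * schwartz_norm l \<phi>" for \<phi>
    using order_trans[OF C(2) mult_left_mono[OF D(2) C(1)]] by (simp add: mult.assoc)
  then show "\<exists>n C. 0 \<le> C \<and> (\<forall>\<phi>. schwartz_norm m (A (B \<phi>)) \<le> C * schwartz_norm n \<phi>)"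
    using C(1) D(1) by (intro exI[of _ l] exI[of _ "C * D"]) auto
qed

text \<open>Stated with an inequality so that it covers both the sum and the difference of two
  operators.\<close>

lemma schwartz_norm_bounded_op_combine:
  assumes A: "schwartz_norm_bounded_op A" and B: "schwartz_norm_bounded_op B"
    and le: "\<And>m \<phi>. schwartz_norm m (R \<phi>) \<le> schwartz_norm m (A \<phi>) + schwartz_norm m (B \<phi>)"
  shows "schwartz_norm_bounded_op R"
  unfolding schwartz_norm_bounded_op_def
proof
  fix m
  obtain n C where C: "0 \<le> C" "\<And>\<phi>. schwartz_norm m (A \<phi>) \<le> C * schwartz_norm n \<phi>"
    using A unfolding schwartz_norm_bounded_op_def by blast
  obtain l D where D: "0 \<le> D" "\<And>\<phi>. schwartz_norm m (B \<phi>) \<le> D * schwartz_norm l \<phi>"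
    using B unfolding schwartz_norm_bounded_op_def by blast
  have "schwartz_norm m (R \<phi>) \<le> (C + D) * schwartz_norm (max n l) \<phi>" for \<phi>
  proof -
    have "schwartz_norm m (R \<phi>) \<le> C * schwartz_norm n \<phi> + D * schwartz_norm l \<phi>"
      using le[of m \<phi>] C(2)[of \<phi>] D(2)[of \<phi>] by linarith
    also have "\<dots> \<le> C * schwartz_norm (max n l) \<phi> + D * schwartz_norm (max n l) \<phi>"
      by (intro add_mono mult_left_mono C D schwartz_norm_mono) auto
    finally show ?thesis by (simp add: distrib_right)
  qed
  then show "\<exists>n C. 0 \<le> C \<and> (\<forall>\<phi>. schwartz_norm m (R \<phi>) \<le> C * schwartz_norm n \<phi>)"
    using C(1) D(1) by (intro exI[of _ "max n l"] exI[of _ "C + D"]) auto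
qed

lemma schwartz_norm_bounded_op_id: "schwartz_norm_bounded_op (\<lambda>\<phi>. \<phi>)"
  unfolding schwartz_norm_bounded_op_def by (intro allI exI[of _ 1] exI) auto

lemma schwartz_norm_bounded_op_oscillator:
  assumes b: "b \<in> Basis"
  shows "schwartz_norm_bounded_op (oscillator b)"
proof -
  have X: "schwartz_norm_bounded_op (coord_mult b)"
    unfolding schwartz_norm_bounded_op_def using schwartz_norm_coord_mult by metis
  have D: "schwartz_norm_bounded_op (partial_schwartz b)"
    unfolding schwartz_norm_bounded_op_def using schwartz_norm_partial[OF b] by metis
  have "schwartz_norm_bounded_op (lowering b)" "schwartz_norm_bounded_op (raising b)"
    by (rule schwartz_norm_bounded_op_combine[OF X D];
      simp add: lowering_def raising_def schwartz_norm_add_le schwartz_norm_diff_le)+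
  from schwartz_norm_bounded_op_combine[OF schwartz_norm_bounded_op_compose[OF this(2,1)] schwartz_norm_bounded_op_id]
  show ?thesis by (simp add: oscillator_def schwartz_norm_add_le)
qed

text \<open>Each oscillator is symmetric, so it can be moved onto \<open>herm \<alpha>\<close>,
  where it acts by its eigenvalue.\<close>

lemma oscillator_product:
  obtains R :: "'a::euclidean_space schwartz \<Rightarrow> 'a schwartz" where "schwartz_norm_bounded_op R"
    "\<And>\<alpha> \<phi>. schwartz_inner (herm \<alpha>) (R \<phi>) = herm_weight \<alpha> * schwartz_inner (herm \<alpha>) \<phi>"
proof -
  obtain bl :: "'a list" where bl: "set bl = Basis" "distinct bl"
    using finite_distinct_list[OF finite_Basis] by blast
  have "set cs \<subseteq> Basis \<Longrightarrow> distinct cs \<Longrightarrow> schwartz_norm_bounded_op (foldr oscillator cs) \<and>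
    (\<forall>\<alpha> \<phi>. schwartz_inner (herm \<alpha>) (foldr oscillator cs \<phi>) =
      (\<Prod>b\<in>set cs. 2 * real (\<alpha> b) + 1) * schwartz_inner (herm \<alpha>) \<phi>)" for cs :: "'a list"
  proof (induction cs)
    case Nil
    then show ?case using schwartz_norm_bounded_op_id by (simp add: id_def)
  next
    case (Cons b cs)
    then have b: "b \<in> Basis" and IH: "schwartz_norm_bounded_op (foldr oscillator cs)"
      "\<And>\<alpha> \<phi>. schwartz_inner (herm \<alpha>) (foldr oscillator cs \<phi>) =
      (\<Prod>b\<in>set cs. 2 * real (\<alpha> b) + 1) * schwartz_inner (herm \<alpha>) \<phi>" by auto
    have "schwartz_norm_bounded_op (foldr oscillator (b # cs))"
      using schwartz_norm_bounded_op_compose[OF schwartz_norm_bounded_op_oscillator[OF b] IH(1)]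
      by (simp add: o_def)
    moreover have "schwartz_inner (herm \<alpha>) (foldr oscillator (b # cs) \<phi>) =
      (\<Prod>b\<in>set (b # cs). 2 * real (\<alpha> b) + 1) * schwartz_inner (herm \<alpha>) \<phi>" for \<alpha> \<phi>
      using Cons.prems by (simp add: schwartz_inner_oscillator[OF b, symmetric] oscillator_herm[OF b]
        schwartz_inner_scaleR_left IH(2))
    ultimately show ?case by blast
  qed
  from this[of bl] bl show ?thesis by (intro that[of "foldr oscillator bl"]) (auto simp: herm_weight_def)
qed

lemma schwartz_inner_herm_le:
  "\<exists>K\<ge>0. \<forall>\<alpha> \<phi>. \<bar>schwartz_inner (herm \<alpha>) (\<phi> :: 'a::euclidean_space schwartz)\<bar>
    \<le> K * herm_weight \<alpha> * schwartz_norm (2 * DIM('a)) \<phi>"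
proof -
  obtain K where K: "0 \<le> K" "\<And>\<alpha> x::'a. \<bar>herm_fun \<alpha> x\<bar> \<le> K * herm_weight \<alpha>" using herm_fun_le by blast
  let ?i = "\<lambda>x::'a. inverse ((1 + norm x) ^ (2 * DIM('a)))"
  define I where "I = (\<integral>x. ?i x \<partial>lborel)"
  have I: "0 \<le> I" unfolding I_def by (intro integral_nonneg_AE AE_I2) simp
  have "\<bar>schwartz_inner (herm \<alpha>) \<phi>\<bar> \<le> (K * I) * herm_weight \<alpha> * schwartz_norm (2 * DIM('a)) \<phi>"
    for \<alpha> and \<phi> :: "'a schwartz"
  proof -
    let ?N = "schwartz_norm (2 * DIM('a)) \<phi>"
    have "\<bar>schwartz_inner (herm \<alpha>) \<phi>\<bar> \<le> (\<integral>x. \<bar>schwartz_fun (herm \<alpha>) x * schwartz_fun \<phi> x\<bar> \<partial>lborel)"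
      unfolding schwartz_inner_def by (rule integral_abs_bound)
    also have "\<dots> \<le> (\<integral>x. (K * herm_weight \<alpha> * ?N) * ?i x \<partial>lborel)"
    proof (intro integral_mono integrable_abs integrable_schwartz_fun_mult integrable_mult_right impI
        integrable_inverse_norm_power)
      fix x :: 'a
      have "(1 + norm x) ^ (2 * DIM('a)) * \<bar>schwartz_fun \<phi> x\<bar> \<le> ?N"
        using schwartz_norm_upper[of "2 * DIM('a)" "2 * DIM('a)" "[]" x \<phi>] by simp
      moreover have "0 < (1 + norm x) ^ (2 * DIM('a))" by (simp add: add_pos_nonneg)
      ultimately have "\<bar>schwartz_fun \<phi> x\<bar> \<le> ?N * ?i x"
        by (simp add: pos_le_divide_eq divide_inverse[symmetric] mult.commute)
      then have "\<bar>schwartz_fun (herm \<alpha>) x\<bar> * \<bar>schwartz_fun \<phi> x\<bar> \<le> (K * herm_weight \<alpha>) * (?N * ?i x)"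
        using K herm_weight_ge_1[of \<alpha>] by (intro mult_mono) (auto simp: herm.rep_eq)
      then show "\<bar>schwartz_fun (herm \<alpha>) x * schwartz_fun \<phi> x\<bar> \<le> K * herm_weight \<alpha> * ?N * ?i x"
        by (simp add: abs_mult mult.assoc)
    qed
    also have "\<dots> = (K * I) * herm_weight \<alpha> * ?N" by (simp add: I_def mult_ac)
    finally show ?thesis .
  qed
  with K I show ?thesis by (intro exI[of _ "K * I"]) auto
qed

text \<open>Applying the oscillator product \<open>k + 1\<close> times multiplies the coefficient by
  the weight to that power. One power pays for the growth of the Hermite functions themselves in
  \<open>schwartz_inner_herm_le\<close>.\<close>

lemma schwartz_inner_herm_decay:
  "\<exists>m C. 0 \<le> C \<and> (\<forall>\<alpha> \<phi>. \<bar>schwartz_inner (herm \<alpha>) (\<phi> :: 'a::euclidean_space schwartz)\<bar> * herm_weight \<alpha> ^ k \<le> C * schwartz_norm m \<phi>)"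
proof -
  obtain R :: "'a schwartz \<Rightarrow> 'a schwartz" where R: "schwartz_norm_bounded_op R"
    "\<And>\<alpha> \<phi>. schwartz_inner (herm \<alpha>) (R \<phi>) = herm_weight \<alpha> * schwartz_inner (herm \<alpha>) \<phi>"
    by (rule oscillator_product) blast
  have Rk: "schwartz_norm_bounded_op (R ^^ j)" "schwartz_inner (herm \<alpha>) ((R ^^ j) \<phi>) = herm_weight \<alpha> ^ j * schwartz_inner (herm \<alpha>) \<phi>"
    for j \<alpha> \<phi>
  proof (induction j)
    case 0
    { case 1 then show ?case using schwartz_norm_bounded_op_id by (simp add: id_def) }
    { case 2 then show ?case by simp }
  next
    case (Suc j)
    { case 1 then show ?case using schwartz_norm_bounded_op_compose[OF R(1) Suc(1)] by (simp add: o_def) }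
    { case 2 then show ?case using Suc(2) by (simp add: R(2)) }
  qed
  obtain K where K: "0 \<le> K" "\<And>\<alpha> \<phi>. \<bar>schwartz_inner (herm \<alpha>) (\<phi> :: 'a schwartz)\<bar>
    \<le> K * herm_weight \<alpha> * schwartz_norm (2 * DIM('a)) \<phi>" using schwartz_inner_herm_le by blast
  obtain n C where C: "0 \<le> C" "\<And>\<phi>. schwartz_norm (2 * DIM('a)) ((R ^^ Suc k) \<phi>) \<le> C * schwartz_norm n \<phi>"
    using Rk(1)[of "Suc k"] unfolding schwartz_norm_bounded_op_def by blast
  have "\<bar>schwartz_inner (herm \<alpha>) \<phi>\<bar> * herm_weight \<alpha> ^ k \<le> (K * C) * schwartz_norm n \<phi>" for \<alpha> and \<phi> :: "'a schwartz"
  proof -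
    let ?w = "herm_weight \<alpha>"
    have w: "0 < ?w" using herm_weight_ge_1[of \<alpha>] by linarith
    have "?w * (\<bar>schwartz_inner (herm \<alpha>) \<phi>\<bar> * ?w ^ k) = \<bar>schwartz_inner (herm \<alpha>) ((R ^^ Suc k) \<phi>)\<bar>"
      unfolding Rk(2) using w by (simp add: abs_mult mult_ac)
    also have "\<dots> \<le> K * ?w * schwartz_norm (2 * DIM('a)) ((R ^^ Suc k) \<phi>)" by (rule K)
    also have "\<dots> \<le> K * ?w * (C * schwartz_norm n \<phi>)" using K w by (intro mult_left_mono C) auto
    also have "\<dots> = ?w * (K * C * schwartz_norm n \<phi>)" by (simp add: mult_ac)
    finally show ?thesis using w by simp
  qed
  with K C show ?thesis by (intro exI[of _ n] exI[of _ "K * C"]) auto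
qed

section \<open>Representation by sequences\<close>

text \<open>Functions that are extensional on \<open>Basis\<close> form a countable set of
  representatives. Over a box of indices the sum factorises, so every partial sum is bounded by a
  power of a convergent one-dimensional sum.\<close>

lemma herm_enumeration:
  obtains e :: "nat \<Rightarrow> 'a::euclidean_space \<Rightarrow> nat"
  where "\<And>\<alpha>. \<exists>j. \<forall>b\<in>Basis. e j b = \<alpha> b" "\<And>i j. i \<noteq> j \<Longrightarrow> \<exists>b\<in>Basis. e i b \<noteq> e j b"
    "summable (\<lambda>j. inverse ((herm_weight (e j))\<^sup>2))"
proof -
  let ?I = "PiE (Basis :: 'a set) (\<lambda>_. UNIV :: nat set)"
  have "infinite ?I"
  proof
    assume fin: "finite ?I"
    have "inj (\<lambda>n. \<lambda>b\<in>(Basis::'a set). n :: nat)"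
      by (rule injI) (metis SOME_Basis restrict_apply')
    moreover have "range (\<lambda>n. \<lambda>b\<in>(Basis::'a set). n :: nat) \<subseteq> ?I" by auto
    ultimately show False using fin by (meson finite_subset finite_imageD infinite_UNIV_nat)
  qed
  moreover have "countable ?I" by (intro countable_PiE) auto
  ultimately have bij: "bij_betw (from_nat_into ?I) UNIV ?I" by (rule bij_betw_from_nat_into[rotated])
  define e where "e = from_nat_into ?I"
  have e_in: "e j \<in> ?I" for j using bij by (auto simp: e_def bij_betw_def)
  have surj: "\<exists>j. \<forall>b\<in>Basis. e j b = \<alpha> b" for \<alpha> :: "'a \<Rightarrow> nat"
  proof -
    have "restrict \<alpha> Basis \<in> ?I" by auto
    then obtain j where "e j = restrict \<alpha> Basis" using bij unfolding e_def bij_betw_def by (metis imageE)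
    then show ?thesis by (intro exI[of _ j]) auto
  qed
  have inj: "\<exists>b\<in>Basis. e i b \<noteq> e j b" if "i \<noteq> j" for i j
  proof (rule ccontr)
    assume "\<not> ?thesis"
    then have "e i = e j" using e_in[of i] e_in[of j] by (intro PiE_ext[of "e i" Basis]) auto
    then show False using bij that unfolding e_def bij_betw_def by (auto dest: injD)
  qed
  obtain c where c: "(\<lambda>n. inverse ((2 * real n + 1)\<^sup>2)) sums c"
  proof -
    have "summable (\<lambda>n. inverse ((real (Suc n))\<^sup>2))"
      using inverse_squares_sums by (auto simp: sums_iff inverse_eq_divide add.commute)
    then have "summable (\<lambda>n. inverse ((2 * real n + 1)\<^sup>2))"
      by (rule summable_comparison_test') (auto intro!: le_imp_inverse_le power_mono)
    then show ?thesis using that by (auto dest: summable_sums)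
  qed
  have "summable (\<lambda>j. inverse ((herm_weight (e j))\<^sup>2))"
  proof (rule summableI_nonneg_bounded)
    fix n
    let ?F = "e ` {..<n}"
    define N where "N = Max (insert 0 ((\<lambda>(j, b). e j b) ` ({..<n} \<times> (Basis::'a set))))"
    have N: "e j b \<le> N" if "j < n" "b \<in> Basis" for j b
      unfolding N_def using that by (intro Max_ge) force+
    have "inj_on e {..<n}" using inj by (intro inj_onI) metis
    then have "(\<Sum>j<n. inverse ((herm_weight (e j))\<^sup>2)) = (\<Sum>\<alpha>\<in>?F. inverse ((herm_weight \<alpha>)\<^sup>2))"
      by (simp add: sum.reindex)
    also have "\<dots> \<le> (\<Sum>\<alpha>\<in>PiE (Basis::'a set) (\<lambda>_. {..N}). inverse ((herm_weight \<alpha>)\<^sup>2))"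
    proof (rule sum_mono2)
      show "?F \<subseteq> PiE (Basis::'a set) (\<lambda>_. {..N})"
      proof (intro image_subsetI PiE_I)
        fix j b assume "j \<in> {..<n}"
        show "b \<in> Basis \<Longrightarrow> e j b \<in> {..N}" using N \<open>j \<in> {..<n}\<close> by simp
        show "b \<notin> Basis \<Longrightarrow> e j b = undefined" using e_in[of j] by (rule PiE_arb)
      qed
    qed (auto intro!: finite_PiE)
    also have "\<dots> = (\<Sum>\<alpha>\<in>PiE (Basis::'a set) (\<lambda>_. {..N}). \<Prod>b\<in>Basis. inverse ((2 * real (\<alpha> b) + 1)\<^sup>2))"
      by (simp add: herm_weight_def prod_power_distrib prod_inversef[unfolded o_def])
    also have "\<dots> = (\<Prod>b\<in>(Basis::'a set). \<Sum>n\<in>{..N}. inverse ((2 * real n + 1)\<^sup>2))"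
      by (rule prod_sum_PiE[symmetric]) auto
    also have "\<dots> \<le> (\<Prod>b\<in>(Basis::'a set). c)"
      using c by (intro prod_mono conjI sum_nonneg) (auto simp: sums_iff intro!: sum_le_suminf)
    finally show "(\<Sum>j<n. inverse ((herm_weight (e j))\<^sup>2)) \<le> (\<Prod>b\<in>(Basis::'a set). c)" .
  qed simp
  with surj inj show ?thesis by (rule that)
qed

text \<open>The interface to the probabilistic part, which uses no other property of the Hermite
  functions.\<close>

lemma schwartz_decomposition:
  obtains \<psi> :: "nat \<Rightarrow> 'a::euclidean_space schwartz" and c :: "nat \<Rightarrow> 'a tempered" and w :: "nat \<Rightarrow> real"
  where "\<And>j. 1 \<le> w j" "summable (\<lambda>j. inverse (w j))"
    "\<And>m. \<exists>C p. 0 \<le> C \<and> (\<forall>j. schwartz_norm m (\<psi> j) \<le> C * w j ^ p)"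
    "\<And>k. \<exists>m C. 0 \<le> C \<and> (\<forall>j \<phi>. \<bar>pairing (c j) \<phi>\<bar> * w j ^ k \<le> C * schwartz_norm m \<phi>)"
    "\<And>v \<phi>. (\<lambda>j. pairing (c j) \<phi> * pairing v (\<psi> j)) sums pairing v \<phi>"
proof -
  obtain e :: "nat \<Rightarrow> 'a \<Rightarrow> nat" where e: "\<And>\<alpha>. \<exists>j. \<forall>b\<in>Basis. e j b = \<alpha> b"
    "\<And>i j. i \<noteq> j \<Longrightarrow> \<exists>b\<in>Basis. e i b \<noteq> e j b" and sw: "summable (\<lambda>j. inverse ((herm_weight (e j))\<^sup>2))"
    by (rule herm_enumeration) blast
  let ?Z = "herm_norm TYPE('a)"
  have Z: "0 < ?Z" by (rule herm_norm_pos)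
  define \<psi> where "\<psi> j = herm (e j)" for j
  define c where "c j = inverse ?Z *\<^sub>R tempered_of_schwartz (\<psi> j)" for j
  \<comment> \<open>Squared, because already in dimension one the inverse weights sum like a
    harmonic series.\<close>
  define w where "w j = (herm_weight (e j))\<^sup>2" for j
  have pc: "pairing (c j) \<phi> = inverse ?Z * schwartz_inner (\<psi> j) \<phi>" for j \<phi>
    by (simp add: c_def scaleR_tempered.rep_eq pairing_tempered_of_schwartz)
  have w_ge: "herm_weight (e j) \<le> w j" for j
    using herm_weight_ge_1[of "e j"] by (simp add: w_def power2_eq_square)
  have w1: "1 \<le> w j" for j using herm_weight_ge_1[of "e j"] w_ge[of j] by linarith
  have sw': "summable (\<lambda>j. inverse (w j))" using sw by (simp add: w_def)
  have \<psi>_bound: "\<exists>C p. 0 \<le> C \<and> (\<forall>j. schwartz_norm m (\<psi> j) \<le> C * w j ^ p)" for m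
  proof -
    obtain C p where C: "0 \<le> C" "\<And>\<alpha>. schwartz_norm m (herm \<alpha> :: 'a schwartz) \<le> C * herm_weight \<alpha> ^ p"
      using schwartz_norm_herm by blast
    have "schwartz_norm m (\<psi> j) \<le> C * w j ^ p" for j
    proof -
      have "C * herm_weight (e j) ^ p \<le> C * w j ^ p"
        using w_ge[of j] herm_weight_ge_1[of "e j"] by (intro mult_left_mono power_mono C) auto
      with C(2)[of "e j"] show ?thesis unfolding \<psi>_def by linarith
    qed
    with C(1) show ?thesis by blast
  qed
  have c_bound: "\<exists>m C. 0 \<le> C \<and> (\<forall>j \<phi>. \<bar>pairing (c j) \<phi>\<bar> * w j ^ k \<le> C * schwartz_norm m \<phi>)" for k
  proof -
    obtain m C where C: "0 \<le> C" "\<And>\<alpha> \<phi>. \<bar>schwartz_inner (herm \<alpha>) (\<phi> :: 'a schwartz)\<bar> * herm_weight \<alpha> ^ (2 * k) \<le> C * schwartz_norm m \<phi>"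
      using schwartz_inner_herm_decay by blast
    have "\<bar>pairing (c j) \<phi>\<bar> * w j ^ k \<le> (inverse ?Z * C) * schwartz_norm m \<phi>" for j \<phi>
      using mult_left_mono[OF C(2)[of "e j" \<phi>], of "inverse ?Z"] Z
      by (simp add: pc abs_mult \<psi>_def w_def power_mult[symmetric] mult.assoc)
    then show ?thesis using C(1) Z by (intro exI[of _ m] exI[of _ "inverse ?Z * C"]) auto
  qed
  have expand: "(\<lambda>j. pairing (c j) \<phi> * pairing v (\<psi> j)) sums pairing v \<phi>" for v \<phi>
  proof -
    have "summable (\<lambda>j. schwartz_norm m (pairing (c j) \<phi> *\<^sub>R \<psi> j))" for m
    proof -
      obtain C p where C: "0 \<le> C" "\<And>j. schwartz_norm m (\<psi> j) \<le> C * w j ^ p" using \<psi>_bound by blast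
      \<comment> \<open>One power of \<open>w j\<close> beyond the growth of \<open>\<psi> j\<close>
        leaves the summable factor \<open>inverse (w j)\<close>.\<close>
      obtain n D where D: "\<And>j \<phi>. \<bar>pairing (c j) \<phi>\<bar> * w j ^ Suc p \<le> D * schwartz_norm n \<phi>" using c_bound by blast
      have "norm (schwartz_norm m (pairing (c j) \<phi> *\<^sub>R \<psi> j)) \<le> (C * (D * schwartz_norm n \<phi>)) * inverse (w j)" for j
      proof -
        have w: "0 < w j" using w1[of j] by linarith
        have "schwartz_norm m (pairing (c j) \<phi> *\<^sub>R \<psi> j) \<le> \<bar>pairing (c j) \<phi>\<bar> * (C * w j ^ p)"
          by (rule order_trans[OF schwartz_norm_scaleR_le]) (intro mult_left_mono C abs_ge_zero)
        also have "\<dots> = C * (\<bar>pairing (c j) \<phi>\<bar> * w j ^ Suc p) * inverse (w j)" using w by simp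
        also have "\<dots> \<le> C * (D * schwartz_norm n \<phi>) * inverse (w j)"
          using w by (intro mult_right_mono mult_left_mono D C) auto
        finally show ?thesis by simp
      qed
      then show ?thesis by (intro summable_comparison_test'[OF summable_mult[OF sw']])
    qed
    then obtain \<phi>' where \<phi>': "\<And>v. (\<lambda>j. pairing v (pairing (c j) \<phi> *\<^sub>R \<psi> j)) sums pairing v \<phi>'"
      by (rule schwartz_series) blast
    \<comment> \<open>The series converges to some test function; comparing Hermite coefficients and
      using completeness identifies it.\<close>
    have "herm_orthogonal (\<phi>' - \<phi>)"
      unfolding herm_orthogonal_def
    proof
      fix \<alpha> :: "'a \<Rightarrow> nat"
      obtain i where "\<forall>b\<in>Basis. e i b = \<alpha> b" using e(1) by blast
      then have h: "herm \<alpha> = \<psi> i" unfolding \<psi>_def by (intro herm_cong) auto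
      have "pairing (tempered_of_schwartz (\<psi> i)) (pairing (c j) \<phi> *\<^sub>R \<psi> j) = (if j = i then schwartz_inner (\<psi> i) \<phi> else 0)" for j
      proof (cases "j = i")
        case True
        then show ?thesis
          using Z schwartz_inner_herm_same[of "e i"]
          by (simp add: pairing_tempered_of_schwartz schwartz_inner_scaleR pc \<psi>_def herm_norm_def[of "TYPE('a)", symmetric])
      next
        case False
        then obtain b where "b \<in> Basis" "e i b \<noteq> e j b" using e(2)[of i j] by blast
        then have "schwartz_inner (\<psi> i) (\<psi> j) = 0" unfolding \<psi>_def by (rule schwartz_inner_herm_neq)
        with False show ?thesis by (simp add: pairing_tempered_of_schwartz schwartz_inner_scaleR)
      qed
      then have "(\<lambda>j. if j = i then schwartz_inner (\<psi> i) \<phi> else 0) sums schwartz_inner (\<psi> i) \<phi>'"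
        using \<phi>'[of "tempered_of_schwartz (\<psi> i)"] by (simp add: pairing_tempered_of_schwartz)
      then have "schwartz_inner (\<psi> i) \<phi>' = schwartz_inner (\<psi> i) \<phi>"
        using sums_unique2 sums_single[of i "\<lambda>_. schwartz_inner (\<psi> i) \<phi>"] by blast
      then show "schwartz_inner (herm \<alpha>) (\<phi>' - \<phi>) = 0" by (simp add: h schwartz_inner_diff)
    qed
    then have "\<phi>' = \<phi>" using herm_orthogonal_eq_0 by fastforce
    with \<phi>'[of v] show ?thesis by (simp add: linear_scale[OF linear_pairing])
  qed
  from w1 sw' \<psi>_bound c_bound expand show ?thesis by (rule that)
qed

section \<open>Tightness\<close>

lemma space_cylindrical [simp]: "space cylindrical = UNIV"
  by (simp add: cylindrical_def space_measure_of_conv)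

lemma measurable_pairing: "(\<lambda>v. pairing v \<phi>) \<in> borel_measurable cylindrical"
proof (rule measurableI)
  fix A :: "real set" assume A: "A \<in> sets borel"
  let ?G = "{{v. (\<lambda>i\<in>{..<N}. pairing v (\<phi> i)) \<in> B} | N (\<phi> :: nat \<Rightarrow> 'a schwartz) B.
        1 \<le> N \<and> B \<in> sets (\<Pi>\<^sub>M i\<in>{..<N}. (borel :: real measure))}"
  let ?P = "\<Pi>\<^sub>M i\<in>{..<1::nat}. (borel :: real measure)"
  have B: "(\<lambda>x. x 0) -` A \<inter> space ?P \<in> sets ?P"
    by (rule measurable_sets[OF measurable_component_singleton[of 0 "{..<1}" "\<lambda>_. borel"] A]) simp
  have "(\<lambda>v. pairing v \<phi>) -` A = {v. (\<lambda>i\<in>{..<1}. pairing v ((\<lambda>_. \<phi>) i)) \<in> (\<lambda>x. x 0) -` A \<inter> space ?P}"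
    by (auto simp: space_PiM)
  also have "\<dots> \<in> ?G"
    by (intro CollectI exI[of _ "1::nat"] exI[of _ "\<lambda>_. \<phi>"] exI[of _ "(\<lambda>x. x 0) -` A \<inter> space ?P"]
      conjI refl B order_refl)
  also have "?G \<subseteq> sets cylindrical" unfolding cylindrical_def by auto
  finally show "(\<lambda>v. pairing v \<phi>) -` A \<inter> space cylindrical \<in> sets cylindrical" by simp
qed simp

section \<open>Averages over random coefficients\<close>

definition unif :: "real measure" where "unif = uniform_measure lborel {-1..1}"

lemma prob_space_unif: "prob_space unif"
  unfolding unif_def by (rule prob_space_uniform_measure) auto

lemma sets_unif [simp, measurable_cong]: "sets unif = sets borel"
  by (simp add: unif_def)

lemma AE_unif: "AE x in unif. x \<in> {-1..1}"
  unfolding unif_def by (rule AE_uniform_measureI) auto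

text \<open>This is \<open>sin t / t\<close>; bounding the primitive at both end points gives
  \<open>1 / \<bar>t\<bar>\<close>. The threshold 2 makes this at most one half.\<close>

lemma char_unif_le:
  assumes "2 \<le> \<bar>t\<bar>"
  shows "norm (char unif t) \<le> 1 / 2"
proof -
  define F where "F x = iexp (t * x) / (\<i> * t)" for x
  have t: "t \<noteq> 0" using assms by auto
  have F: "(F has_vector_derivative iexp (t * x)) (at x within {-1..1})" for x
  proof -
    have "((\<lambda>z. exp (\<i> * t * z) / (\<i> * t)) has_field_derivative exp (\<i> * t * of_real x)) (at (of_real x))"
      using t by (auto intro!: derivative_eq_intros)
    from has_vector_derivative_real_field[OF this] show ?thesis
      by (simp add: F_def[abs_def] mult.assoc)
  qed
  have int_F: "(\<integral>x. indicator {-1..1} x *\<^sub>R iexp (t * x) \<partial>lborel) = F 1 - F (-1)"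
  proof (rule integral_FTC_Icc)
    show "continuous_on {-1..1} (\<lambda>x. iexp (t * x))" by (intro continuous_intros)
  qed (use F in simp_all)
  have char_eq: "char unif t = (\<integral>x. indicator {-1..1} x *\<^sub>R iexp (t * x) \<partial>lborel) / 2"
  proof -
    have "(1 / 2 :: ennreal) = ennreal (1 / 2)"
      using divide_ennreal[of 1 2] by simp
    then have unif: "unif = density lborel (\<lambda>x. ennreal (indicator {-1..1} x / 2))"
      unfolding unif_def uniform_measure_def by (intro density_cong AE_I2) (auto simp: indicator_def)
    have "char unif t = (\<integral>x. (indicator {-1..1} x / 2) *\<^sub>R iexp (t * x) \<partial>lborel)"
      unfolding char_def by (subst unif, subst integral_density) auto
    also have "\<dots> = (\<integral>x. (indicator {-1..1} x *\<^sub>R iexp (t * x)) / 2 \<partial>lborel)"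
      by (intro Bochner_Integration.integral_cong refl) (simp add: scaleR_conv_of_real)
    finally show ?thesis by simp
  qed
  have "norm (F x) = 1 / \<bar>t\<bar>" for x by (simp add: F_def norm_divide norm_mult)
  then have "norm (F 1 - F (-1)) \<le> 1 / \<bar>t\<bar> + 1 / \<bar>t\<bar>"
    by (metis norm_triangle_ineq4)
  then have "norm (char unif t) \<le> 1 / \<bar>t\<bar>" unfolding char_eq int_F by (simp add: norm_divide)
  also have "\<dots> \<le> 1 / 2" using assms by (intro divide_left_mono) auto
  finally show ?thesis .
qed

abbreviation cube_measure :: "(nat \<Rightarrow> real) measure" where
  "cube_measure \<equiv> \<Pi>\<^sub>M j\<in>UNIV. unif"

interpretation cube: product_prob_space "\<lambda>_::nat. unif" UNIV
  by (rule product_prob_spaceI) (rule prob_space_unif)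

lemma AE_cube: "AE g in cube_measure. \<forall>j. \<bar>g j\<bar> \<le> 1"
  unfolding AE_all_countable
proof
  fix j :: nat
  show "AE g in cube_measure. \<bar>g j\<bar> \<le> 1"
    by (rule AE_PiM_component[where P = "\<lambda>x. \<bar>x\<bar> \<le> 1"])
      (use AE_unif in \<open>auto simp: prob_space_unif abs_le_iff elim: eventually_mono\<close>)
qed

text \<open>By independence the integral over finitely many coordinates is a product of
  characteristic functions: one factor is at most one half and the others at most 1. A single large
  coordinate therefore suffices, whatever the rest.\<close>

lemma integral_cube_le:
  fixes x :: "nat \<Rightarrow> real"
  assumes sums: "AE g in cube_measure. summable (\<lambda>j. g j * x j)" and i: "2 \<le> \<bar>x i\<bar>"
  shows "norm (\<integral>g. iexp (\<Sum>j. g j * x j) \<partial>cube_measure) \<le> 1 / 2"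
proof -
  have fin: "norm (\<integral>g. iexp (\<Sum>j<J. g j * x j) \<partial>cube_measure) \<le> 1 / 2" if "i < J" for J
  proof -
    let ?PJ = "\<Pi>\<^sub>M j\<in>{..<J}. unif"
    have "(\<integral>g. iexp (\<Sum>j<J. g j * x j) \<partial>cube_measure) =
        (\<integral>g. (\<Prod>j\<in>{..<J}. iexp (x j * restrict g {..<J} j)) \<partial>cube_measure)"
      by (intro Bochner_Integration.integral_cong refl)
        (simp add: exp_sum[symmetric] sum_distrib_left mult_ac)
    also have "\<dots> = (\<integral>g. (\<Prod>j\<in>{..<J}. iexp (x j * g j)) \<partial>distr cube_measure ?PJ (\<lambda>g. restrict g {..<J}))"
      by (subst integral_distr) (auto intro!: measurable_restrict_subset)
    also have "distr cube_measure ?PJ (\<lambda>g. restrict g {..<J}) = ?PJ"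
      by (rule cube.distr_PiM_restrict_finite) auto
    also have "(\<integral>g. (\<Prod>j\<in>{..<J}. iexp (x j * g j)) \<partial>?PJ) = (\<Prod>j\<in>{..<J}. \<integral>t. iexp (x j * t) \<partial>unif)"
    proof (rule cube.product_integral_prod)
      show "integrable unif (\<lambda>t. iexp (x j * t))" for j
        by (rule finite_measure.integrable_const_bound[OF prob_space.finite_measure[OF prob_space_unif], where B = 1]) auto
    qed simp
    also have "\<dots> = (\<Prod>j\<in>{..<J}. char unif (x j))" by (simp add: char_def)
    also have "\<dots> = char unif (x i) * (\<Prod>j\<in>{..<J} - {i}. char unif (x j))"
      using that by (intro prod.remove) auto
    also have "norm \<dots> \<le> 1 / 2 * 1"
      unfolding norm_mult
    proof (intro mult_mono)
      interpret real_distribution unif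
        by (intro real_distribution.intro real_distribution_axioms.intro prob_space_unif) (auto simp: unif_def)
      show "norm (\<Prod>j\<in>{..<J} - {i}. char unif (x j)) \<le> 1"
        unfolding prod_norm[symmetric] by (intro prod_le_1 conjI cmod_char_le_1) auto
      show "norm (char unif (x i)) \<le> 1 / 2" by (rule char_unif_le[OF i])
    qed simp_all
    finally show ?thesis by simp
  qed
  have "(\<lambda>J. \<integral>g. iexp (\<Sum>j<J. g j * x j) \<partial>cube_measure) \<longlonglongrightarrow> (\<integral>g. iexp (\<Sum>j. g j * x j) \<partial>cube_measure)"
  proof (rule integral_dominated_convergence[where w = "\<lambda>_. 1"])
    show "AE g in cube_measure. (\<lambda>J. iexp (\<Sum>j<J. g j * x j)) \<longlonglongrightarrow> iexp (\<Sum>j. g j * x j)"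
      using sums
    proof eventually_elim
      case (elim g)
      from summable_LIMSEQ[OF this] show ?case by (intro tendsto_intros)
    qed
  qed auto
  then have "(\<lambda>J. norm (\<integral>g. iexp (\<Sum>j<J. g j * x j) \<partial>cube_measure)) \<longlonglongrightarrow> norm (\<integral>g. iexp (\<Sum>j. g j * x j) \<partial>cube_measure)"
    by (rule tendsto_norm)
  then show ?thesis
    by (rule LIMSEQ_le_const2) (use fin in \<open>auto intro!: exI[of _ "Suc i"]\<close>)
qed

text \<open>Stated for measures rather than processes, so that the constant sequence
  \<open>\<nu>\<close> is an instance too; tightness of the limit is then a special case.\<close>

locale tempered_convergence =
  fixes \<mu> :: "nat \<Rightarrow> 'a::euclidean_space tempered measure" and \<nu> :: "'a tempered measure"
  assumes prob_\<mu>: "\<And>n. prob_space (\<mu> n)" and prob_\<nu>: "prob_space \<nu>"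
    and sets_\<mu> [simp, measurable_cong]: "\<And>n. sets (\<mu> n) = sets cylindrical"
    and sets_\<nu> [simp, measurable_cong]: "sets \<nu> = sets cylindrical"
    and char_tendsto: "\<And>\<phi>. (\<lambda>n. \<integral>v. iexp (pairing v \<phi>) \<partial>\<mu> n) \<longlonglongrightarrow> (\<integral>v. iexp (pairing v \<phi>) \<partial>\<nu>)"
begin

declare measurable_pairing [measurable]

lemma tight_rapidly_decreasing:
  fixes \<psi> :: "nat \<Rightarrow> 'a schwartz" and b :: "nat \<Rightarrow> real"
  assumes summ: "\<And>m. summable (\<lambda>j. \<bar>b j\<bar> * schwartz_norm m (\<psi> j))" and \<epsilon>: "0 < \<epsilon>"
  obtains \<kappa> n0 where "0 < \<kappa>"
    "\<And>n. n0 \<le> n \<Longrightarrow> measure (\<mu> n) {v. \<exists>i. 2 \<le> \<kappa> * \<bar>b i * pairing v (\<psi> i)\<bar>} \<le> \<epsilon>"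
proof -
  define S where "S v g = (\<Sum>j. g j * (b j * pairing v (\<psi> j)))" for v and g :: "nat \<Rightarrow> real"
  have S_meas [measurable]: "(\<lambda>(v, g). S v g) \<in> borel_measurable (cylindrical \<Otimes>\<^sub>M cube_measure)"
    unfolding S_def split_beta by measurable
  \<comment> \<open>For bounded \<open>g\<close> the series is the pairing with one test function,
    independent of \<open>v\<close>; only so does \<open>char_tendsto\<close> apply.\<close>
  have represent: "\<exists>\<phi>. \<forall>v. (\<lambda>j. g j * (b j * pairing v (\<psi> j))) sums pairing v \<phi>" if g: "\<forall>j. \<bar>g j\<bar> \<le> 1" for g
  proof -
    have "summable (\<lambda>j. schwartz_norm m ((g j * b j) *\<^sub>R \<psi> j))" for m
    proof (rule summable_comparison_test'[OF summ])
      fix j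
      have "schwartz_norm m ((g j * b j) *\<^sub>R \<psi> j) \<le> \<bar>g j\<bar> * (\<bar>b j\<bar> * schwartz_norm m (\<psi> j))"
        using schwartz_norm_scaleR_le[of m "g j * b j" "\<psi> j"] by (simp add: abs_mult mult.assoc)
      also have "\<dots> \<le> 1 * (\<bar>b j\<bar> * schwartz_norm m (\<psi> j))"
        using g by (intro mult_right_mono) auto
      finally show "norm (schwartz_norm m ((g j * b j) *\<^sub>R \<psi> j)) \<le> \<bar>b j\<bar> * schwartz_norm m (\<psi> j)" by simp
    qed
    then obtain \<phi> where "\<And>v. (\<lambda>j. pairing v ((g j * b j) *\<^sub>R \<psi> j)) sums pairing v \<phi>"
      by (rule schwartz_series) blast
    then show ?thesis
      by (intro exI[of _ \<phi>]) (simp add: linear_scale[OF linear_pairing] mult.assoc)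
  qed
  define I where "I M \<kappa> = (\<integral>g. (\<integral>v. iexp (\<kappa> * S v g) \<partial>M) \<partial>cube_measure)" for M and \<kappa> :: real
  have inner_meas: "(\<lambda>g. \<integral>v. iexp (\<kappa> * S v g) \<partial>M) \<in> borel_measurable cube_measure"
    if "prob_space M" "sets M = sets cylindrical" for M \<kappa>
  proof -
    interpret M: prob_space M by fact
    note that(2)[measurable_cong]
    show ?thesis by measurable
  qed
  have inner_le: "norm (\<integral>v. iexp (\<kappa> * S v g) \<partial>M) \<le> 1" if "prob_space M" "sets M = sets cylindrical" for M \<kappa> g
  proof -
    interpret M: prob_space M by fact
    have "norm (\<integral>v. iexp (\<kappa> * S v g) \<partial>M) \<le> (\<integral>v. norm (iexp (\<kappa> * S v g)) \<partial>M)"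
      by (rule integral_norm_bound)
    also have "\<dots> = 1" by (simp add: M.prob_space)
    finally show ?thesis .
  qed
  have I_tendsto: "(\<lambda>n. I (\<mu> n) \<kappa>) \<longlonglongrightarrow> I \<nu> \<kappa>" for \<kappa>
    unfolding I_def
  proof (rule integral_dominated_convergence[where w = "\<lambda>_. 1"])
    show "AE g in cube_measure. (\<lambda>n. \<integral>v. iexp (\<kappa> * S v g) \<partial>\<mu> n) \<longlonglongrightarrow> (\<integral>v. iexp (\<kappa> * S v g) \<partial>\<nu>)"
      using AE_cube
    proof eventually_elim
      case (elim g)
      from represent[OF elim] obtain \<phi> where "\<And>v. S v g = pairing v \<phi>" unfolding S_def by (metis sums_unique)
      then have "\<kappa> * S v g = pairing v (\<kappa> *\<^sub>R \<phi>)" for v by (simp add: linear_scale[OF linear_pairing])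
      then show ?case using char_tendsto[of "\<kappa> *\<^sub>R \<phi>"] by simp
    qed
    show "AE g in cube_measure. norm (\<integral>v. iexp (\<kappa> * S v g) \<partial>\<mu> n) \<le> 1" for n
      by (intro AE_I2 inner_le prob_\<mu> sets_\<mu>)
  qed (rule inner_meas prob_\<mu> prob_\<nu> sets_\<mu> sets_\<nu> integrable_const cube.P.finite_measure_axioms | simp)+
  \<comment> \<open>As the scale tends to 0, the integrand tends to 1 for every real value of
    \<open>S v g\<close>, including the default value where the series diverges.\<close>
  have I_one: "(\<lambda>m. I \<nu> (inverse (real (Suc m)))) \<longlonglongrightarrow> 1"
  proof -
    interpret \<nu>: prob_space \<nu> by (rule prob_\<nu>)
    have "(\<lambda>m. I \<nu> (inverse (real (Suc m)))) \<longlonglongrightarrow> (\<integral>g. (\<integral>v. 1 \<partial>\<nu>) \<partial>cube_measure)"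
      unfolding I_def
    proof (rule integral_dominated_convergence[where w = "\<lambda>_. 1"])
      show "AE g in cube_measure. (\<lambda>m. \<integral>v. iexp (inverse (real (Suc m)) * S v g) \<partial>\<nu>) \<longlonglongrightarrow> (\<integral>v. 1 \<partial>\<nu>)"
      proof (intro AE_I2 integral_dominated_convergence[where w = "\<lambda>_. 1"])
        fix g v
        have "(\<lambda>m. iexp (inverse (real (Suc m)) * S v g)) \<longlonglongrightarrow> iexp (0 * S v g)"
          by (intro tendsto_intros LIMSEQ_inverse_real_of_nat)
        then show "(\<lambda>m. iexp (inverse (real (Suc m)) * S v g)) \<longlonglongrightarrow> 1" by simp
      qed (auto simp: S_def)
      show "AE g in cube_measure. norm (\<integral>v. iexp (inverse (real (Suc m)) * S v g) \<partial>\<nu>) \<le> 1" for m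
        by (intro AE_I2 inner_le prob_\<nu> sets_\<nu>)
    qed (rule inner_meas prob_\<nu> sets_\<nu> | simp)+
    then show ?thesis by (simp add: \<nu>.prob_space cube.P.prob_space)
  qed
  \<comment> \<open>On the event the average over \<open>g\<close> has modulus at most one half,
    elsewhere at most 1. So half the probability is at most
    \<open>1 - Re (I M \<kappa>)\<close>.\<close>
  have key: "measure M {v. \<exists>i. 2 \<le> \<kappa> * \<bar>b i * pairing v (\<psi> i)\<bar>} \<le> 2 * (1 - Re (I M \<kappa>))"
    if M: "prob_space M" "sets M = sets cylindrical" and \<kappa>: "0 < \<kappa>" for M \<kappa>
  proof -
    interpret M: prob_space M by (rule M(1))
    interpret MP: pair_prob_space M cube_measure ..
    note M(2)[measurable_cong]
    have spM: "space M = UNIV" using sets_eq_imp_space_eq[OF M(2)] by simp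
    let ?E = "{v. \<exists>i. 2 \<le> \<kappa> * \<bar>b i * pairing v (\<psi> i)\<bar>}"
    let ?h = "\<lambda>v. \<integral>g. iexp (\<kappa> * S v g) \<partial>cube_measure"
    have "Measurable.pred M (\<lambda>v. \<exists>i. 2 \<le> \<kappa> * \<bar>b i * pairing v (\<psi> i)\<bar>)" by measurable
    then have E: "?E \<in> sets M" by (simp add: pred_def spM)
    have int: "integrable (M \<Otimes>\<^sub>M cube_measure) (\<lambda>(v, g). iexp (\<kappa> * S v g))"
      by (rule MP.P.integrable_const_bound[where B = 1]) (auto simp: split_beta)
    \<comment> \<open>Convergence in \<open>n\<close> needs \<open>g\<close> fixed in the inner
      integral, whereas the estimate of the event needs \<open>v\<close> fixed.\<close>
    have Fubini: "I M \<kappa> = (\<integral>v. ?h v \<partial>M)"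
      unfolding I_def using MP.Fubini_integral[OF int] by simp
    have h_meas: "?h \<in> borel_measurable M" by measurable
    have h_le: "norm (?h v) \<le> 1" for v
    proof -
      have "norm (?h v) \<le> (\<integral>g. norm (iexp (\<kappa> * S v g)) \<partial>cube_measure)" by (rule integral_norm_bound)
      also have "\<dots> = 1" by (simp add: cube.P.prob_space)
      finally show ?thesis .
    qed
    have h_int: "integrable M ?h"
      by (rule M.integrable_const_bound[OF AE_I2[OF h_le] h_meas])
    have h_half: "norm (?h v) \<le> 1 / 2" if v: "v \<in> ?E" for v
    proof -
      obtain i where i: "2 \<le> \<bar>\<kappa> * (b i * pairing v (\<psi> i))\<bar>" using v \<kappa> by (auto simp: abs_mult)
      have summ: "AE g in cube_measure. summable (\<lambda>j. g j * (\<kappa> * (b j * pairing v (\<psi> j))))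
        \<and> (\<Sum>j. g j * (\<kappa> * (b j * pairing v (\<psi> j)))) = \<kappa> * S v g"
        using AE_cube
      proof eventually_elim
        case (elim g)
        from represent[OF elim] have "summable (\<lambda>j. g j * (b j * pairing v (\<psi> j)))" by (auto simp: sums_iff)
        from summable_mult[OF this, of \<kappa>] suminf_mult[OF this, of \<kappa>] show ?case
          by (simp add: S_def mult_ac)
      qed
      have "(\<integral>g. iexp (\<Sum>j. g j * (\<kappa> * (b j * pairing v (\<psi> j)))) \<partial>cube_measure) = ?h v"
      proof (rule integral_cong_AE)
        show "AE g in cube_measure. iexp (\<Sum>j. g j * (\<kappa> * (b j * pairing v (\<psi> j)))) = iexp (\<kappa> * S v g)"
          using summ by eventually_elim (simp only:)
      qed (auto simp: S_def)
      moreover have "norm (\<integral>g. iexp (\<Sum>j. g j * (\<kappa> * (b j * pairing v (\<psi> j)))) \<partial>cube_measure) \<le> 1 / 2"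
        by (rule integral_cube_le[where i = i and x = "\<lambda>j. \<kappa> * (b j * pairing v (\<psi> j))", OF _ i]) (use summ in \<open>auto elim: eventually_mono\<close>)
      ultimately show ?thesis by simp
    qed
    have "measure M ?E / 2 = (\<integral>v. indicator ?E v / 2 \<partial>M)" using E by simp
    also have "\<dots> \<le> (\<integral>v. 1 - Re (?h v) \<partial>M)"
    proof (rule integral_mono)
      have "integrable M (indicator ?E :: 'a tempered \<Rightarrow> real)"
        by (rule integrable_real_indicator[OF E]) (simp add: M.emeasure_eq_measure)
      then show "integrable M (\<lambda>v. indicator ?E v / 2 :: real)" by simp
      show "integrable M (\<lambda>v. 1 - Re (?h v))" using h_int by auto
      show "indicator ?E v / 2 \<le> 1 - Re (?h v)" for v
      proof (cases "v \<in> ?E")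
        case True
        have "Re (?h v) \<le> 1 / 2" by (rule order_trans[OF complex_Re_le_cmod h_half[OF True]])
        with True show ?thesis by simp
      next
        case False
        have "Re (?h v) \<le> 1" by (rule order_trans[OF complex_Re_le_cmod h_le])
        with False show ?thesis by simp
      qed
    qed
    also have "\<dots> = 1 - Re (I M \<kappa>)" using h_int by (simp add: Fubini M.prob_space)
    finally show ?thesis by simp
  qed
  have "(\<lambda>m. Re (I \<nu> (inverse (real (Suc m))))) \<longlonglongrightarrow> Re 1" by (intro tendsto_Re I_one)
  then have "\<forall>\<^sub>F m in sequentially. 1 - \<epsilon> / 2 < Re (I \<nu> (inverse (real (Suc m))))"
    using \<epsilon> by (intro order_tendstoD) auto
  then obtain m where m: "1 - \<epsilon> / 2 < Re (I \<nu> (inverse (real (Suc m))))"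
    by (auto simp: eventually_sequentially)
  \<comment> \<open>The scale is chosen from the limit law alone; \<open>n0\<close> comes afterwards
    from convergence at this fixed scale.\<close>
  define \<kappa> where "\<kappa> = inverse (real (Suc m))"
  have "(\<lambda>n. Re (I (\<mu> n) \<kappa>)) \<longlonglongrightarrow> Re (I \<nu> \<kappa>)" by (intro tendsto_Re I_tendsto)
  then have "\<forall>\<^sub>F n in sequentially. 1 - \<epsilon> / 2 < Re (I (\<mu> n) \<kappa>)"
    using m unfolding \<kappa>_def by (rule order_tendstoD)
  then obtain n0 where n0: "\<And>n. n0 \<le> n \<Longrightarrow> 1 - \<epsilon> / 2 < Re (I (\<mu> n) \<kappa>)"
    by (auto simp: eventually_sequentially)
  show ?thesis
  proof (rule that)
    show \<kappa>: "0 < \<kappa>" by (simp add: \<kappa>_def)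
    show "measure (\<mu> n) {v. \<exists>i. 2 \<le> \<kappa> * \<bar>b i * pairing v (\<psi> i)\<bar>} \<le> \<epsilon>" if "n0 \<le> n" for n
    proof -
      have "2 * (1 - Re (I (\<mu> n) \<kappa>)) \<le> \<epsilon>" using n0[OF that] by simp
      with key[OF prob_\<mu> sets_\<mu> \<kappa>, of n] show ?thesis by (rule order_trans)
    qed
  qed
qed

text \<open>One \<open>k\<close> serves both as factor and as exponent, so that failure of all
  bounds is a single sequence of failures, along which the index of the law tends to
  infinity.\<close>

lemma tight:
  fixes \<psi> :: "nat \<Rightarrow> 'a schwartz" and w :: "nat \<Rightarrow> real"
  assumes w: "\<And>j. 1 \<le> w j" "summable (\<lambda>j. inverse (w j))"
    and \<psi>: "\<And>m. \<exists>C p. 0 \<le> C \<and> (\<forall>j. schwartz_norm m (\<psi> j) \<le> C * w j ^ p)" and \<epsilon>: "0 < \<epsilon>"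
  shows "\<exists>k n0. \<forall>n\<ge>n0. measure (\<mu> n) {v. \<exists>j. real k * w j ^ k < \<bar>pairing v (\<psi> j)\<bar>} \<le> \<epsilon>"
proof (rule ccontr)
  assume contra: "\<not> ?thesis"
  have w0: "0 < w j" for j using w(1)[of j] by linarith
  \<comment> \<open>Since the failure is a strict inequality, finitely many coordinates already
    exhibit it. This leaves \<open>b\<close> free to decrease rapidly.\<close>
  define A where "A k J = {v. \<exists>j<J. real k * w j ^ k < \<bar>pairing v (\<psi> j)\<bar>}" for k J
  have sp: "space (\<mu> n) = UNIV" for n using sets_eq_imp_space_eq[OF sets_\<mu>] by simp
  have A_sets: "A k J \<in> sets (\<mu> n)" for k J n
  proof -
    have "Measurable.pred (\<mu> n) (\<lambda>v. \<exists>j\<in>{..<J}. real k * w j ^ k < \<bar>pairing v (\<psi> j)\<bar>)" by measurable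
    then show ?thesis by (simp add: pred_def sp A_def Bex_def)
  qed
  have "\<exists>n J. k \<le> n \<and> \<epsilon> < measure (\<mu> n) (A k J)" for k
  proof -
    obtain n where n: "k \<le> n" "\<epsilon> < measure (\<mu> n) {v. \<exists>j. real k * w j ^ k < \<bar>pairing v (\<psi> j)\<bar>}"
      using contra by (meson not_le)
    interpret prob_space "\<mu> n" by (rule prob_\<mu>)
    have "incseq (A k)"
      by (auto simp: incseq_def A_def) (meson order_less_le_trans)
    then have "(\<lambda>J. measure (\<mu> n) (A k J)) \<longlonglongrightarrow> measure (\<mu> n) (\<Union>J. A k J)"
      by (intro finite_Lim_measure_incseq) (use A_sets in auto)
    moreover have "(\<Union>J. A k J) = {v. \<exists>j. real k * w j ^ k < \<bar>pairing v (\<psi> j)\<bar>}" by (auto simp: A_def)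
    ultimately have "\<forall>\<^sub>F J in sequentially. \<epsilon> < measure (\<mu> n) (A k J)"
      using n(2) by (metis order_tendstoD(1))
    then show ?thesis using n(1) by (auto simp: eventually_sequentially)
  qed
  then obtain N J where NJ: "\<And>k. k \<le> N k" "\<And>k. \<epsilon> < measure (\<mu> (N k)) (A k (J k))" by metis
  \<comment> \<open>rapidly decreasing, yet at least \<open>w\<^sub>j\<^sup>-\<^sup>k\<close> on the finitely many coordinates that violate the \<open>k\<close>-th bound\<close>
  define b where "b j = (if \<exists>k. j < J k then inverse (w j) ^ (LEAST k. j < J k) else 0)" for j
  have b_nonneg: "0 \<le> b j" for j using w0[of j] by (simp add: b_def)
  have b_ge: "inverse (w j) ^ k \<le> b j" if "j < J k" for j k
  proof -
    have "(LEAST k. j < J k) \<le> k" by (rule Least_le[of "\<lambda>k. j < J k", OF that])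
    then have "inverse (w j) ^ k \<le> inverse (w j) ^ (LEAST k. j < J k)"
      using w(1)[of j] w0[of j] by (intro power_decreasing) (auto simp: inverse_le_1_iff)
    then show ?thesis using that by (auto simp: b_def)
  qed
  \<comment> \<open>Beyond \<open>J 0, ..., J p\<close> the exponent used by \<open>b\<close>
    exceeds \<open>p\<close>, which leaves one factor \<open>inverse (w j)\<close> for
    summability.\<close>
  have b_decay: "b j * w j ^ p \<le> inverse (w j)" if "\<And>k. k \<le> p \<Longrightarrow> J k \<le> j" for j p
  proof (cases "\<exists>k. j < J k")
    case True
    define l where "l = (LEAST k. j < J k)"
    have "j < J l" using True unfolding l_def by (rule LeastI_ex)
    then have "Suc p \<le> l" using that[of l] by (meson not_less_eq_eq leD)
    then have "inverse (w j) ^ l \<le> inverse (w j) ^ Suc p"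
      using w(1)[of j] w0[of j] by (intro power_decreasing) (auto simp: inverse_le_1_iff)
    then have "inverse (w j) ^ l * w j ^ p \<le> inverse (w j) ^ Suc p * w j ^ p"
      using w0[of j] by (intro mult_right_mono) auto
    also have "\<dots> = inverse (w j)" using w0[of j] by (simp add: power_inverse field_simps)
    finally show ?thesis using True by (simp add: b_def l_def)
  next
    case False
    then show ?thesis using w0[of j] by (simp add: b_def)
  qed
  have "summable (\<lambda>j. \<bar>b j\<bar> * schwartz_norm m (\<psi> j))" for m
  proof -
    obtain C p where C: "0 \<le> C" "\<And>j. schwartz_norm m (\<psi> j) \<le> C * w j ^ p" using \<psi> by blast
    have "norm (\<bar>b j\<bar> * schwartz_norm m (\<psi> j)) \<le> C * inverse (w j)" if j: "Max (J ` {..p}) \<le> j" for j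
    proof -
      have "\<bar>b j\<bar> * schwartz_norm m (\<psi> j) \<le> b j * (C * w j ^ p)"
        using b_nonneg[of j] by (simp add: mult_left_mono C)
      also have "\<dots> = C * (b j * w j ^ p)" by simp
      also have "\<dots> \<le> C * inverse (w j)"
        using j by (intro mult_left_mono b_decay C) (auto simp: Max_le_iff)
      finally show ?thesis using b_nonneg[of j] by simp
    qed
    then show ?thesis
      by (intro summable_comparison_test'[OF summable_mult[OF w(2)], where N = "Max (J ` {..p})"]) auto
  qed
  from tight_rapidly_decreasing[OF this \<epsilon>] obtain \<kappa> n0 where \<kappa>: "0 < \<kappa>"
    and n0: "\<And>n. n0 \<le> n \<Longrightarrow> measure (\<mu> n) {v. \<exists>i. 2 \<le> \<kappa> * \<bar>b i * pairing v (\<psi> i)\<bar>} \<le> \<epsilon>" by blast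
  obtain k0 where k0: "2 / \<kappa> \<le> real k0" using real_arch_simple by blast
  \<comment> \<open>\<open>k0\<close> makes the violation exceed the threshold 2 after scaling by
    \<open>\<kappa>\<close>, and \<open>n0\<close> puts \<open>N k\<close> in the range where the
    event is rare.\<close>
  define k where "k = max n0 k0"
  have k: "2 \<le> \<kappa> * real k" "n0 \<le> N k"
  proof -
    have "2 \<le> \<kappa> * real k0" using k0 \<kappa> by (simp add: field_simps)
    also have "\<dots> \<le> \<kappa> * real k" using \<kappa> by (intro mult_left_mono) (auto simp: k_def)
    finally show "2 \<le> \<kappa> * real k" .
    show "n0 \<le> N k" using NJ(1)[of k] by (simp add: k_def)
  qed
  let ?E = "{v. \<exists>i. 2 \<le> \<kappa> * \<bar>b i * pairing v (\<psi> i)\<bar>}"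
  have "A k (J k) \<subseteq> ?E"
  proof
    fix v assume "v \<in> A k (J k)"
    then obtain j where j: "j < J k" "real k * w j ^ k < \<bar>pairing v (\<psi> j)\<bar>" by (auto simp: A_def)
    have "2 \<le> \<kappa> * (inverse (w j) ^ k * (real k * w j ^ k))"
      using k(1) w0[of j] by (simp add: power_inverse field_simps)
    also have "\<dots> \<le> \<kappa> * (b j * \<bar>pairing v (\<psi> j)\<bar>)"
      using \<kappa> j b_ge[OF j(1)] b_nonneg[of j] w0[of j] by (intro mult_left_mono mult_mono) auto
    also have "\<dots> = \<kappa> * \<bar>b j * pairing v (\<psi> j)\<bar>" using b_nonneg[of j] by (simp add: abs_mult)
    finally show "v \<in> ?E" by blast
  qed
  moreover have "?E \<in> sets (\<mu> (N k))"
  proof -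
    have "Measurable.pred (\<mu> (N k)) (\<lambda>v. \<exists>i. 2 \<le> \<kappa> * \<bar>b i * pairing v (\<psi> i)\<bar>)" by measurable
    then show ?thesis by (simp add: pred_def sp)
  qed
  ultimately have "measure (\<mu> (N k)) (A k (J k)) \<le> measure (\<mu> (N k)) ?E"
    using prob_space.finite_measure[OF prob_\<mu>] by (intro finite_measure.finite_measure_mono) auto
  with n0[OF k(2)] NJ(2)[of k] show False by linarith
qed

end

section \<open>Continuity theorem on tempered distributions\<close>

text \<open>The phase covers sines, and the zero test function gives constants; the product-to-sum
  formula makes the class an algebra.\<close>

inductive trig_poly :: "('a::euclidean_space tempered \<Rightarrow> real) \<Rightarrow> bool" where
  cos: "trig_poly (\<lambda>v. c * cos (pairing v \<phi> + \<theta>))"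
| add: "trig_poly f \<Longrightarrow> trig_poly g \<Longrightarrow> trig_poly (\<lambda>v. f v + g v)"

lemma trig_poly_mult_cos: "trig_poly g \<Longrightarrow> trig_poly (\<lambda>v. (c * cos (pairing v \<phi> + \<theta>)) * g v)"
proof (induction rule: trig_poly.induct)
  case (cos d \<phi>' \<theta>')
  have eq: "(c * cos (pairing v \<phi> + \<theta>)) * (d * cos (pairing v \<phi>' + \<theta>')) =
      (c * d / 2) * cos (pairing v (\<phi> - \<phi>') + (\<theta> - \<theta>')) + (c * d / 2) * cos (pairing v (\<phi> + \<phi>') + (\<theta> + \<theta>'))" for v
  proof -
    have "pairing v (\<phi> - \<phi>') + (\<theta> - \<theta>') = (pairing v \<phi> + \<theta>) - (pairing v \<phi>' + \<theta>')"
      "pairing v (\<phi> + \<phi>') + (\<theta> + \<theta>') = (pairing v \<phi> + \<theta>) + (pairing v \<phi>' + \<theta>')"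
      by (simp_all add: linear_diff[OF linear_pairing] linear_add[OF linear_pairing])
    moreover have "(c * cos A) * (d * cos B) = (c * d / 2) * cos (A - B) + (c * d / 2) * cos (A + B)" for A B
    proof -
      have "(c * cos A) * (d * cos B) = (c * d) * (cos A * cos B)" by simp
      also have "\<dots> = (c * d) * ((cos (A - B) + cos (A + B)) / 2)" by (simp only: cos_times_cos)
      finally show ?thesis by (simp add: distrib_left add_divide_distrib)
    qed
    ultimately show ?thesis by (simp only:)
  qed
  show ?case unfolding eq by (intro trig_poly.intros)
next
  case (add f g)
  from trig_poly.add[OF add.IH] show ?case by (simp add: distrib_left)
qed

lemma trig_poly_mult: "trig_poly f \<Longrightarrow> trig_poly g \<Longrightarrow> trig_poly (\<lambda>v. f v * g v)"
proof (induction rule: trig_poly.induct)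
  case (cos c \<phi> \<theta>)
  then show ?case by (rule trig_poly_mult_cos)
next
  case (add f h)
  from trig_poly.add[OF add.IH(1)[OF add.prems] add.IH(2)[OF add.prems]] show ?case
    by (simp add: distrib_right)
qed

lemma trig_poly_const: "trig_poly (\<lambda>v. c)"
  using trig_poly.cos[of c 0 0] by (simp add: linear_0[OF linear_pairing])

lemma trig_poly_sin: "trig_poly (\<lambda>v. sin (pairing v \<phi> * r))"
proof -
  have "sin (pairing v \<phi> * r) = 1 * cos (pairing v (r *\<^sub>R \<phi>) + - (pi / 2))" for v
    by (simp add: linear_scale[OF linear_pairing] cos_diff mult.commute)
  then show ?thesis by (simp only: trig_poly.cos)
qed

text \<open>Integrability is part of the induction because the integral of a sum splits only with
  it.\<close>

lemma (in tempered_convergence) trig_poly_tendsto: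
  assumes "trig_poly f"
  shows "(\<forall>M. prob_space M \<and> sets M = sets cylindrical \<longrightarrow> integrable M f) \<and>
    (\<lambda>n. \<integral>v. f v \<partial>\<mu> n) \<longlonglongrightarrow> (\<integral>v. f v \<partial>\<nu>)"
  using assms
proof (induction rule: trig_poly.induct)
  case (cos c \<phi> \<theta>)
  have iexp_int: "integrable M (\<lambda>v. iexp (pairing v \<phi>))" if "prob_space M" "sets M = sets cylindrical" for M
  proof -
    interpret M: prob_space M by fact
    note that(2)[measurable_cong]
    show ?thesis by (rule M.integrable_const_bound[where B = 1]) auto
  qed
  have eq: "c * cos (pairing v \<phi> + \<theta>) = c * Re (cis \<theta> * iexp (pairing v \<phi>))" for v
    by (simp add: cis_conv_exp[symmetric] cis_mult add.commute)
  have val: "(\<integral>v. c * cos (pairing v \<phi> + \<theta>) \<partial>M) = c * Re (cis \<theta> * (\<integral>v. iexp (pairing v \<phi>) \<partial>M))"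
    if "prob_space M" "sets M = sets cylindrical" for M
  proof -
    have int: "integrable M (\<lambda>v. cis \<theta> * iexp (pairing v \<phi>))"
      by (intro integrable_mult_right impI iexp_int that)
    have "(\<integral>v. c * Re (cis \<theta> * iexp (pairing v \<phi>)) \<partial>M) = c * (\<integral>v. Re (cis \<theta> * iexp (pairing v \<phi>)) \<partial>M)"
      by (rule integral_mult_right_zero)
    also have "\<dots> = c * Re (\<integral>v. cis \<theta> * iexp (pairing v \<phi>) \<partial>M)"
      by (simp only: integral_Re[OF int])
    also have "\<dots> = c * Re (cis \<theta> * (\<integral>v. iexp (pairing v \<phi>) \<partial>M))"
      by (simp only: integral_mult_right_zero)
    finally show ?thesis unfolding eq .
  qed
  have "integrable M (\<lambda>v. c * cos (pairing v \<phi> + \<theta>))" if "prob_space M" "sets M = sets cylindrical" for M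
    unfolding eq using iexp_int[OF that] by (intro integrable_mult_right impI integrable_Re) auto
  moreover have "(\<lambda>n. c * Re (cis \<theta> * (\<integral>v. iexp (pairing v \<phi>) \<partial>\<mu> n))) \<longlonglongrightarrow> c * Re (cis \<theta> * (\<integral>v. iexp (pairing v \<phi>) \<partial>\<nu>))"
    by (intro tendsto_intros char_tendsto)
  ultimately show ?case by (simp only: val[OF prob_\<mu> sets_\<mu>] val[OF prob_\<nu> sets_\<nu>]) blast
next
  case (add f g)
  then have "integrable M f" "integrable M g" if "prob_space M" "sets M = sets cylindrical" for M
    using that by auto
  then show ?case using add prob_\<mu> prob_\<nu> by (auto intro: tendsto_add)
qed

section \<open>Polynomial approximation on the cube\<close>

inductive coord_poly :: "((nat \<Rightarrow> real) \<Rightarrow> real) \<Rightarrow> bool" where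
  const: "coord_poly (\<lambda>z. c)"
| coord: "coord_poly (\<lambda>z. z i)"
| add: "coord_poly f \<Longrightarrow> coord_poly g \<Longrightarrow> coord_poly (\<lambda>z. f z + g z)"
| mult: "coord_poly f \<Longrightarrow> coord_poly g \<Longrightarrow> coord_poly (\<lambda>z. f z * g z)"

lemma trig_poly_coord_poly:
  assumes "coord_poly P"
  shows "trig_poly (\<lambda>v. P (\<lambda>j. sin (pairing v (\<psi> j) * r j)))"
  using assms by induction (auto intro: trig_poly_const trig_poly_sin trig_poly.add trig_poly_mult)

definition unit_cube :: "(nat \<Rightarrow> real) set" where
  "unit_cube = {z. \<forall>j. \<bar>z j\<bar> \<le> 1}"

lemma compact_cube: "compact unit_cube"
proof -
  have "compactin (product_topology (\<lambda>_. euclidean) UNIV) (PiE UNIV (\<lambda>_::nat. {-1..1::real}))"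
    unfolding compactin_PiE by (simp add: compactin_euclidean_iff)
  then have "compact (PiE UNIV (\<lambda>_::nat. {-1..1::real}))"
    by (simp add: euclidean_product_topology compactin_euclidean_iff)
  moreover have "PiE UNIV (\<lambda>_::nat. {-1..1::real}) = unit_cube"
    by (auto simp: unit_cube_def PiE_iff abs_le_iff minus_le_iff)
  ultimately show ?thesis by simp
qed

lemma coord_poly_dense:
  assumes "continuous_on unit_cube H" "0 < e"
  obtains P where "coord_poly P" "\<And>z. z \<in> unit_cube \<Longrightarrow> \<bar>H z - P z\<bar> < e"
proof -
  have "function_ring_on {P. coord_poly P} unit_cube"
  proof
    show "compact unit_cube" by (rule compact_cube)
    show "continuous_on unit_cube f" if "f \<in> {P. coord_poly P}" for f
    proof -
      have "coord_poly f" using that by simp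
      then show ?thesis
        by induction (auto intro!: continuous_intros continuous_on_subset[OF continuous_on_product_coordinates])
    qed
    show "\<exists>f\<in>{P. coord_poly P}. f x \<noteq> f y" if "x \<noteq> y" for x y
    proof -
      have "\<exists>i. x i \<noteq> y i" using that by (simp add: fun_eq_iff)
      then obtain i where "x i \<noteq> y i" ..
      then show ?thesis by (intro bexI[of _ "\<lambda>z. z i"]) (auto intro: coord_poly.coord)
    qed
  qed (auto intro: coord_poly.intros)
  from function_ring_on.Stone_Weierstrass_basic[OF this assms] show ?thesis using that by blast
qed

context tempered_convergence
begin

text \<open>Measurability is a hypothesis of its own: \<open>F\<close> is continuous for the strong
  topology, while the laws are defined on the cylindrical sigma-field.\<close>

lemma integral_tendsto:
  fixes F :: "'a tempered \<Rightarrow> real"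
  assumes F: "continuous_on UNIV F" "\<And>v. \<bar>F v\<bar> \<le> B" and meas: "F \<in> borel_measurable cylindrical"
  shows "(\<lambda>n. \<integral>v. F v \<partial>\<mu> n) \<longlonglongrightarrow> (\<integral>v. F v \<partial>\<nu>)"
proof -
  note meas[measurable]
  have B: "0 \<le> B" by (rule order_trans[OF abs_ge_zero F(2)])
  obtain \<psi> :: "nat \<Rightarrow> 'a schwartz" and c :: "nat \<Rightarrow> 'a tempered" and w :: "nat \<Rightarrow> real"
    where w: "\<And>j. 1 \<le> w j" and sw: "summable (\<lambda>j. inverse (w j))"
    and \<psi>: "\<And>m. \<exists>C p. 0 \<le> C \<and> (\<forall>j. schwartz_norm m (\<psi> j) \<le> C * w j ^ p)"
    and c: "\<And>k. \<exists>m C. 0 \<le> C \<and> (\<forall>j \<phi>. \<bar>pairing (c j) \<phi>\<bar> * w j ^ k \<le> C * schwartz_norm m \<phi>)"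
    and expand: "\<And>v \<phi>. (\<lambda>j. pairing (c j) \<phi> * pairing v (\<psi> j)) sums pairing v \<phi>"
    by (rule schwartz_decomposition) blast
  have w0: "0 < w j" for j using w[of j] by linarith
  \<comment> \<open>Replacing \<open>F\<close> by the approximation costs \<open>e\<close> on
    \<open>K\<close>, and \<open>2 * B + 1\<close> on a set of measure at most \<open>e\<close>.
    This happens for \<open>\<mu> n\<close> and for \<open>\<nu>\<close>; convergence of the
    approximation costs one more \<open>e\<close>, which adds up to
    \<open>(4 * B + 5) * e\<close>.\<close>
  have main: "\<forall>\<^sub>F n in sequentially. \<bar>(\<integral>v. F v \<partial>\<mu> n) - (\<integral>v. F v \<partial>\<nu>)\<bar> < (4 * B + 5) * e"
    if e: "0 < e" "e \<le> 1" for e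
  proof -
    obtain k1 n1 where k1: "\<And>n. n1 \<le> n \<Longrightarrow> measure (\<mu> n) {v. \<exists>j. real k1 * w j ^ k1 < \<bar>pairing v (\<psi> j)\<bar>} \<le> e"
      using tight[OF w sw \<psi> e(1)] by blast
    interpret \<nu>: tempered_convergence "\<lambda>_. \<nu>" \<nu>
      by (intro tempered_convergence.intro prob_\<nu> sets_\<nu> tendsto_const)
    obtain k2 where k2: "measure \<nu> {v. \<exists>j. real k2 * w j ^ k2 < \<bar>pairing v (\<psi> j)\<bar>} \<le> e"
      using \<nu>.tight[OF w sw \<psi> e(1)] by blast
    define k where "k = max k1 k2"
    \<comment> \<open>\<open>Suc k\<close> in place of \<open>k\<close> keeps \<open>R j\<close>
      positive even for \<open>k = 0\<close>, as the divisions below require.\<close>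
    define R where "R j = real (Suc k) * w j ^ k" for j
    have R0: "0 < R j" for j using w0[of j] by (simp add: R_def del: of_nat_Suc)
    have R_ge: "real l * w j ^ l \<le> R j" if "l \<le> k" for l j
      unfolding R_def using w[of j] w0[of j] that by (intro mult_mono power_increasing) auto
    define K where "K = {v. \<forall>j. \<bar>pairing v (\<psi> j)\<bar> \<le> R j}"
    have K_sets: "K \<in> sets M" if "sets M = sets cylindrical" for M
    proof -
      note that[measurable_cong]
      have "Measurable.pred M (\<lambda>v. \<forall>j. \<bar>pairing v (\<psi> j)\<bar> \<le> R j)" by measurable
      then show ?thesis using sets_eq_imp_space_eq[OF that] by (simp add: pred_def K_def)
    qed
    have K_measure: "measure M (- K) \<le> e"
      if M: "prob_space M" "sets M = sets cylindrical" and l: "l \<le> k"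
        "measure M {v. \<exists>j. real l * w j ^ l < \<bar>pairing v (\<psi> j)\<bar>} \<le> e" for M l
    proof -
      interpret M: prob_space M by fact
      note M(2)[measurable_cong]
      have sp: "space M = UNIV" using sets_eq_imp_space_eq[OF M(2)] by simp
      have "Measurable.pred M (\<lambda>v. \<exists>j. real l * w j ^ l < \<bar>pairing v (\<psi> j)\<bar>)" by measurable
      then have "{v. \<exists>j. real l * w j ^ l < \<bar>pairing v (\<psi> j)\<bar>} \<in> sets M" by (simp add: pred_def sp)
      moreover have "- K \<subseteq> {v. \<exists>j. real l * w j ^ l < \<bar>pairing v (\<psi> j)\<bar>}"
      proof
        fix v assume "v \<in> - K"
        then obtain j where "R j < \<bar>pairing v (\<psi> j)\<bar>" by (auto simp: K_def not_le)
        with R_ge[OF l(1), of j] have "real l * w j ^ l < \<bar>pairing v (\<psi> j)\<bar>" by (rule le_less_trans)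
        then show "v \<in> {v. \<exists>j. real l * w j ^ l < \<bar>pairing v (\<psi> j)\<bar>}" by blast
      qed
      ultimately show ?thesis using M.finite_measure_mono l(2) by (meson order_trans)
    qed
    \<comment> \<open>Rescaled \<open>arcsin\<close> maps the cube onto the box with sides
      \<open>R j\<close> and inverts there the map \<open>\<sigma>\<close> introduced below.\<close>
    define y where "y z j = arcsin (z j) * (2 * R j / pi)" for z :: "nat \<Rightarrow> real" and j
    have y_le: "\<bar>y z j\<bar> \<le> R j" if "z \<in> unit_cube" for z j
    proof -
      have "\<bar>arcsin (z j)\<bar> \<le> pi / 2"
        using that arcsin_bounded[of "z j"] by (auto simp: unit_cube_def abs_le_iff minus_le_iff)
      then have "\<bar>arcsin (z j)\<bar> * (2 * R j / pi) \<le> pi / 2 * (2 * R j / pi)"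
        using R0[of j] by (intro mult_right_mono) auto
      then show ?thesis using R0[of j] by (simp add: y_def abs_mult)
    qed
    \<comment> \<open>The exponent \<open>Suc k\<close> absorbs the growth \<open>w j ^ k\<close> of
      \<open>R j\<close> and leaves a summable factor, collected in \<open>a\<close>.\<close>
    obtain m C where C: "0 \<le> C" "\<And>j \<phi>. \<bar>pairing (c j) \<phi>\<bar> * w j ^ Suc k \<le> C * schwartz_norm m \<phi>"
      using c by blast
    define a where "a j = real (Suc k) * C * inverse (w j)" for j
    have a: "summable a" "0 \<le> a j" for j
      using C(1) less_imp_le[OF w0[of j]] unfolding a_def[abs_def]
      by (auto intro!: summable_mult sw mult_nonneg_nonneg)
    have R_c: "R j * \<bar>pairing (c j) \<phi>\<bar> \<le> a j * schwartz_norm m \<phi>" for j \<phi>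
    proof -
      have "R j * \<bar>pairing (c j) \<phi>\<bar> = real (Suc k) * inverse (w j) * (\<bar>pairing (c j) \<phi>\<bar> * w j ^ Suc k)"
        using w0[of j] by (simp add: R_def field_simps del: of_nat_Suc)
      also have "\<dots> \<le> real (Suc k) * inverse (w j) * (C * schwartz_norm m \<phi>)"
        using w0[of j] by (intro mult_left_mono C) auto
      finally show ?thesis by (simp add: a_def mult_ac)
    qed
    have y_c: "\<bar>y z j * pairing (c j) \<phi>\<bar> \<le> a j * schwartz_norm m \<phi>" if "z \<in> unit_cube" for z j \<phi>
      using mult_right_mono[OF y_le[OF that, of j] abs_ge_zero[of "pairing (c j) \<phi>"]] R_c[of j \<phi>]
      unfolding abs_mult by linarith
    have y_summable: "summable (\<lambda>j. y z j * pairing (c j) \<phi>)" if "z \<in> unit_cube" for z \<phi>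
      using y_c[OF that] by (intro summable_comparison_test'[OF summable_mult2[OF a(1)]]) auto
    define \<Lambda> where "\<Lambda> z = Abs_tempered (\<lambda>\<phi>. \<Sum>j. y z j * pairing (c j) \<phi>)" for z
    have pairing_\<Lambda>: "pairing (\<Lambda> z) \<phi> = (\<Sum>j. y z j * pairing (c j) \<phi>)" if z: "z \<in> unit_cube" for z \<phi>
    proof -
      let ?u = "\<lambda>\<phi>. \<Sum>j. y z j * pairing (c j) \<phi>"
      have lin: "linear ?u"
      proof (rule linearI)
        fix \<phi>1 \<phi>2 :: "'a schwartz" and r :: real
        show "?u (\<phi>1 + \<phi>2) = ?u \<phi>1 + ?u \<phi>2"
          using suminf_add[OF y_summable[OF z] y_summable[OF z], of \<phi>1 \<phi>2]
          by (simp add: linear_add[OF linear_pairing] distrib_left)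
        show "?u (r *\<^sub>R \<phi>1) = r *\<^sub>R ?u \<phi>1"
          using suminf_mult[OF y_summable[OF z], of r \<phi>1]
          by (simp add: linear_scale[OF linear_pairing] mult.left_commute)
      qed
      have "\<bar>?u \<phi>\<bar> \<le> suminf a * schwartz_norm m \<phi>" for \<phi>
      proof -
        have "norm (?u \<phi>) \<le> (\<Sum>j. a j * schwartz_norm m \<phi>)"
          using y_c[OF z] by (intro norm_suminf_le summable_mult2 a) auto
        then show ?thesis using suminf_mult2[OF a(1), of "schwartz_norm m \<phi>"] by simp
      qed
      then have "continuous_on UNIV ?u" by (rule continuous_functional_normI[OF lin])
      with lin show ?thesis unfolding \<Lambda>_def by (subst Abs_tempered_inverse) auto
    qed
    have cont_\<Lambda>: "continuous_on unit_cube \<Lambda>"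
      unfolding continuous_on_def
    proof (intro ballI topological_tendstoI)
      fix z0 U assume z0: "z0 \<in> unit_cube" and U: "open U" "\<Lambda> z0 \<in> U"
      obtain X d where X: "schwartz_bounded X" "0 < d"
        "{v. \<forall>\<phi>\<in>X. \<bar>pairing v \<phi> - pairing (\<Lambda> z0) \<phi>\<bar> < d} \<subseteq> U"
        using bspec[OF U(1)[unfolded open_tempered_def] U(2)] by (elim exE conjE)
      obtain D where D: "0 \<le> D" "\<And>\<phi>. \<phi> \<in> X \<Longrightarrow> schwartz_norm m \<phi> \<le> D"
        by (rule schwartz_norm_bounded[OF X(1)]) blast
      \<comment> \<open>The bounded set \<open>X\<close> of a strong neighbourhood has bounded
        \<open>schwartz_norm m\<close>. So one series free of \<open>\<phi>\<close> controls all
        pairings at once, and it is continuous in \<open>z\<close> by the Weierstrass test with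
        majorant \<open>2 * a j\<close>.\<close>
      let ?h = "\<lambda>j z. \<bar>y z j - y z0 j\<bar> * (a j / R j)"
      have h_le: "?h j z \<le> 2 * a j" if "z \<in> unit_cube" for j z
      proof -
        have "\<bar>y z j - y z0 j\<bar> \<le> 2 * R j" using y_le[OF that, of j] y_le[OF z0, of j] by linarith
        then have "?h j z \<le> 2 * R j * (a j / R j)" using a(2)[of j] R0[of j] by (intro mult_right_mono) auto
        then show ?thesis using R0[of j] by simp
      qed
      have h_nonneg: "0 \<le> ?h j z" for j z using a(2)[of j] R0[of j] by simp
      have h_norm: "norm (?h j z) \<le> 2 * a j" if "z \<in> unit_cube" for j z
        using h_le[OF that, of j] h_nonneg[of z j] by (simp only: real_norm_def abs_of_nonneg)
      have h_summable: "summable (\<lambda>j. ?h j z)" if "z \<in> unit_cube" for z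
        using h_norm[OF that] by (rule summable_comparison_test'[OF summable_mult[OF a(1), of 2]])
      have "continuous_on unit_cube (\<lambda>z. \<Sum>j. ?h j z)"
      proof (rule uniform_limit_theorem)
        show "uniform_limit unit_cube (\<lambda>n z. \<Sum>j<n. ?h j z) (\<lambda>z. \<Sum>j. ?h j z) sequentially"
          by (intro Weierstrass_m_test[where M = "\<lambda>j. 2 * a j"] summable_mult a h_norm)
        have "continuous_on unit_cube (\<lambda>z. y z j)" for j
          unfolding y_def
          by (intro continuous_intros continuous_on_subset[OF continuous_on_product_coordinates] ballI)
            (auto simp: unit_cube_def abs_le_iff minus_le_iff)
        then show "\<forall>\<^sub>F n in sequentially. continuous_on unit_cube (\<lambda>z. \<Sum>j<n. ?h j z)"
          by (intro always_eventually allI continuous_intros)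
      qed simp
      then have "((\<lambda>z. \<Sum>j. ?h j z) \<longlongrightarrow> (\<Sum>j. ?h j z0)) (at z0 within unit_cube)"
        using z0 unfolding continuous_on_def by blast
      then have "\<forall>\<^sub>F z in at z0 within unit_cube. (\<Sum>j. ?h j z) < d / (D + 1)"
        using X(2) D(1) by (intro order_tendstoD(2)) auto
      moreover have "\<forall>\<^sub>F z in at z0 within unit_cube. z \<in> unit_cube" by (simp add: eventually_at_filter)
      ultimately show "\<forall>\<^sub>F z in at z0 within unit_cube. \<Lambda> z \<in> U"
      proof eventually_elim
        case (elim z)
        have "\<bar>pairing (\<Lambda> z) \<phi> - pairing (\<Lambda> z0) \<phi>\<bar> < d" if \<phi>: "\<phi> \<in> X" for \<phi>
        proof -
          have diff_le: "norm (y z j * pairing (c j) \<phi> - y z0 j * pairing (c j) \<phi>) \<le> ?h j z * D" for j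
          proof -
            have "\<bar>pairing (c j) \<phi>\<bar> \<le> a j / R j * D"
            proof -
              have "R j * \<bar>pairing (c j) \<phi>\<bar> \<le> a j * D"
                using R_c[of j \<phi>] mult_left_mono[OF D(2)[OF \<phi>] a(2)[of j]] by linarith
              then show ?thesis using R0[of j] by (simp add: field_simps)
            qed
            then have "\<bar>y z j - y z0 j\<bar> * \<bar>pairing (c j) \<phi>\<bar> \<le> \<bar>y z j - y z0 j\<bar> * (a j / R j * D)"
              by (rule mult_left_mono) simp
            then show ?thesis by (simp add: left_diff_distrib[symmetric] abs_mult mult.assoc)
          qed
          have "pairing (\<Lambda> z) \<phi> - pairing (\<Lambda> z0) \<phi> = (\<Sum>j. y z j * pairing (c j) \<phi> - y z0 j * pairing (c j) \<phi>)"
            using elim z0 by (simp add: pairing_\<Lambda> suminf_diff y_summable)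
          also have "norm \<dots> \<le> (\<Sum>j. ?h j z * D)"
            using elim by (intro norm_suminf_le diff_le summable_mult2 h_summable)
          also have "\<dots> = (\<Sum>j. ?h j z) * D" using suminf_mult2[OF h_summable] elim by simp
          also have "\<dots> \<le> d / (D + 1) * D" using elim D(1) by (intro mult_right_mono) auto
          also have "\<dots> < d" using X(2) D(1) by (simp add: field_simps)
          finally show ?thesis by simp
        qed
        then show ?case using X(3) by blast
      qed
    qed
    have "continuous_on unit_cube (\<lambda>z. F (\<Lambda> z))"
      by (rule continuous_on_compose2[OF F(1) cont_\<Lambda>]) auto
    then obtain P where P: "coord_poly P" "\<And>z. z \<in> unit_cube \<Longrightarrow> \<bar>F (\<Lambda> z) - P z\<bar> < e"
      using coord_poly_dense e(1) by blast
    define \<sigma> where "\<sigma> v = (\<lambda>j. sin (pairing v (\<psi> j) * (pi / (2 * R j))))" for v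
    have \<sigma>: "\<sigma> v \<in> unit_cube" for v by (simp add: \<sigma>_def unit_cube_def abs_sin_le_one)
    let ?G = "\<lambda>v. P (\<sigma> v)"
    have G: "trig_poly ?G" unfolding \<sigma>_def by (rule trig_poly_coord_poly[OF P(1)])
    \<comment> \<open>The sines put every \<open>\<sigma> v\<close> into the cube, so
      \<open>P\<close> is within \<open>e \<le> 1\<close> of a value of \<open>F\<close> even when
      \<open>v\<close> lies outside \<open>K\<close>.\<close>
    have G_le: "\<bar>F v - ?G v\<bar> \<le> 2 * B + 1" for v
      using P(2)[OF \<sigma>, of v] F(2)[of v] F(2)[of "\<Lambda> (\<sigma> v)"] e(2) by linarith
    \<comment> \<open>On \<open>K\<close> the arguments of the sines stay within the range inverted
      by \<open>arcsin\<close>, so \<open>\<Lambda> (\<sigma> v)\<close> has the coordinates of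
      \<open>v\<close> and, by the expansion, equals \<open>v\<close>.\<close>
    have G_K: "\<bar>F v - ?G v\<bar> \<le> e" if v: "v \<in> K" for v
    proof -
      have "y (\<sigma> v) j = pairing v (\<psi> j)" for j
      proof -
        have "\<bar>pairing v (\<psi> j) * (pi / (2 * R j))\<bar> \<le> R j * (pi / (2 * R j))"
          using v R0[of j] unfolding abs_mult by (intro mult_mono) (auto simp: K_def)
        also have "\<dots> = pi / 2" using R0[of j] by simp
        finally have le: "\<bar>pairing v (\<psi> j) * (pi / (2 * R j))\<bar> \<le> pi / 2" .
        have "- (pi / 2) \<le> pairing v (\<psi> j) * (pi / (2 * R j))"
          using abs_le_D2[OF le] by (simp only: minus_le_iff)
        then have "arcsin (sin (pairing v (\<psi> j) * (pi / (2 * R j)))) = pairing v (\<psi> j) * (pi / (2 * R j))"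
          using abs_le_D1[OF le] by (rule arcsin_sin)
        then show ?thesis using R0[of j] by (simp add: y_def \<sigma>_def)
      qed
      then have "pairing (\<Lambda> (\<sigma> v)) \<phi> = pairing v \<phi>" for \<phi>
        using expand[of \<phi> v] by (simp add: pairing_\<Lambda>[OF \<sigma>] sums_iff mult.commute)
      then have "\<Lambda> (\<sigma> v) = v" by (simp add: pairing_inject[symmetric] fun_eq_iff)
      with P(2)[OF \<sigma>, of v] show ?thesis by simp
    qed
    have close: "\<bar>(\<integral>v. F v \<partial>M) - (\<integral>v. ?G v \<partial>M)\<bar> \<le> e + (2 * B + 1) * e"
      if M: "prob_space M" "sets M = sets cylindrical" and K: "measure M (- K) \<le> e" for M
    proof -
      interpret M: prob_space M by fact
      note M(2)[measurable_cong]
      have sp: "space M = UNIV" using sets_eq_imp_space_eq[OF M(2)] by simp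
      have F_int: "integrable M F"
        by (rule M.integrable_const_bound[where B = B]) (auto simp: F(2))
      have G_int: "integrable M ?G" using trig_poly_tendsto[OF G] M by blast
      have K': "- K \<in> sets M" using sets.compl_sets[OF K_sets[OF M(2)]] by (simp add: sp Compl_eq_Diff_UNIV)
      have "\<bar>(\<integral>v. F v \<partial>M) - (\<integral>v. ?G v \<partial>M)\<bar> = \<bar>\<integral>v. F v - ?G v \<partial>M\<bar>"
        using F_int G_int by simp
      also have "\<dots> \<le> (\<integral>v. \<bar>F v - ?G v\<bar> \<partial>M)" by (rule integral_abs_bound)
      also have "\<dots> \<le> (\<integral>v. e + (2 * B + 1) * indicator (- K) v \<partial>M)"
      proof (rule integral_mono)
        show "integrable M (\<lambda>v. \<bar>F v - ?G v\<bar>)" using F_int G_int by auto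
        show "integrable M (\<lambda>v. e + (2 * B + 1) * indicator (- K) v)"
          using K' by (intro Bochner_Integration.integrable_add integrable_mult_right impI) (auto simp: M.emeasure_eq_measure)
        show "\<bar>F v - ?G v\<bar> \<le> e + (2 * B + 1) * indicator (- K) v" for v
          using G_le[of v] G_K[of v] e(1) by (cases "v \<in> K") auto
      qed
      also have "\<dots> = e + (2 * B + 1) * measure M (- K)"
        using K' by (subst Bochner_Integration.integral_add) (auto simp: M.prob_space M.emeasure_eq_measure)
      also have "\<dots> \<le> e + (2 * B + 1) * e" using K B by (intro add_left_mono mult_left_mono) auto
      finally show ?thesis .
    qed
    have close_\<mu>: "\<bar>(\<integral>v. F v \<partial>\<mu> n) - (\<integral>v. ?G v \<partial>\<mu> n)\<bar> \<le> e + (2 * B + 1) * e" if "n1 \<le> n" for n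
      by (intro close K_measure[of _ k1] prob_\<mu> sets_\<mu> k1 that) (simp add: k_def)
    have close_\<nu>: "\<bar>(\<integral>v. F v \<partial>\<nu>) - (\<integral>v. ?G v \<partial>\<nu>)\<bar> \<le> e + (2 * B + 1) * e"
      by (intro close K_measure[of _ k2] prob_\<nu> sets_\<nu> k2) (simp add: k_def)
    have "(\<lambda>n. \<integral>v. ?G v \<partial>\<mu> n) \<longlonglongrightarrow> (\<integral>v. ?G v \<partial>\<nu>)" using trig_poly_tendsto[OF G] by blast
    then have "\<forall>\<^sub>F n in sequentially. dist (\<integral>v. ?G v \<partial>\<mu> n) (\<integral>v. ?G v \<partial>\<nu>) < e"
      using e(1) by (rule tendstoD)
    then show ?thesis using eventually_ge_at_top[of n1]
    proof eventually_elim
      case (elim n)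
      have "(4 * B + 5) * e = (e + (2 * B + 1) * e) + (e + (2 * B + 1) * e) + e" by (simp add: algebra_simps)
      then show ?case using elim(1) close_\<mu>[OF elim(2)] close_\<nu> unfolding dist_real_def by linarith
    qed
  qed
  show ?thesis
  proof (rule tendstoI)
    fix d :: real assume d: "0 < d"
    define e where "e = min 1 (d / (4 * B + 5))"
    have e: "0 < e" "e \<le> 1" using d B by (auto simp: e_def)
    have "(4 * B + 5) * e \<le> (4 * B + 5) * (d / (4 * B + 5))"
      using B by (intro mult_left_mono) (auto simp: e_def)
    also have "\<dots> = d" using B by simp
    finally have "(4 * B + 5) * e \<le> d" .
    with main[OF e] show "\<forall>\<^sub>F n in sequentially. dist (\<integral>v. F v \<partial>\<mu> n) (\<integral>v. F v \<partial>\<nu>) < d"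
      by (auto simp: dist_real_def elim!: eventually_mono)
  qed
qed

end

section \<open>Levy exponents and their Poisson approximations\<close>

lemma levy_exponent_Re_le_0:
  assumes "levy_exponent f"
  shows "Re (f \<xi>) \<le> 0"
proof -
  obtain \<mu> \<sigma>2 V where f: "levy_triplet f \<mu> \<sigma>2 V" using assms unfolding levy_exponent_def by blast
  let ?g = "\<lambda>t. iexp (\<xi> * t) - 1 - \<i> * \<xi> * t * indicator {t. \<bar>t\<bar> \<le> 1} t"
  have "Re (\<integral>t. ?g t \<partial>V) \<le> 0"
  \<comment> \<open>The real part of the integrand is \<open>cos (\<xi> * t) - 1\<close>. In the
    non-integrable case the Bochner integral has the default value 0, which also satisfies the
    bound.\<close>
  proof (cases "integrable V ?g")
    case True
    have "0 \<le> (\<integral>t. - Re (?g t) \<partial>V)"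
    proof (intro integral_nonneg_AE AE_I2)
      fix t
      have "Re (?g t) = cos (\<xi> * t) - 1"
        by (simp add: Re_exp indicator_def)
      then show "0 \<le> - Re (?g t)" by (simp only: neg_0_le_iff_le diff_le_0_iff_le cos_le_one)
    qed
    also have "\<dots> = - Re (\<integral>t. ?g t \<partial>V)"
      by (simp only: Bochner_Integration.integral_minus integral_Re[OF True])
    finally show ?thesis by simp
  qed (simp add: not_integrable_integral_eq)
  moreover have f_eq: "f \<xi> = \<i> * \<mu> * \<xi> - \<sigma>2 * \<xi>\<^sup>2 / 2 + (\<integral>t. ?g t \<partial>V)" and \<sigma>2: "0 \<le> \<sigma>2"
    using f unfolding levy_triplet_def by auto
  moreover have "Re (\<i> * \<mu> * \<xi> - \<sigma>2 * \<xi>\<^sup>2 / 2) \<le> 0"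
    using \<sigma>2 by (simp flip: of_real_power of_real_mult)
  ultimately show ?thesis by (simp only: f_eq plus_complex.sel add_nonpos_nonpos)
qed

text \<open>Mean value inequality on the convex left half-plane, where the derivative of
  \<open>exp\<close> has modulus at most 1.\<close>

lemma norm_exp_minus_1_le:
  assumes "Re z \<le> 0"
  shows "norm (exp z - 1) \<le> norm z"
proof -
  have "norm (exp z - exp 0) \<le> 1 * norm (z - 0)"
  proof (rule field_differentiable_bound[where f = exp and f' = exp and S = "{z. Re z \<le> 0}"])
    show "convex {z. Re z \<le> 0}" by (rule convex_halfspace_Re_le)
    show "(exp has_field_derivative exp z) (at z within {z. Re z \<le> 0})" for z :: complex
      by (rule DERIV_subset[OF DERIV_exp]) simp
  qed (use assms in auto)
  then show ?thesis by simp
qed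

text \<open>The difference quotient of \<open>exp\<close> at 0 along \<open>z / n\<close>; it
  requires a nonzero increment, so \<open>z = 0\<close> is treated apart.\<close>

lemma exp_divide_tendsto:
  fixes z :: complex
  shows "(\<lambda>n. of_nat n * (exp (z / of_nat n) - 1)) \<longlonglongrightarrow> z"
proof (cases "z = 0")
  case False
  have "((\<lambda>h. (exp h - 1) / h) \<longlongrightarrow> 1) (at (0::complex))"
    using DERIV_exp[of "0::complex"] by (simp add: DERIV_def)
  moreover have "filterlim (\<lambda>n. z / of_nat n) (at 0) sequentially"
    unfolding filterlim_at
  proof
    show "(\<lambda>n. z / of_nat n) \<longlonglongrightarrow> 0" by (rule lim_const_over_n)
    show "\<forall>\<^sub>F n in sequentially. z / of_nat n \<in> UNIV \<and> z / of_nat n \<noteq> 0"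
      using eventually_gt_at_top[of 0] by eventually_elim (use False in simp)
  qed
  ultimately have "(\<lambda>n. (exp (z / of_nat n) - 1) / (z / of_nat n)) \<longlonglongrightarrow> 1"
    by (rule filterlim_compose)
  from tendsto_mult_left[OF this, of z] show ?thesis using False by (simp add: mult.commute)
qed simp

text \<open>The relation \<open>levy_functional\<close> carries integrability, so it supplies both
  the majorant \<open>norm (f (g x))\<close> and the measurability of all integrands.\<close>

lemma levy_functional_tendsto:
  assumes f: "\<And>\<xi>. Re (f \<xi>) \<le> 0" and c: "levy_functional f g c"
    and cn: "\<And>n. levy_functional (\<lambda>\<xi>. of_nat (Suc n) * (exp (f \<xi> / of_nat (Suc n)) - 1)) g (cn n)"
  shows "cn \<longlonglongrightarrow> c"
proof -
  let ?f = "\<lambda>n \<xi>. of_nat (Suc n) * (exp (f \<xi> / of_nat (Suc n)) - 1)"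
  obtain J where J: "has_bochner_integral lborel (\<lambda>x. f (g x)) J" "c = exp J"
    using c unfolding levy_functional_def by blast
  obtain Jn where Jn: "\<And>n. has_bochner_integral lborel (\<lambda>x. ?f n (g x)) (Jn n)" "\<And>n. cn n = exp (Jn n)"
    using cn unfolding levy_functional_def by metis
  have "(\<lambda>n. \<integral>x. ?f n (g x) \<partial>lborel) \<longlonglongrightarrow> (\<integral>x. f (g x) \<partial>lborel)"
  proof (rule integral_dominated_convergence)
    show "(\<lambda>x. f (g x)) \<in> borel_measurable lborel" "\<And>n. (\<lambda>x. ?f n (g x)) \<in> borel_measurable lborel"
      using J(1) Jn(1) by (auto simp: has_bochner_integral_iff simp del: of_nat_Suc)
    show "integrable lborel (\<lambda>x. norm (f (g x)))"
      using J(1) by (auto simp: has_bochner_integral_iff)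
    show "AE x in lborel. (\<lambda>n. ?f n (g x)) \<longlonglongrightarrow> f (g x)"
      by (intro AE_I2 LIMSEQ_Suc exp_divide_tendsto)
    show "AE x in lborel. norm (?f n (g x)) \<le> norm (f (g x))" for n
    proof (intro AE_I2)
      fix x
      have "norm (exp (f (g x) / of_nat (Suc n)) - 1) \<le> norm (f (g x) / of_nat (Suc n))"
        using f[of "g x"] by (intro norm_exp_minus_1_le) (simp add: Re_divide_of_nat divide_nonpos_pos)
      then have "real (Suc n) * norm (exp (f (g x) / of_nat (Suc n)) - 1) \<le> real (Suc n) * norm (f (g x) / of_nat (Suc n))"
        by (rule mult_left_mono) simp
      also have "\<dots> = norm (f (g x))" by (simp add: norm_divide del: of_nat_Suc)
      finally show "norm (?f n (g x)) \<le> norm (f (g x))" by (simp only: norm_mult norm_of_nat)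
    qed
  qed
  then have "Jn \<longlonglongrightarrow> J"
    using J(1) Jn(1) by (simp add: has_bochner_integral_iff)
  then show ?thesis unfolding J(2) Jn(2)[abs_def] by (rule tendsto_exp)
qed

lemma process_law_prob_space:
  assumes "generalized_random_process M s"
  shows "prob_space (process_law M s)"
  using assms unfolding generalized_random_process_def process_law_def
  by (auto intro: prob_space.prob_space_distr)

lemma char_functional_process_law:
  assumes "generalized_random_process M s"
  shows "(\<integral>v. iexp (pairing v \<phi>) \<partial>process_law M s) = char_functional M s \<phi>"
proof -
  note measurable_pairing[measurable]
  show ?thesis
    using assms unfolding generalized_random_process_def process_law_def char_functional_def
    by (intro integral_distr) auto
qed

theorem levy_continuity:
  fixes s :: "'b \<Rightarrow> 'a::euclidean_space tempered" and sn :: "nat \<Rightarrow> 'c \<Rightarrow> 'a tempered"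
  assumes s: "generalized_random_process M s" "\<And>n. generalized_random_process (Mn n) (sn n)"
    and conv: "\<And>\<phi>. (\<lambda>n. char_functional (Mn n) (sn n) \<phi>) \<longlonglongrightarrow> char_functional M s \<phi>"
  shows "converges_in_law Mn sn M s"
  unfolding converges_in_law_def
proof (intro allI impI, elim conjE)
  fix F :: "'a tempered \<Rightarrow> real"
  assume F: "continuous_on UNIV F" "bounded (range F)"
  interpret tempered_convergence "\<lambda>n. process_law (Mn n) (sn n)" "process_law M s"
  proof (rule tempered_convergence.intro)
    show "sets (process_law (Mn n) (sn n)) = sets cylindrical" "sets (process_law M s) = sets cylindrical" for n
      by (simp_all add: process_law_def)
  qed (simp_all only: process_law_prob_space char_functional_process_law s conv)
  show "(\<lambda>n. \<integral>v. F v \<partial>process_law (Mn n) (sn n)) \<longlonglongrightarrow> (\<integral>v. F v \<partial>process_law M s)"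
  \<comment> \<open>\<open>converges_in_law\<close> ranges over all bounded continuous
    \<open>F\<close>, without a measurability requirement; hence the case distinction.\<close>
  proof (cases "F \<in> borel_measurable cylindrical")
    case True
    obtain B where "\<And>v. \<bar>F v\<bar> \<le> B" using F(2) by (auto simp: bounded_iff)
    then show ?thesis by (rule integral_tendsto[OF F(1) _ True])
  next
    case False
    \<comment> \<open>All the Bochner integrals have the junk value \<open>0\<close>.\<close>
    then have "(\<integral>v. F v \<partial>M) = 0" if "sets M = sets cylindrical" for M
      using borel_measurable_integrable[of M F] measurable_cong_sets[OF that refl, of borel]
      by (intro not_integrable_integral_eq notI) auto
    then show ?thesis by (simp add: process_law_def)
  qed
qed

theorem theorem1:
  fixes L :: "(real ^ 'd) schwartz \<Rightarrow> (real ^ 'd) tempered"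
    and T :: "(real ^ 'd) tempered \<Rightarrow> real ^ 'd \<Rightarrow> real"
    and f :: "real \<Rightarrow> complex" and pmin pmax :: real
    and W :: "'w measure" and w :: "'w \<Rightarrow> (real ^ 'd) tempered"
    and S :: "'s measure" and s :: "'s \<Rightarrow> (real ^ 'd) tempered"
    and W\<^sub>n :: "nat \<Rightarrow> 'v measure" and w\<^sub>n :: "nat \<Rightarrow> 'v \<Rightarrow> (real ^ 'd) tempered"
    and S\<^sub>n :: "nat \<Rightarrow> 'r measure" and s\<^sub>n :: "nat \<Rightarrow> 'r \<Rightarrow> (real ^ 'd) tempered"
  defines "f\<^sub>n \<equiv> \<lambda>n \<xi>. of_nat n * (exp (f \<xi> / of_nat n) - 1)"
  assumes "spline_admissible L"
    and "levy_white_noise f W w"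
    and "compatible_via pmin pmax T L f"
    and "inverse_process T f S s"
    and "\<And>n. 1 \<le> n \<Longrightarrow> impulsive_noise_with_exponent (f\<^sub>n n) (W\<^sub>n n) (w\<^sub>n n)"
    and "\<And>n. 1 \<le> n \<Longrightarrow> inverse_process T (f\<^sub>n n) (S\<^sub>n n) (s\<^sub>n n)"
  shows "converges_in_law S\<^sub>n s\<^sub>n S s"
proof -
  have Re_f: "Re (f \<xi>) \<le> 0" for \<xi>
    using assms(3) levy_exponent_Re_le_0 unfolding levy_white_noise_def by blast
  have sn: "inverse_process T (f\<^sub>n (Suc n)) (S\<^sub>n (Suc n)) (s\<^sub>n (Suc n))" for n
    by (rule assms(7)) simp
  \<comment> \<open>The hypotheses on the approximating processes start at index 1, so the sequence
    is shifted; the limit does not see the first term.\<close>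
  have "converges_in_law (\<lambda>n. S\<^sub>n (Suc n)) (\<lambda>n. s\<^sub>n (Suc n)) S s"
  proof (rule levy_continuity)
    show "generalized_random_process S s" "\<And>n. generalized_random_process (S\<^sub>n (Suc n)) (s\<^sub>n (Suc n))"
      using assms(5) sn unfolding inverse_process_def by blast+
    fix \<phi>
    show "(\<lambda>n. char_functional (S\<^sub>n (Suc n)) (s\<^sub>n (Suc n)) \<phi>) \<longlonglongrightarrow> char_functional S s \<phi>"
    proof (rule levy_functional_tendsto[OF Re_f])
      show "levy_functional f (T (tempered_of_schwartz \<phi>)) (char_functional S s \<phi>)"
        using assms(5) unfolding inverse_process_def by blast
      show "levy_functional (\<lambda>\<xi>. of_nat (Suc n) * (exp (f \<xi> / of_nat (Suc n)) - 1))
          (T (tempered_of_schwartz \<phi>)) (char_functional (S\<^sub>n (Suc n)) (s\<^sub>n (Suc n)) \<phi>)" for n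
        using sn[of n] unfolding inverse_process_def f\<^sub>n_def by blast
    qed
  qed
  then show ?thesis
    unfolding converges_in_law_def by (blast intro: LIMSEQ_imp_Suc)
qed

end
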